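(* Let $d \geq 2$ and $n \geq d$ be integers. Then for all real $B \geq 2$ and $A \geq B^{1/(n+1-d)}$, \[ \frac{1}{\# \mathbb{V}_{d,n}(A)} \sum_{V \in \mathbb{V}_{d,n}(A)} N_V(B) = C_{d,n} \frac{B}{A} \left( 1 + O\left( \frac{B^{1/(n+1-d)}}{A} + \frac{\log B}{B^{1/(n+1-d)}} \right) \right), \] where the implied constant depends only on $d$ and $n$, and $C_{d,n} > 0$ is the constant \[ C_{d,n} = \frac{1}{2\zeta(n+1)} \cdot \frac{V_{N_{d,n}-1}}{V_{N_{d,n}}} \cdot \frac{\zeta(N_{d,n})}{\zeta(N_{d,n}-1)} \cdot \int_{\mathcal{B}_{n+1}(1)} \frac{\mathrm{d}\mathbf{t}}{\|\nu_{d,n}(\mathbf{t})\|}. \]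
   Context: $\|\cdot\|$ is the Euclidean norm; $\mathcal{B}_N(u) = \{\mathbf{y} \in \mathbb{R}^N : \|\mathbf{y}\| \leq u\}$ and $V_N$ is the volume of $\mathcal{B}_N(1)$; $\zeta$ is the Riemann zeta function. $\mathbb{Z}^N_{\mathrm{prim}}$ is the set of integer vectors in $\mathbb{Z}^N$ whose coordinates have gcd $1$. $N_{d,n} = \binom{n+d}{d}$, and $\nu_{d,n} : \mathbb{R}^{n+1} \to \mathbb{R}^{N_{d,n}}$ is the Veronese map listing all monomials of degree $d$ in the $n+1$ coordinates in lexicographic order. Degree $d$ hypersurfaces in $\mathbb{P}^n$ over $\mathbb{Q}$ are parametrized by their coefficient vectors, i.e. by $\mathbb{V}_{d,n} = \mathbb{P}^{N_{d,n}-1}(\mathbb{Q})$; for $V \in \mathbb{V}_{d,n}$, $\mathbf{a}_V \in \mathbb{Z}^{N_{d,n}}_{\mathrm{prim}}$ is either of its two primitive coefficient vectors, and $\mathbb{V}_{d,n}(A) = \{V : \|\mathbf{a}_V\| \leq A\}$. For $x \in \mathbb{P}^n(\mathbb{Q})$ with primitive integral representative $\mathbf{x} \in \mathbb{Z}^{n+1}_{\mathrm{prim}}$, $H(x) = \|\mathbf{x}\|^{n+1-d}$. For $V \in \mathbb{V}_{d,n}$, $N_V(B) = \#\{x \in V(\mathbb{Q}) : H(x) \leq B\}$. *)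

theory Defs
  imports "HOL-Analysis.Analysis"
begin

definition mons :: "nat \<Rightarrow> nat \<Rightarrow> (nat \<Rightarrow> nat) set" where
  "mons d n = {e. (\<forall>i. n < i \<longrightarrow> e i = 0) \<and> (\<Sum>i\<le>n. e i) = d}"

definition Ndn :: "nat \<Rightarrow> nat \<Rightarrow> nat" where
  "Ndn d n = (n + d) choose d"

text \<open>Veronese map nu_{d,n}: coordinates indexed by the monomials (order irrelevant for the norm).\<close>
definition veronese :: "nat \<Rightarrow> nat \<Rightarrow> (nat \<Rightarrow> real) \<Rightarrow> (nat \<Rightarrow> nat) \<Rightarrow> real" where
  "veronese d n t = (\<lambda>e. if e \<in> mons d n then (\<Prod>i\<le>n. t i ^ e i) else 0)"

definition veronese_norm :: "nat \<Rightarrow> nat \<Rightarrow> (nat \<Rightarrow> real) \<Rightarrow> real" where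
  "veronese_norm d n t = sqrt (\<Sum>e\<in>mons d n. (veronese d n t e)\<^sup>2)"

definition int_vec :: "nat \<Rightarrow> (nat \<Rightarrow> int) \<Rightarrow> bool" where
  "int_vec n x \<longleftrightarrow> (\<forall>i. n < i \<longrightarrow> x i = 0)"

definition prim_vec :: "nat \<Rightarrow> (nat \<Rightarrow> int) \<Rightarrow> bool" where
  "prim_vec n x \<longleftrightarrow> int_vec n x \<and> Gcd (x ` {..n}) = 1"

definition vnorm :: "nat \<Rightarrow> (nat \<Rightarrow> int) \<Rightarrow> real" where
  "vnorm n x = sqrt (\<Sum>i\<le>n. (real_of_int (x i))\<^sup>2)"

definition coeff_vec :: "nat \<Rightarrow> nat \<Rightarrow> ((nat \<Rightarrow> nat) \<Rightarrow> int) \<Rightarrow> bool" where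
  "coeff_vec d n a \<longleftrightarrow> (\<forall>e. e \<notin> mons d n \<longrightarrow> a e = 0)"

definition prim_coeff :: "nat \<Rightarrow> nat \<Rightarrow> ((nat \<Rightarrow> nat) \<Rightarrow> int) \<Rightarrow> bool" where
  "prim_coeff d n a \<longleftrightarrow> coeff_vec d n a \<and> Gcd (a ` mons d n) = 1"

definition cnorm :: "nat \<Rightarrow> nat \<Rightarrow> ((nat \<Rightarrow> nat) \<Rightarrow> int) \<Rightarrow> real" where
  "cnorm d n a = sqrt (\<Sum>e\<in>mons d n. (real_of_int (a e))\<^sup>2)"

definition form_eval :: "nat \<Rightarrow> nat \<Rightarrow> ((nat \<Rightarrow> nat) \<Rightarrow> int) \<Rightarrow> (nat \<Rightarrow> int) \<Rightarrow> int" where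
  "form_eval d n a x = (\<Sum>e\<in>mons d n. a e * (\<Prod>i\<le>n. x i ^ e i))"

text \<open>A hypersurface V in V_{d,n} is identified with the pair {a_V, -a_V} of its primitive
  coefficient vectors; V_{d,n}(A) is the set of those with norm at most A.\<close>
definition hyps :: "nat \<Rightarrow> nat \<Rightarrow> real \<Rightarrow> ((nat \<Rightarrow> nat) \<Rightarrow> int) set set" where
  "hyps d n A = {{a, -a} | a. prim_coeff d n a \<and> cnorm d n a \<le> A}"

text \<open>Rational points x of P^n(Q) are identified with {x, -x}, x primitive integral;
  H(x) = ||x||^(n+1-d). N_V(B) counts points of V(Q) of height at most B.\<close>
definition NV :: "nat \<Rightarrow> nat \<Rightarrow> ((nat \<Rightarrow> nat) \<Rightarrow> int) set \<Rightarrow> real \<Rightarrow> nat" where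
  "NV d n V B = card {{x, -x} | x. prim_vec n x \<and> (\<exists>a\<in>V. form_eval d n a x = 0)
                        \<and> vnorm n x ^ (n + 1 - d) \<le> B}"

text \<open>Riemann zeta at real arguments s > 1 (we only use integer arguments >= 2).\<close>
definition zeta_nat :: "nat \<Rightarrow> real" where
  "zeta_nat s = (\<Sum>k. 1 / (real (Suc k)) ^ s)"

definition ver_integral :: "nat \<Rightarrow> nat \<Rightarrow> real" where
  "ver_integral d n = integral\<^sup>L (PiM {..n} (\<lambda>_. lborel))
     (\<lambda>t. indicator {t. (\<Sum>i\<le>n. (t i)\<^sup>2) \<le> 1} t / veronese_norm d n t)"

definition Cdn :: "nat \<Rightarrow> nat \<Rightarrow> real" where
  "Cdn d n = 1 / (2 * zeta_nat (n + 1))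
     * (unit_ball_vol (real (Ndn d n - 1)) / unit_ball_vol (real (Ndn d n)))
     * (zeta_nat (Ndn d n) / zeta_nat (Ndn d n - 1))
     * ver_integral d n"

end

theory Submission
  imports Defs "HOL-Computational_Algebra.Squarefree"
begin

text \<open>
  Summing over \<open>V\<close> and \<open>x\<close> in the other order, one counts for each primitive \<open>x\<close> of norm at most
  \<open>X = B powr (1 / (n + 1 - d))\<close> the primitive vectors \<open>a\<close> of norm at most \<open>A\<close> in the lattice orthogonal to \<open>\<nu>(x)\<close>,
  whose rank is \<open>M = N - 1\<close> and whose covolume is \<open>\<parallel>\<nu>(x)\<parallel>\<close>. With \<open>P\<close> the largest absolute value of a coordinate of
  \<open>x\<close>, attained at \<open>x p\<close>, projecting away the coefficient of \<open>x p ^ d\<close> turns this lattice into the solution set of one congruence modulo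
  \<open>P ^ d\<close>, which has exactly \<open>P ^ (M - d)\<close> points in every box of side \<open>P\<close>. Comparison with the volume of an
  ellipsoid gives the number of lattice points of norm at most \<open>T\<close> with error \<open>O(T ^ (M - 1) * P ^ (1 - d))\<close>, as long as
  \<open>T \<ge> P\<close>. Moebius inversion passes to primitive points; for the short vectors (\<open>T < P\<close>) that it brings in,
  either they all lie on a line, or two independent ones force the lattice to have at least about \<open>(P / T)\<^sup>2\<close> times
  as many points of norm at most \<open>2 * P\<close>. Finally the sum of \<open>1 / \<parallel>\<nu>(x)\<parallel>\<close> over integer vectors is a Riemann sum for
  the integral in the constant: the oscillation on the unit cube at \<open>x\<close> is \<open>O(\<parallel>x\<parallel> ^ (- d - 1))\<close>, and summing
  this over shells produces the logarithm.
\<close>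

section \<open>Moebius inversion\<close>

text \<open>The range is critical: A may be as small as X, so the error for each x may not exceed a
  constant times the main term even when P is about A. No logarithm can be lost in the lattice
  count, and this dictates the treatment of short vectors. Moebius inversion needs the count at all
  radii A / k with k <= A, and those with k > A / P lie below P, where a comparison with volumes
  says nothing. The gain (T / P)^2 over the O(P^(M - d)) points of norm at most 2 * P makes the sum
  over k > A / P converge; a gain T / P would cost a logarithm. Vectors on a line give at most 2 * P
  for each k, in total O(A * P), which M >= d + 2 makes harmless. The error A^(M - 1) * P^(1 - d),
  summed over the O(k^n) vectors x with P = k for all k <= X, is O(A^(M - 1) * X^(n + 2 - d)), that
  is X / A times the main term A^M * X^(n + 1 - d). The error log B / X stems from the sum of the
  inverse norms of the Veronese images alone.\<close>

definition moebius_mu :: "nat \<Rightarrow> real" where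
  "moebius_mu n = (if squarefree n then (-1) ^ card (prime_factors n) else 0)"

lemma abs_moebius_le_1: "\<bar>moebius_mu n\<bar> \<le> 1"
  by (simp add: moebius_mu_def power_abs)

lemma prime_factors_prod_primes:
  fixes S :: "nat set"
  assumes "finite S" "\<And>p. p \<in> S \<Longrightarrow> prime p"
  shows "prime_factors (\<Prod>S) = S" "squarefree (\<Prod>S)"
proof -
  have "prime_factorization (\<Prod>S) = (\<Sum>p\<in>S. prime_factorization p)"
    using assms by (intro prime_factorization_prod) (auto simp: prime_gt_0_nat)
  also have "\<dots> = (\<Sum>p\<in>S. {#p#})"
    using assms by (intro sum.cong) (auto simp: prime_factorization_prime)
  finally have "prime_factorization (\<Prod>S) = (\<Sum>p\<in>S. {#p#})" .
  then show "prime_factors (\<Prod>S) = S" using assms by (simp add: set_mset_sum)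
  show "squarefree (\<Prod>S)"
    using assms by (intro squarefree_prod_coprime) (auto intro: primes_coprime squarefree_prime)
qed

lemma squarefree_eq_prod_prime_factors:
  fixes n :: nat
  assumes "squarefree n" shows "\<Prod>(prime_factors n) = n"
proof -
  have n0: "n \<noteq> 0" using assms by (metis not_squarefree_0)
  have "n = (\<Prod>p\<in>prime_factors n. p ^ multiplicity p n)"
    using n0 by (simp add: prime_factorization_nat)
  also have "\<dots> = (\<Prod>p\<in>prime_factors n. p)"
  proof (rule prod.cong[OF refl])
    fix p assume p: "p \<in> prime_factors n"
    then have "multiplicity p n \<le> 1" using assms n0 by (auto simp: squarefree_factorial_semiring'')
    moreover have "multiplicity p n > 0" using p by (simp add: prime_factors_multiplicity)
    ultimately have "multiplicity p n = 1" by linarith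
    then show "p ^ multiplicity p n = p" by simp
  qed
  finally show ?thesis by simp
qed

text \<open>Only squarefree divisors contribute, and they are the products of subsets of the prime
  factors. The sum is therefore the expansion of a product of factors \<open>-1 + 1\<close>, which
  is an empty product exactly for \<open>n = 1\<close>.\<close>

lemma sum_moebius_divisors:
  fixes n :: nat
  assumes "n > 0"
  shows "(\<Sum>k | k dvd n. moebius_mu k) = (if n = 1 then 1 else 0)"
proof -
  let ?P = "prime_factors n"
  have sub: "\<Prod>S dvd n" if "S \<subseteq> ?P" for S
  proof -
    have "\<Prod>S dvd \<Prod>?P" using that by (intro prod_dvd_prod_subset) auto
    also have "\<Prod>?P dvd (\<Prod>p\<in>?P. p ^ multiplicity p n)"
      by (intro prod_dvd_prod dvd_power) (auto simp: prime_factors_multiplicity)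
    also have "\<dots> = n" using assms by (simp add: prime_factorization_nat[symmetric])
    finally show ?thesis .
  qed
  have fin: "finite {k. k dvd n}" using assms by simp
  have "(\<Sum>k | k dvd n. moebius_mu k) = (\<Sum>k | k dvd n \<and> squarefree k. moebius_mu k)"
    using fin by (intro sum.mono_neutral_right) (auto simp: moebius_mu_def)
  also have "\<dots> = (\<Sum>S\<in>Pow ?P. (-1) ^ card S)"
  proof (rule sum.reindex_bij_witness[where i = "\<lambda>S. \<Prod>S" and j = prime_factors])
    fix k assume k: "k \<in> {k. k dvd n \<and> squarefree k}"
    show "\<Prod>(prime_factors k) = k" using k squarefree_eq_prod_prime_factors by auto
    show "prime_factors k \<in> Pow ?P" using k assms by (auto intro: dvd_trans simp: prime_factors_dvd)
    show "(-1) ^ card (prime_factors k) = moebius_mu k" using k by (simp add: moebius_mu_def)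
  next
    fix S assume S: "S \<in> Pow ?P"
    then have "finite S" "\<And>p. p \<in> S \<Longrightarrow> prime p" by (auto intro: finite_subset)
    then show "prime_factors (\<Prod>S) = S" "\<Prod>S \<in> {k. k dvd n \<and> squarefree k}"
      using prime_factors_prod_primes sub S by auto
  qed
  also have "\<dots> = (\<Sum>S\<in>Pow ?P. (\<Prod>x\<in>S. (-1::real)) * (\<Prod>x\<in>?P-S. 1))" by simp
  also have "\<dots> = (\<Prod>x\<in>?P. (-1) + 1)" by (rule prod_add[symmetric]) simp
  also have "\<dots> = (if ?P = {} then 1 else 0)" by (simp add: card_gt_0_iff)
  also have "\<dots> = (if n = 1 then 1 else 0)"
    using assms by (auto simp: prime_factorization_empty_iff)
  finally show ?thesis .
qed

text \<open>Extending the divisor sum to all \<open>k\<close> up to a common bound \<open>K\<close>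
  makes the range independent of \<open>g\<close>, so that it can be exchanged with a sum over
  vectors.\<close>

lemma sum_moebius_dividing:
  fixes g K :: nat
  assumes "g > 0" "g \<le> K"
  shows "(\<Sum>k\<in>{1..K}. if k dvd g then moebius_mu k else 0) = (if g = 1 then 1 else 0)"
proof -
  have "(\<Sum>k\<in>{1..K}. if k dvd g then moebius_mu k else 0) = (\<Sum>k | k \<in> {1..K} \<and> k dvd g. moebius_mu k)"
    by (rule sum.inter_filter[symmetric]) simp
  also have "{k. k \<in> {1..K} \<and> k dvd g} = {k. k dvd g}"
    using assms by (auto dest: dvd_imp_le intro: order_trans Suc_leI dvd_pos_nat)
  finally show ?thesis using sum_moebius_divisors[OF assms(1)] by simp
qed

text \<open>The indicator of \<open>g a = 1\<close> is replaced by a Moebius sum and the two sums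
  are exchanged. The function \<open>g\<close> is abstract because it serves both as the identity on
  numbers and as the gcd of the entries of a vector.\<close>

lemma sum_gcd_one_eq_moebius_sum:
  fixes f :: "'a \<Rightarrow> real" and g :: "'a \<Rightarrow> nat"
  assumes "finite S" "\<And>a. a \<in> S \<Longrightarrow> g a > 0" "\<And>a. a \<in> S \<Longrightarrow> g a \<le> K"
  shows "(\<Sum>a | a \<in> S \<and> g a = 1. f a) = (\<Sum>k\<in>{1..K}. moebius_mu k * (\<Sum>a | a \<in> S \<and> k dvd g a. f a))"
proof -
  have "(\<Sum>a | a \<in> S \<and> g a = 1. f a) = (\<Sum>a\<in>S. if g a = 1 then f a else 0)"
    using assms by (simp add: sum.inter_filter)
  also have "\<dots> = (\<Sum>a\<in>S. (\<Sum>k\<in>{1..K}. if k dvd g a then moebius_mu k else 0) * f a)"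
    using assms by (intro sum.cong refl, subst sum_moebius_dividing) auto
  also have "\<dots> = (\<Sum>a\<in>S. \<Sum>k\<in>{1..K}. if k dvd g a then moebius_mu k * f a else 0)"
    by (auto simp: sum_distrib_right intro!: sum.cong)
  also have "\<dots> = (\<Sum>k\<in>{1..K}. \<Sum>a\<in>S. if k dvd g a then moebius_mu k * f a else 0)"
    by (rule sum.swap)
  also have "\<dots> = (\<Sum>k\<in>{1..K}. moebius_mu k * (\<Sum>a | a \<in> S \<and> k dvd g a. f a))"
    using assms by (auto simp: sum.inter_filter sum_distrib_left intro!: sum.cong)
  finally show ?thesis .
qed

text \<open>Induction with \<open>1 / (b + 1)^2 <= 1 / b - 1 / (b + 1)\<close>; larger exponents
  only make the terms smaller.\<close>

lemma sum_inverse_powers_telescope: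
  fixes a b s :: nat
  assumes "0 < a" "a \<le> b" "2 \<le> s"
  shows "(\<Sum>k\<in>{a<..b}. 1 / real k ^ s) \<le> 1 / real a - 1 / real b"
  using assms(2)
proof (induction b rule: dec_induct)
  case base then show ?case by simp
next
  case (step b)
  have b: "b > 0" using step assms by simp
  have "{a<..Suc b} = insert (Suc b) {a<..b}" using step by auto
  then have "(\<Sum>k\<in>{a<..Suc b}. 1 / real k ^ s) = 1 / real (Suc b) ^ s + (\<Sum>k\<in>{a<..b}. 1 / real k ^ s)"
    by simp
  also have "1 / real (Suc b) ^ s \<le> 1 / real (Suc b) ^ 2"
    using assms by (intro divide_left_mono power_increasing) auto
  also have "\<dots> \<le> 1 / real b - 1 / real (Suc b)"
  proof -
    have "1 / real b - 1 / real (Suc b) = 1 / (real b * real (Suc b))" using b by (simp add: field_simps)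
    moreover have "1 / real (Suc b) ^ 2 \<le> 1 / (real b * real (Suc b))"
      using b by (intro divide_left_mono) (auto simp: power2_eq_square)
    ultimately show ?thesis by simp
  qed
  finally show ?case using step.IH by simp
qed

lemma sum_inverse_powers_tail_le:
  fixes a b s :: nat
  assumes "0 < a" "2 \<le> s"
  shows "(\<Sum>k\<in>{a<..b}. 1 / real k ^ s) \<le> 1 / real a"
proof (cases "a \<le> b")
  case True
  then show ?thesis using sum_inverse_powers_telescope[OF assms(1) True assms(2)] by (smt (verit) divide_nonneg_nonneg of_nat_0_le_iff)
qed simp

lemma sum_inverse_powers_le_2:
  fixes b s :: nat
  assumes "2 \<le> s"
  shows "(\<Sum>k\<in>{1..b}. 1 / real k ^ s) \<le> 2"
proof (cases "b = 0")
  case False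
  then have "{1..b} = insert 1 {1<..b}" by auto
  then show ?thesis using sum_inverse_powers_tail_le[of 1 s b] assms by simp
qed simp

lemma zeta_nat_bounds:
  fixes s q :: nat
  assumes s: "2 \<le> s" and q: "0 < q"
  shows "(\<Sum>k\<in>{1..q}. 1 / real k ^ s) \<le> zeta_nat s"
    "zeta_nat s \<le> (\<Sum>k\<in>{1..q}. 1 / real k ^ s) + 1 / real q"
proof -
  let ?f = "\<lambda>k. 1 / real (Suc k) ^ s"
  have part: "sum ?f {..<m} = (\<Sum>k\<in>{1..m}. 1 / real k ^ s)" for m
    by (rule sum.reindex_bij_witness[where i = "\<lambda>k. k - 1" and j = Suc]) auto
  have "summable (\<lambda>n. inverse (real (Suc n) ^ s))"
    using inverse_power_summable[OF s, where 'a = real] by (subst summable_Suc_iff)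
  then have sm: "summable ?f" by (simp add: inverse_eq_divide)
  show "(\<Sum>k\<in>{1..q}. 1 / real k ^ s) \<le> zeta_nat s"
    unfolding zeta_nat_def part[symmetric] using sm by (intro sum_le_suminf) auto
  have "sum ?f {..<m} \<le> (\<Sum>k\<in>{1..q}. 1 / real k ^ s) + 1 / real q" for m
  proof -
    have "sum ?f {..<m} \<le> sum ?f {..<q + m}" by (intro sum_mono2) auto
    also have "\<dots> = (\<Sum>k\<in>{1..q} \<union> {q<..q+m}. 1 / real k ^ s)"
      unfolding part by (intro sum.cong) auto
    also have "\<dots> = (\<Sum>k\<in>{1..q}. 1 / real k ^ s) + (\<Sum>k\<in>{q<..q+m}. 1 / real k ^ s)"
      by (intro sum.union_disjoint) auto
    finally show ?thesis using sum_inverse_powers_tail_le[OF q s, of "q+m"] by simp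
  qed
  then show "zeta_nat s \<le> (\<Sum>k\<in>{1..q}. 1 / real k ^ s) + 1 / real q"
    unfolding zeta_nat_def by (intro suminf_le_const sm) auto
qed

lemma zeta_nat_ge_1: "2 \<le> s \<Longrightarrow> 1 \<le> zeta_nat s"
  using zeta_nat_bounds(1)[of s 1] by simp

text \<open>Moebius inversion of the trivial sum over \<open>a = 1\<close> gives the exact finite
  identity \<open>inv\<close>, in which zeta sums truncated at \<open>K div k\<close> stand in place
  of \<open>zeta_nat s\<close>. Replacing them costs at most \<open>2 * k / K\<close> in the term
  for \<open>k\<close>, and \<open>s >= 3\<close> leaves the bounded sum of
  \<open>1 / k^(s - 1)\<close>.\<close>

lemma moebius_partial_sum:
  fixes s K :: nat
  assumes s: "3 \<le> s" and K: "0 < K"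
  shows "\<bar>(\<Sum>k\<in>{1..K}. moebius_mu k / real k ^ s) - 1 / zeta_nat s\<bar> \<le> 4 / real K"
proof -
  let ?M = "\<Sum>k\<in>{1..K}. moebius_mu k / real k ^ s"
  define F where "F q = (\<Sum>j\<in>{1..q}. 1 / real j ^ s)" for q :: nat
  have z1: "1 \<le> zeta_nat s" using s by (intro zeta_nat_ge_1) simp
  have inv: "(\<Sum>k\<in>{1..K}. moebius_mu k / real k ^ s * F (K div k)) = 1"
  proof -
    have "(\<Sum>a | a \<in> {1..K} \<and> a = 1. 1 / real a ^ s)
        = (\<Sum>k\<in>{1..K}. moebius_mu k * (\<Sum>a | a \<in> {1..K} \<and> k dvd a. 1 / real a ^ s))"
      by (rule sum_gcd_one_eq_moebius_sum) auto
    also have "\<dots> = (\<Sum>k\<in>{1..K}. moebius_mu k / real k ^ s * F (K div k))"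
    proof (rule sum.cong[OF refl])
      fix k assume k: "k \<in> {1..K}"
      have "(\<Sum>a | a \<in> {1..K} \<and> k dvd a. 1 / real a ^ s) = (\<Sum>j\<in>{1..K div k}. 1 / real (k * j) ^ s)"
        using k by (intro sum.reindex_bij_witness[where i = "\<lambda>j. k * j" and j = "\<lambda>a. a div k"])
          (auto simp: less_eq_div_iff_mult_less_eq mult.commute div_le_mono dest: dvd_imp_le intro!: Suc_leI)
      also have "\<dots> = F (K div k) / real k ^ s"
        by (simp add: F_def sum_divide_distrib power_mult_distrib mult.commute)
      finally show "moebius_mu k * (\<Sum>a | a \<in> {1..K} \<and> k dvd a. 1 / real a ^ s) = moebius_mu k / real k ^ s * F (K div k)"
        by simp
    qed
    finally have "(\<Sum>k\<in>{1..K}. moebius_mu k / real k ^ s * F (K div k)) = (\<Sum>a | a \<in> {1..K} \<and> a = 1. 1 / real a ^ s)" ..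
    also have "{a. a \<in> {1..K} \<and> a = 1} = {1}" using K by auto
    finally show ?thesis by simp
  qed
  have "\<bar>zeta_nat s * ?M - 1\<bar> = \<bar>\<Sum>k\<in>{1..K}. moebius_mu k / real k ^ s * (zeta_nat s - F (K div k))\<bar>"
  proof -
    have "(\<Sum>k\<in>{1..K}. moebius_mu k / real k ^ s * (zeta_nat s - F (K div k)))
        = zeta_nat s * ?M - (\<Sum>k\<in>{1..K}. moebius_mu k / real k ^ s * F (K div k))"
      by (simp add: sum_distrib_left right_diff_distrib diff_divide_distrib flip: sum_subtractf) (simp add: mult_ac)
    then show ?thesis using inv by simp
  qed
  also have "\<dots> \<le> (\<Sum>k\<in>{1..K}. \<bar>moebius_mu k / real k ^ s * (zeta_nat s - F (K div k))\<bar>)"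
    by (rule sum_abs)
  also have "\<dots> \<le> (\<Sum>k\<in>{1..K}. 2 / real K * (1 / real k ^ (s - 1)))"
  proof (rule sum_mono)
    fix k assume k: "k \<in> {1..K}"
    define q where "q = K div k"
    have q: "q > 0" using k by (simp add: q_def div_greater_zero_iff)
    have "K < k * (q + 1)" using k dividend_less_times_div[of k K] by (simp add: q_def)
    also have "\<dots> \<le> k * (2 * q)" using q by (intro mult_left_mono) auto
    finally have "real K \<le> real (k * (2 * q))" by (subst of_nat_le_iff) simp
    then have qK: "1 / real q \<le> 2 * real k / real K" using q K by (simp add: field_simps)
    have "\<bar>zeta_nat s - F q\<bar> \<le> 1 / real q"
      using zeta_nat_bounds[of s q] s q by (simp add: F_def)
    then have b: "\<bar>zeta_nat s - F q\<bar> \<le> 2 * real k / real K" using qK by simp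
    have "\<bar>moebius_mu k / real k ^ s * (zeta_nat s - F q)\<bar> = \<bar>moebius_mu k\<bar> * (1 / real k ^ s) * \<bar>zeta_nat s - F q\<bar>"
      by (simp add: abs_mult)
    also have "\<dots> \<le> 1 * (1 / real k ^ s) * (2 * real k / real K)"
      using abs_moebius_le_1 b by (intro mult_mono) auto
    also have "\<dots> = 2 / real K * (1 / real k ^ (s - 1))"
      using k s by (cases s) (auto simp: field_simps)
    finally show "\<bar>moebius_mu k / real k ^ s * (zeta_nat s - F (K div k))\<bar> \<le> 2 / real K * (1 / real k ^ (s - 1))"
      by (simp add: q_def)
  qed
  also have "\<dots> = 2 / real K * (\<Sum>k\<in>{1..K}. 1 / real k ^ (s - 1))" by (simp add: sum_distrib_left)
  also have "\<dots> \<le> 2 / real K * 2" using s by (intro mult_left_mono sum_inverse_powers_le_2) auto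
  finally have *: "\<bar>zeta_nat s * ?M - 1\<bar> \<le> 4 / real K" by simp
  have "\<bar>?M - 1 / zeta_nat s\<bar> = \<bar>zeta_nat s * ?M - 1\<bar> / zeta_nat s"
    using z1 by (simp add: field_simps flip: abs_div_pos)
  also have "\<dots> \<le> \<bar>zeta_nat s * ?M - 1\<bar> / 1" using z1 by (intro divide_left_mono) auto
  finally show ?thesis using * by simp
qed

text \<open>The cutoff \<open>y\<close> is separate from \<open>X\<close> because the asymptotics of
  \<open>R\<close> may hold only for part of the range of \<open>k\<close>: it is
  \<open>A / P\<close> for the lattice of a point, and all of \<open>A\<close> or \<open>X\<close>
  in the other two counts. The first error term collects the errors of \<open>R\<close>, the second
  is the tail of the Moebius series beyond \<open>y\<close>.\<close>

lemma moebius_transform_asymptotic: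
  fixes s :: nat and R :: "nat \<Rightarrow> real" and X a b y :: real
  assumes s: "3 \<le> s" and y: "1 \<le> y" and X: "0 \<le> X" and a: "0 \<le> a" and b: "0 \<le> b"
    and R: "\<And>k. 1 \<le> k \<Longrightarrow> real k \<le> y \<Longrightarrow> \<bar>R k - a * (X / k) ^ s\<bar> \<le> b * (X / k) ^ (s - 1)"
  shows "\<bar>(\<Sum>k\<in>{1..nat \<lfloor>y\<rfloor>}. moebius_mu k * R k) - a * X ^ s / zeta_nat s\<bar>
           \<le> 2 * b * X ^ (s - 1) + 8 * a * X ^ s / y"
proof -
  define K where "K = nat \<lfloor>y\<rfloor>"
  have K: "0 < K" "real K \<le> y" using y unfolding K_def by linarith+
  have "y < real K + 1" "1 \<le> real K" using y K unfolding K_def by linarith+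
  then have yK: "y \<le> 2 * real K" by linarith
  let ?M = "\<Sum>k\<in>{1..K}. moebius_mu k / real k ^ s"
  have "(\<Sum>k\<in>{1..K}. moebius_mu k * (R k - a * (X / k) ^ s)) = (\<Sum>k\<in>{1..K}. moebius_mu k * R k) - a * X ^ s * ?M"
    by (simp add: sum_subtractf right_diff_distrib sum_distrib_left power_divide mult_ac)
  moreover have "\<bar>\<Sum>k\<in>{1..K}. moebius_mu k * (R k - a * (X / k) ^ s)\<bar> \<le> 2 * b * X ^ (s - 1)"
  proof -
    have "\<bar>\<Sum>k\<in>{1..K}. moebius_mu k * (R k - a * (X / k) ^ s)\<bar> \<le> (\<Sum>k\<in>{1..K}. \<bar>moebius_mu k * (R k - a * (X / k) ^ s)\<bar>)"
      by (rule sum_abs)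
    also have "\<dots> \<le> (\<Sum>k\<in>{1..K}. b * X ^ (s - 1) * (1 / real k ^ (s - 1)))"
    proof (rule sum_mono)
      fix k assume k: "k \<in> {1..K}"
      have "real k \<le> real K" using k by simp
      then have "real k \<le> y" using K by linarith
      then have "\<bar>moebius_mu k\<bar> * \<bar>R k - a * (X / k) ^ s\<bar> \<le> 1 * (b * (X / k) ^ (s - 1))"
        using k R abs_moebius_le_1 by (intro mult_mono) auto
      then show "\<bar>moebius_mu k * (R k - a * (X / k) ^ s)\<bar> \<le> b * X ^ (s - 1) * (1 / real k ^ (s - 1))"
        by (simp add: abs_mult power_divide)
    qed
    also have "\<dots> = b * X ^ (s - 1) * (\<Sum>k\<in>{1..K}. 1 / real k ^ (s - 1))" by (simp only: sum_distrib_left)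
    also have "\<dots> \<le> b * X ^ (s - 1) * 2" using s b X by (intro mult_left_mono sum_inverse_powers_le_2) auto
    finally show ?thesis by simp
  qed
  moreover have "\<bar>a * X ^ s * ?M - a * X ^ s / zeta_nat s\<bar> \<le> 8 * a * X ^ s / y"
  proof -
    have "\<bar>a * X ^ s * ?M - a * X ^ s / zeta_nat s\<bar> = a * X ^ s * \<bar>?M - 1 / zeta_nat s\<bar>"
    proof -
      have "a * X ^ s * ?M - a * X ^ s / zeta_nat s = a * X ^ s * (?M - 1 / zeta_nat s)"
        by (simp add: right_diff_distrib)
      then show ?thesis using a X by (simp add: abs_mult)
    qed
    also have "\<dots> \<le> a * X ^ s * (4 / real K)"
      using moebius_partial_sum[OF s K(1)] a X by (intro mult_left_mono) auto
    also have "\<dots> \<le> a * X ^ s * (8 / y)"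
      using K yK y a X by (intro mult_left_mono) (auto simp: field_simps)
    finally show ?thesis by (simp add: mult_ac)
  qed
  ultimately show ?thesis unfolding K_def[symmetric] by linarith
qed

section \<open>Lattice points in ellipsoids\<close>

text \<open>Completing the square: with \<open>r^2 = 1 + c^2\<close>,
  \<open>y^2 + (s + c * y)^2 = r^2 * (y + c * s / r^2)^2 + (s / r)^2\<close>, so the substitution
  \<open>w = r * (y + c * s / r^2)\<close>, with Jacobian \<open>1 / r\<close>, isolates the
  variable.\<close>

lemma nn_integral_shear:
  fixes f :: "real \<Rightarrow> ennreal" and c s q :: real
  assumes [measurable]: "f \<in> borel_measurable borel"
  shows "(\<integral>\<^sup>+y. f (q + y\<^sup>2 + (s + c * y)\<^sup>2) \<partial>lborel)
    = ennreal (1 / sqrt (1 + c\<^sup>2)) * (\<integral>\<^sup>+w. f (w\<^sup>2 + (q + (s / sqrt (1 + c\<^sup>2))\<^sup>2)) \<partial>lborel)"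
proof -
  define r where "r = sqrt (1 + c\<^sup>2)"
  have "1 + c\<^sup>2 > 0" by (simp add: add_pos_nonneg)
  then have r: "r > 0" "r\<^sup>2 = 1 + c\<^sup>2" by (auto simp: r_def)
  have "(\<integral>\<^sup>+y. f (q + y\<^sup>2 + (s + c * y)\<^sup>2) \<partial>lborel)
      = ennreal \<bar>1 / r\<bar> * (\<integral>\<^sup>+w. f (q + (- c * s / r\<^sup>2 + 1 / r * w)\<^sup>2 + (s + c * (- c * s / r\<^sup>2 + 1 / r * w))\<^sup>2) \<partial>lborel)"
    using r by (intro nn_integral_real_affine) auto
  also have "(\<lambda>w. f (q + (- c * s / r\<^sup>2 + 1 / r * w)\<^sup>2 + (s + c * (- c * s / r\<^sup>2 + 1 / r * w))\<^sup>2))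
      = (\<lambda>w. f (w\<^sup>2 + (q + (s / r)\<^sup>2)))"
  proof
    fix w
    have e: "(- c * s / r\<^sup>2 + 1 / r * w) = (r * w - c * s) / r\<^sup>2"
      using r(1) by (simp add: field_simps power2_eq_square)
    have e2: "s + c * ((r * w - c * s) / r\<^sup>2) = (s + c * r * w) / r\<^sup>2"
    proof -
      have "s + c * ((r * w - c * s) / r\<^sup>2) = (s * r\<^sup>2 + c * (r * w - c * s)) / r\<^sup>2"
        using r(1) by (simp add: field_simps)
      also have "s * r\<^sup>2 + c * (r * w - c * s) = s + c * r * w"
        unfolding r(2) by (simp add: algebra_simps power2_eq_square)
      finally show ?thesis .
    qed
    have "(r * w - c * s)\<^sup>2 + (s + c * r * w)\<^sup>2 = (1 + c\<^sup>2) * (r\<^sup>2 * w\<^sup>2 + s\<^sup>2)"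
      by (simp add: algebra_simps power2_eq_square)
    also have "\<dots> = r\<^sup>2 * (r\<^sup>2 * w\<^sup>2 + s\<^sup>2)" by (simp add: r(2))
    finally have "((r * w - c * s) / r\<^sup>2)\<^sup>2 + ((s + c * r * w) / r\<^sup>2)\<^sup>2 = w\<^sup>2 + (s / r)\<^sup>2"
      using r(1) by (simp add: power_divide add_divide_distrib[symmetric] field_simps)
    then show "f (q + (- c * s / r\<^sup>2 + 1 / r * w)\<^sup>2 + (s + c * (- c * s / r\<^sup>2 + 1 / r * w))\<^sup>2) = f (w\<^sup>2 + (q + (s / r)\<^sup>2))"
      unfolding e e2 by (simp add: add_ac)
  qed
  finally show ?thesis using r by (simp add: r_def)
qed

text \<open>Completing the square in one coordinate replaces the linear form by a shorter one with rescaled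
  coefficients, which makes an induction over the coordinates possible.\<close>
lemma nn_integral_norm_plus_linear_form:
  fixes c :: "'a \<Rightarrow> real" and f :: "real \<Rightarrow> ennreal"
  assumes "finite J" "f \<in> borel_measurable borel"
  shows "(\<integral>\<^sup>+u. f ((\<Sum>i\<in>J. (u i)\<^sup>2) + (\<Sum>i\<in>J. c i * u i)\<^sup>2) \<partial>PiM J (\<lambda>_. lborel))
    = ennreal (1 / sqrt (1 + (\<Sum>i\<in>J. (c i)\<^sup>2))) * (\<integral>\<^sup>+u. f (\<Sum>i\<in>J. (u i)\<^sup>2) \<partial>PiM J (\<lambda>_. lborel))"
  using assms
proof (induction J arbitrary: c f rule: finite_induct)
  case empty
  then show ?case by simp
next
  case (insert j J)
  note [measurable] = insert.prems
  note [simp] = insert.hyps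
  interpret product_sigma_finite "\<lambda>_. lborel :: real measure" by standard
  define r where "r = sqrt (1 + (c j)\<^sup>2)"
  have r: "r > 0" "r\<^sup>2 = 1 + (c j)\<^sup>2" by (auto simp: r_def add_pos_nonneg)
  have "(\<integral>\<^sup>+u. f ((\<Sum>i\<in>insert j J. (u i)\<^sup>2) + (\<Sum>i\<in>insert j J. c i * u i)\<^sup>2) \<partial>PiM (insert j J) (\<lambda>_. lborel))
    = (\<integral>\<^sup>+x. (\<integral>\<^sup>+y. f ((\<Sum>i\<in>insert j J. ((x(j:=y)) i)\<^sup>2) + (\<Sum>i\<in>insert j J. c i * (x(j:=y)) i)\<^sup>2) \<partial>lborel) \<partial>PiM J (\<lambda>_. lborel))"
    by (rule product_nn_integral_insert) auto
  also have "\<dots> = (\<integral>\<^sup>+x. (\<integral>\<^sup>+y. f ((\<Sum>i\<in>J. (x i)\<^sup>2) + y\<^sup>2 + ((\<Sum>i\<in>J. c i * x i) + c j * y)\<^sup>2) \<partial>lborel) \<partial>PiM J (\<lambda>_. lborel))"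
  proof -
    have "(\<Sum>i\<in>insert j J. ((x(j:=y)) i)\<^sup>2) = (\<Sum>i\<in>J. (x i)\<^sup>2) + y\<^sup>2"
      "(\<Sum>i\<in>insert j J. c i * (x(j:=y)) i) = (\<Sum>i\<in>J. c i * x i) + c j * y" for x :: "'a \<Rightarrow> real" and y
    proof -
      have "(\<Sum>i\<in>J. ((x(j:=y)) i)\<^sup>2) = (\<Sum>i\<in>J. (x i)\<^sup>2)" "(\<Sum>i\<in>J. c i * (x(j:=y)) i) = (\<Sum>i\<in>J. c i * x i)"
        by (rule sum.cong; auto)+
      then show "(\<Sum>i\<in>insert j J. ((x(j:=y)) i)\<^sup>2) = (\<Sum>i\<in>J. (x i)\<^sup>2) + y\<^sup>2"
        "(\<Sum>i\<in>insert j J. c i * (x(j:=y)) i) = (\<Sum>i\<in>J. c i * x i) + c j * y"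
        by (simp_all add: add_ac)
    qed
    then show ?thesis by (simp only:)
  qed
  also have "\<dots> = (\<integral>\<^sup>+x. ennreal (1 / r) * (\<integral>\<^sup>+w. f (w\<^sup>2 + ((\<Sum>i\<in>J. (x i)\<^sup>2) + ((\<Sum>i\<in>J. c i * x i) / r)\<^sup>2)) \<partial>lborel) \<partial>PiM J (\<lambda>_. lborel))"
    unfolding r_def by (intro nn_integral_cong nn_integral_shear) (rule insert.prems)
  also have "\<dots> = ennreal (1 / r) * (\<integral>\<^sup>+x. (\<integral>\<^sup>+w. f (w\<^sup>2 + ((\<Sum>i\<in>J. (x i)\<^sup>2) + ((\<Sum>i\<in>J. c i * x i) / r)\<^sup>2)) \<partial>lborel) \<partial>PiM J (\<lambda>_. lborel))"
    by (rule nn_integral_cmult) measurable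
  \<comment> \<open>Exchanging the two integrals brings the remaining coordinates inside, where the
    induction hypothesis applies with the coefficients \<open>c i / r\<close>.\<close>
  also have "(\<integral>\<^sup>+x. (\<integral>\<^sup>+w. f (w\<^sup>2 + ((\<Sum>i\<in>J. (x i)\<^sup>2) + ((\<Sum>i\<in>J. c i * x i) / r)\<^sup>2)) \<partial>lborel) \<partial>PiM J (\<lambda>_. lborel))
     = (\<integral>\<^sup>+w. (\<integral>\<^sup>+x. f (w\<^sup>2 + ((\<Sum>i\<in>J. (x i)\<^sup>2) + (\<Sum>i\<in>J. (c i / r) * x i)\<^sup>2)) \<partial>PiM J (\<lambda>_. lborel)) \<partial>lborel)"
  proof -
    interpret pair_sigma_finite lborel "PiM J (\<lambda>_. lborel :: real measure)"
      by (intro pair_sigma_finite.intro sigma_finite sigma_finite_lborel) simp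
    show ?thesis
      by (subst Fubini') (auto simp: sum_divide_distrib intro!: nn_integral_cong)
  qed
  \<comment> \<open>The hypothesis is used for \<open>f\<close> translated by \<open>w^2\<close>;
    this is why the induction runs over arbitrary \<open>f\<close>.\<close>
  also have "\<dots> = (\<integral>\<^sup>+w. ennreal (1 / sqrt (1 + (\<Sum>i\<in>J. (c i / r)\<^sup>2))) * (\<integral>\<^sup>+x. f (w\<^sup>2 + (\<Sum>i\<in>J. (x i)\<^sup>2)) \<partial>PiM J (\<lambda>_. lborel)) \<partial>lborel)"
    by (intro nn_integral_cong insert.IH[of "\<lambda>z. f (_ + z)"]) measurable
  also have "\<dots> = ennreal (1 / sqrt (1 + (\<Sum>i\<in>J. (c i / r)\<^sup>2))) * (\<integral>\<^sup>+w. (\<integral>\<^sup>+x. f (w\<^sup>2 + (\<Sum>i\<in>J. (x i)\<^sup>2)) \<partial>PiM J (\<lambda>_. lborel)) \<partial>lborel)"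
  proof (rule nn_integral_cmult)
    interpret sigma_finite_measure "PiM J (\<lambda>_. lborel :: real measure)" by (rule sigma_finite) simp
    show "(\<lambda>w. \<integral>\<^sup>+x. f (w\<^sup>2 + (\<Sum>i\<in>J. (x i)\<^sup>2)) \<partial>PiM J (\<lambda>_. lborel)) \<in> borel_measurable lborel"
      by measurable
  qed
  also have "(\<integral>\<^sup>+w. (\<integral>\<^sup>+x. f (w\<^sup>2 + (\<Sum>i\<in>J. (x i)\<^sup>2)) \<partial>PiM J (\<lambda>_. lborel)) \<partial>lborel)
      = (\<integral>\<^sup>+u. f (\<Sum>i\<in>insert j J. (u i)\<^sup>2) \<partial>PiM (insert j J) (\<lambda>_. lborel))"
  proof -
    have "(\<Sum>i\<in>J. ((x(j:=y)) i)\<^sup>2) = (\<Sum>i\<in>J. (x i)\<^sup>2)" for x :: "'a \<Rightarrow> real" and y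
      by (rule sum.cong) auto
    then show ?thesis by (subst product_nn_integral_insert_rev) auto
  qed
  \<comment> \<open>The two factors combine because \<open>r^2\<close> times
    \<open>1 + (sum of (c i / r)^2)\<close> is \<open>r^2\<close> plus the sum of
    \<open>(c i)^2\<close> over \<open>J\<close>, and \<open>r^2 = 1 + (c j)^2\<close>.\<close>
  also have "ennreal (1 / r) * (ennreal (1 / sqrt (1 + (\<Sum>i\<in>J. (c i / r)\<^sup>2))) * (\<integral>\<^sup>+u. f (\<Sum>i\<in>insert j J. (u i)\<^sup>2) \<partial>PiM (insert j J) (\<lambda>_. lborel)))
     = ennreal (1 / sqrt (1 + (\<Sum>i\<in>insert j J. (c i)\<^sup>2))) * (\<integral>\<^sup>+u. f (\<Sum>i\<in>insert j J. (u i)\<^sup>2) \<partial>PiM (insert j J) (\<lambda>_. lborel))"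
  proof -
    have "1 + (\<Sum>i\<in>J. (c i / r)\<^sup>2) \<ge> 0" by (simp add: sum_nonneg)
    have "(1 / r) * (1 / sqrt (1 + (\<Sum>i\<in>J. (c i / r)\<^sup>2))) = 1 / sqrt (r\<^sup>2 * (1 + (\<Sum>i\<in>J. (c i / r)\<^sup>2)))"
      using r(1) by (simp add: real_sqrt_mult)
    also have "r\<^sup>2 * (1 + (\<Sum>i\<in>J. (c i / r)\<^sup>2)) = 1 + (\<Sum>i\<in>insert j J. (c i)\<^sup>2)"
    proof -
      have "r\<^sup>2 * (\<Sum>i\<in>J. (c i / r)\<^sup>2) = (\<Sum>i\<in>J. (c i)\<^sup>2)"
        using r(1) by (simp add: power_divide flip: sum_divide_distrib)
      then show ?thesis by (simp add: distrib_left) (simp add: r(2))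
    qed
    finally show ?thesis using r
      by (simp add: sum_nonneg flip: mult.assoc ennreal_mult)
  qed
  finally show ?case .
qed

text \<open>The ellipsoid is the projection of a ball of radius \<open>T\<close> in the hyperplane
  that is the graph of the linear form. Projecting divides the volume by the length of the normal
  vector with entries \<open>c i\<close> and \<open>-1\<close>.\<close>

lemma emeasure_ellipsoid:
  fixes c :: "'a \<Rightarrow> real"
  assumes J: "finite J" and T: "0 < T"
  shows "emeasure (PiM J (\<lambda>_. lborel))
      {u \<in> space (PiM J (\<lambda>_. lborel)). sqrt ((\<Sum>i\<in>J. (u i)\<^sup>2) + (\<Sum>i\<in>J. c i * u i)\<^sup>2) \<le> T}
    = ennreal (unit_ball_vol (real (card J)) * T ^ card J / sqrt (1 + (\<Sum>i\<in>J. (c i)\<^sup>2)))"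
proof -
  let ?M = "PiM J (\<lambda>_. lborel :: real measure)"
  let ?f = "indicator {..T\<^sup>2} :: real \<Rightarrow> ennreal"
  have iff: "sqrt x \<le> T \<longleftrightarrow> x \<in> {..T\<^sup>2}" for x
    using T by (auto intro: real_le_lsqrt sqrt_le_D)
  have "emeasure ?M {u \<in> space ?M. sqrt ((\<Sum>i\<in>J. (u i)\<^sup>2) + (\<Sum>i\<in>J. c i * u i)\<^sup>2) \<le> T}
      = (\<integral>\<^sup>+u. ?f ((\<Sum>i\<in>J. (u i)\<^sup>2) + (\<Sum>i\<in>J. c i * u i)\<^sup>2) \<partial>?M)"
  proof -
    have "emeasure ?M {u \<in> space ?M. sqrt ((\<Sum>i\<in>J. (u i)\<^sup>2) + (\<Sum>i\<in>J. c i * u i)\<^sup>2) \<le> T}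
       = (\<integral>\<^sup>+u. indicator {u \<in> space ?M. sqrt ((\<Sum>i\<in>J. (u i)\<^sup>2) + (\<Sum>i\<in>J. c i * u i)\<^sup>2) \<le> T} u \<partial>?M)"
      by (rule nn_integral_indicator[symmetric]) measurable
    also have "\<dots> = (\<integral>\<^sup>+u. ?f ((\<Sum>i\<in>J. (u i)\<^sup>2) + (\<Sum>i\<in>J. c i * u i)\<^sup>2) \<partial>?M)"
      by (rule nn_integral_cong) (simp only: iff indicator_def mem_Collect_eq simp_thms)
    finally show ?thesis .
  qed
  also have "\<dots> = ennreal (1 / sqrt (1 + (\<Sum>i\<in>J. (c i)\<^sup>2))) * (\<integral>\<^sup>+u. ?f (\<Sum>i\<in>J. (u i)\<^sup>2) \<partial>?M)"
    using J by (intro nn_integral_norm_plus_linear_form) auto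
  also have "(\<integral>\<^sup>+u. ?f (\<Sum>i\<in>J. (u i)\<^sup>2) \<partial>?M) = emeasure ?M ({u. sqrt (\<Sum>i\<in>J. (u i)\<^sup>2) \<le> T} \<inter> space ?M)"
  proof -
    have "emeasure ?M ({u. sqrt (\<Sum>i\<in>J. (u i)\<^sup>2) \<le> T} \<inter> space ?M)
       = (\<integral>\<^sup>+u. indicator ({u. sqrt (\<Sum>i\<in>J. (u i)\<^sup>2) \<le> T} \<inter> space ?M) u \<partial>?M)"
      by (rule nn_integral_indicator[symmetric]) auto
    also have "\<dots> = (\<integral>\<^sup>+u. ?f (\<Sum>i\<in>J. (u i)\<^sup>2) \<partial>?M)"
      by (rule nn_integral_cong) (simp only: iff indicator_def mem_Collect_eq simp_thms Int_iff)
    finally show ?thesis by simp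
  qed
  also have "\<dots> = ennreal (unit_ball_vol (real (card J)) * T ^ card J)"
    using J T by (rule emeasure_cball_aux)
  finally show ?thesis using T
    by (simp add: sum_nonneg mult.commute flip: ennreal_mult)
qed

lemma emeasure_half_open_box:
  fixes b :: "'a \<Rightarrow> real"
  assumes "finite J" "0 \<le> P"
  shows "emeasure (PiM J (\<lambda>_. lborel)) (PiE J (\<lambda>i. {b i - P<..b i})) = ennreal (P ^ card J)"
proof -
  interpret product_sigma_finite "\<lambda>_. lborel :: real measure" by standard
  have "emeasure (PiM J (\<lambda>_. lborel)) (PiE J (\<lambda>i. {b i - P<..b i})) = (\<Prod>i\<in>J. ennreal P)"
    using assms by (subst emeasure_PiM) auto
  then show ?thesis using assms by (simp add: ennreal_power)
qed

text \<open>Double counting: integrate over \<open>u\<close> the number of points of \<open>L\<close> in the box with corner \<open>u\<close>.\<close>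
lemma box_count_sandwich:
  fixes L :: "('a \<Rightarrow> int) set" and E :: "('a \<Rightarrow> real) \<Rightarrow> real" and P T D :: real and k :: nat
  assumes J: "finite J" and P: "0 < P"
    and E[measurable]: "E \<in> borel_measurable (PiM J (\<lambda>_. lborel))"
    and ext: "\<And>a. E (restrict a J) = E a"
    and lip: "\<And>u v. (\<And>i. i \<in> J \<Longrightarrow> \<bar>u i - v i\<bar> \<le> P) \<Longrightarrow> E u \<le> E v + D"
    and box: "\<And>u :: 'a \<Rightarrow> real. card {a\<in>L. \<forall>i\<in>J. real_of_int (a i) \<in> {u i..<u i + P}} = k"
    and boxfin: "\<And>u :: 'a \<Rightarrow> real. finite {a\<in>L. \<forall>i\<in>J. real_of_int (a i) \<in> {u i..<u i + P}}"
    and fin: "finite {a\<in>L. E (\<lambda>i. real_of_int (a i)) \<le> T}"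
  shows "of_nat k * emeasure (PiM J (\<lambda>_. lborel)) {u \<in> space (PiM J (\<lambda>_. lborel)). E u \<le> T - D}
      \<le> ennreal (real (card {a\<in>L. E (\<lambda>i. real_of_int (a i)) \<le> T}) * P ^ card J)"
    and "ennreal (real (card {a\<in>L. E (\<lambda>i. real_of_int (a i)) \<le> T}) * P ^ card J)
      \<le> of_nat k * emeasure (PiM J (\<lambda>_. lborel)) {u \<in> space (PiM J (\<lambda>_. lborel)). E u \<le> T + D}"
proof -
  let ?M = "PiM J (\<lambda>_. lborel :: real measure)"
  define S where "S = {a\<in>L. E (\<lambda>i. real_of_int (a i)) \<le> T}"
  define W where "W u = {a\<in>L. \<forall>i\<in>J. real_of_int (a i) \<in> {u i..<u i + P}}" for u
  \<comment> \<open>\<open>Q a\<close> is the set of corners \<open>u\<close> whose box contains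
    \<open>a\<close>, so the closed end of the half-open intervals moves to the other side.\<close>
  define Q where "Q a = PiE J (\<lambda>i. {real_of_int (a i) - P<..real_of_int (a i)})" for a :: "'a \<Rightarrow> int"
  have [measurable]: "Q a \<in> sets ?M" for a using J by (auto simp: Q_def intro!: sets_PiM_I_finite)
  have finS: "finite S" using fin by (simp add: S_def)
  have finW: "finite (W u)" and cardW: "card (W u) = k" for u using box boxfin by (auto simp: W_def)
  have eq: "(\<Sum>a\<in>S. indicator (Q a) u) = (of_nat (card (S \<inter> W u)) :: ennreal)" if u: "u \<in> space ?M" for u
  proof -
    have "(\<Sum>a\<in>S. indicator (Q a) u) = (\<Sum>a\<in>S. if a \<in> W u then 1 else (0::ennreal))"
    proof (rule sum.cong[OF refl])
      fix a assume "a \<in> S"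
      have "x - P < y \<and> y \<le> x \<longleftrightarrow> y \<le> x \<and> x < y + P" for x y :: real by auto
      then have "u \<in> Q a \<longleftrightarrow> a \<in> W u"
        using u \<open>a \<in> S\<close> by (simp add: Q_def W_def S_def space_PiM PiE_iff)
      then show "indicator (Q a) u = (if a \<in> W u then 1 else (0::ennreal))" by (simp add: indicator_def)
    qed
    also have "\<dots> = of_nat (card (S \<inter> W u))"
      using finS by (simp add: sum.inter_restrict[symmetric])
    finally show ?thesis .
  qed
  have "(\<integral>\<^sup>+u. of_nat (card (S \<inter> W u)) \<partial>?M) = (\<integral>\<^sup>+u. (\<Sum>a\<in>S. indicator (Q a) u) \<partial>?M)"
    by (intro nn_integral_cong eq[symmetric])
  also have "\<dots> = (\<Sum>a\<in>S. (\<integral>\<^sup>+u. indicator (Q a) u \<partial>?M))"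
    by (rule nn_integral_sum) auto
  also have "\<dots> = (\<Sum>a\<in>S. ennreal (P ^ card J))"
  proof (rule sum.cong[OF refl])
    fix a
    have "(\<integral>\<^sup>+u. indicator (Q a) u \<partial>?M) = emeasure ?M (Q a)" by (rule nn_integral_indicator) measurable
    then show "(\<integral>\<^sup>+u. indicator (Q a) u \<partial>?M) = ennreal (P ^ card J)"
      using emeasure_half_open_box[OF J, of P "\<lambda>i. real_of_int (a i)"] P by (simp add: Q_def)
  qed
  also have "\<dots> = ennreal (real (card S) * P ^ card J)"
    using P by (simp add: ennreal_mult ennreal_of_nat_eq_real_of_nat)
  finally have int: "(\<integral>\<^sup>+u. of_nat (card (S \<inter> W u)) \<partial>?M) = ennreal (real (card S) * P ^ card J)" .
  \<comment> \<open>A lattice point and the corner of a box containing it differ by at most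
    \<open>P\<close> in each coordinate, so \<open>E\<close> changes by at most \<open>D\<close>.
    Hence for \<open>E u <= T - D\<close> all \<open>k\<close> points of the box are counted, and
    for \<open>E u > T + D\<close> none is.\<close>
  have near: "E (\<lambda>i. real_of_int (a i)) \<le> E u + D" "E u \<le> E (\<lambda>i. real_of_int (a i)) + D" if "a \<in> W u" for a u
  proof -
    have "\<bar>real_of_int (a i) - u i\<bar> \<le> P" "\<bar>u i - real_of_int (a i)\<bar> \<le> P" if "i \<in> J" for i
      using \<open>a \<in> W u\<close> that P by (auto simp: W_def abs_le_iff)
    then show "E (\<lambda>i. real_of_int (a i)) \<le> E u + D" "E u \<le> E (\<lambda>i. real_of_int (a i)) + D"
      by (auto intro!: lip)
  qed
  have "of_nat k * emeasure ?M {u \<in> space ?M. E u \<le> T - D} = (\<integral>\<^sup>+u. of_nat k * indicator {u \<in> space ?M. E u \<le> T - D} u \<partial>?M)"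
    by (rule nn_integral_cmult_indicator[symmetric]) measurable
  also have "\<dots> \<le> (\<integral>\<^sup>+u. of_nat (card (S \<inter> W u)) \<partial>?M)"
  proof (rule nn_integral_mono)
    fix u assume "u \<in> space ?M"
    show "of_nat k * indicator {u \<in> space ?M. E u \<le> T - D} u \<le> (of_nat (card (S \<inter> W u)) :: ennreal)"
    proof (cases "E u \<le> T - D")
      case True
      then have "W u \<subseteq> S" using near(1)[of _ u] by (fastforce simp: S_def W_def)
      then have "S \<inter> W u = W u" by auto
      then show ?thesis using cardW by (auto simp: indicator_def)
    qed auto
  qed
  finally show "of_nat k * emeasure ?M {u \<in> space ?M. E u \<le> T - D} \<le> ennreal (real (card {a\<in>L. E (\<lambda>i. real_of_int (a i)) \<le> T}) * P ^ card J)"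
    unfolding int unfolding S_def .
  have "(\<integral>\<^sup>+u. of_nat (card (S \<inter> W u)) \<partial>?M) \<le> (\<integral>\<^sup>+u. of_nat k * indicator {u \<in> space ?M. E u \<le> T + D} u \<partial>?M)"
  proof (rule nn_integral_mono)
    fix u assume u: "u \<in> space ?M"
    show "(of_nat (card (S \<inter> W u)) :: ennreal) \<le> of_nat k * indicator {u \<in> space ?M. E u \<le> T + D} u"
    proof (cases "S \<inter> W u = {}")
      case False
      then have "E u \<le> T + D" using near(2)[of _ u] by (fastforce simp: S_def)
      moreover have "card (S \<inter> W u) \<le> k" using finW cardW by (metis card_mono inf_le2)
      ultimately show ?thesis using u by (simp add: indicator_def)
    qed auto
  qed
  also have "\<dots> = of_nat k * emeasure ?M {u \<in> space ?M. E u \<le> T + D}"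
    by (rule nn_integral_cmult_indicator) measurable
  finally show "ennreal (real (card {a\<in>L. E (\<lambda>i. real_of_int (a i)) \<le> T}) * P ^ card J) \<le> of_nat k * emeasure ?M {u \<in> space ?M. E u \<le> T + D}"
    unfolding int unfolding S_def .
qed

lemma power_diff_le:
  fixes x y :: real
  assumes "0 \<le> y" "y \<le> x"
  shows "x ^ n - y ^ n \<le> real n * (x - y) * x ^ (n - 1)"
proof (induction n)
  case (Suc n)
  have "x ^ Suc n - y ^ Suc n = x * (x ^ n - y ^ n) + (x - y) * y ^ n" by (simp add: algebra_simps)
  also have "\<dots> \<le> x * (real n * (x - y) * x ^ (n - 1)) + (x - y) * x ^ n"
    using assms Suc by (intro add_mono mult_left_mono power_mono) auto
  also have "\<dots> = real (Suc n) * (x - y) * x ^ (Suc n - 1)" by (cases n) (auto simp: algebra_simps)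
  finally show ?case .
qed simp

text \<open>The expression is the Euclidean norm of \<open>u\<close> extended by the value of the
  linear form, so the triangle inequality reduces everything to the difference of \<open>u\<close>
  and \<open>v\<close>. There the norm and, since the \<open>c i\<close> are at most 1 in absolute
  value, also the linear form are at most \<open>card J * P\<close>; the constant 2 absorbs their
  combination.\<close>

lemma ellipsoid_norm_lipschitz:
  fixes c u v :: "'a \<Rightarrow> real"
  assumes J: "finite J" "J \<noteq> {}" and c: "\<And>i. i \<in> J \<Longrightarrow> \<bar>c i\<bar> \<le> 1"
    and P: "0 \<le> P" and uv: "\<And>i. i \<in> J \<Longrightarrow> \<bar>u i - v i\<bar> \<le> P"
  shows "sqrt ((\<Sum>i\<in>J. (u i)\<^sup>2) + (\<Sum>i\<in>J. c i * u i)\<^sup>2)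
    \<le> sqrt ((\<Sum>i\<in>J. (v i)\<^sup>2) + (\<Sum>i\<in>J. c i * v i)\<^sup>2) + 2 * real (card J) * P"
proof -
  define w where "w i = u i - v i" for i
  let ?m = "real (card J)"
  have m: "1 \<le> ?m" using J by (simp add: Suc_le_eq card_gt_0_iff)
  have E: "sqrt ((\<Sum>i\<in>J. (z i)\<^sup>2) + (\<Sum>i\<in>J. c i * z i)\<^sup>2) = sqrt ((L2_set z J)\<^sup>2 + (\<Sum>i\<in>J. c i * z i)\<^sup>2)" for z
    by (simp add: L2_set_def sum_nonneg)
  have u: "u i = v i + w i" for i by (simp add: w_def)
  have "sqrt ((\<Sum>i\<in>J. (u i)\<^sup>2) + (\<Sum>i\<in>J. c i * u i)\<^sup>2)
     \<le> sqrt ((L2_set v J + L2_set w J)\<^sup>2 + ((\<Sum>i\<in>J. c i * v i) + (\<Sum>i\<in>J. c i * w i))\<^sup>2)"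
  proof -
    have "L2_set u J \<le> L2_set v J + L2_set w J" unfolding u by (rule L2_set_triangle_ineq)
    then have "(L2_set u J)\<^sup>2 \<le> (L2_set v J + L2_set w J)\<^sup>2" by (intro power_mono) auto
    moreover have "(\<Sum>i\<in>J. c i * u i) = (\<Sum>i\<in>J. c i * v i) + (\<Sum>i\<in>J. c i * w i)"
      by (simp add: u distrib_left sum.distrib)
    ultimately show ?thesis unfolding E by (intro real_sqrt_le_mono add_mono) auto
  qed
  also have "\<dots> \<le> sqrt ((L2_set v J)\<^sup>2 + (\<Sum>i\<in>J. c i * v i)\<^sup>2) + sqrt ((L2_set w J)\<^sup>2 + (\<Sum>i\<in>J. c i * w i)\<^sup>2)"
    by (rule real_sqrt_sum_squares_triangle_ineq)
  also have "sqrt ((L2_set w J)\<^sup>2 + (\<Sum>i\<in>J. c i * w i)\<^sup>2) \<le> 2 * ?m * P"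
  proof -
    have "(L2_set w J)\<^sup>2 = (\<Sum>i\<in>J. (w i)\<^sup>2)" by (simp add: L2_set_def sum_nonneg)
    also have "\<dots> \<le> (\<Sum>i\<in>J. P\<^sup>2)" using uv P by (intro sum_mono abs_le_square_iff[THEN iffD1]) (auto simp: w_def)
    also have "\<dots> = ?m * P\<^sup>2" by simp
    also have "\<dots> \<le> (?m * ?m) * P\<^sup>2" using m by (intro mult_right_mono) auto
    finally have 1: "(L2_set w J)\<^sup>2 \<le> (?m * P)\<^sup>2" by (simp add: power2_eq_square mult_ac)
    have "\<bar>\<Sum>i\<in>J. c i * w i\<bar> \<le> (\<Sum>i\<in>J. \<bar>c i * w i\<bar>)" by (rule sum_abs)
    also have "\<dots> \<le> (\<Sum>i\<in>J. 1 * P)" using c uv P unfolding abs_mult w_def by (intro sum_mono mult_mono) auto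
    also have "\<dots> = \<bar>?m * P\<bar>" using P by simp
    finally have 2: "(\<Sum>i\<in>J. c i * w i)\<^sup>2 \<le> (?m * P)\<^sup>2" by (simp only: abs_le_square_iff)
    have "(L2_set w J)\<^sup>2 + (\<Sum>i\<in>J. c i * w i)\<^sup>2 \<le> (2 * ?m * P)\<^sup>2"
    proof -
      have "(2 * ?m * P)\<^sup>2 = 4 * (?m * P)\<^sup>2" by (simp add: power_mult_distrib)
      then show ?thesis using 1 2 zero_le_power2[of "?m * P"] by linarith
    qed
    then show ?thesis using P by (intro real_le_lsqrt) auto
  qed
  finally show ?thesis unfolding E by simp
qed

text \<open>The points have density \<kappa>, and the sandwich compares their number with the
  volumes at radii \<open>T + D\<close> and \<open>T - D\<close>, where
  \<open>D = 2 * M * P\<close>. As \<open>P <= T\<close>, the larger radius is at most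
  \<open>(1 + 2 * M) * T\<close>, and the difference of the \<open>M\<close>-th powers yields the
  constant \<open>2 * M^2 * (1 + 2 * M)^(M - 1)\<close>.\<close>

lemma lattice_count_ellipsoid:
  fixes L :: "('a \<Rightarrow> int) set" and c :: "'a \<Rightarrow> real" and P T :: real and k :: nat
  assumes J: "finite J" "J \<noteq> {}" and c: "\<And>i. i \<in> J \<Longrightarrow> \<bar>c i\<bar> \<le> 1" and P: "0 < P" "P \<le> T"
    and box: "\<And>u :: 'a \<Rightarrow> real. card {a\<in>L. \<forall>i\<in>J. real_of_int (a i) \<in> {u i..<u i + P}} = k"
    and boxfin: "\<And>u :: 'a \<Rightarrow> real. finite {a\<in>L. \<forall>i\<in>J. real_of_int (a i) \<in> {u i..<u i + P}}"
    and fin: "finite {a\<in>L. sqrt ((\<Sum>i\<in>J. (real_of_int (a i))\<^sup>2) + (\<Sum>i\<in>J. c i * real_of_int (a i))\<^sup>2) \<le> T}"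
  defines "M \<equiv> card J" and "\<kappa> \<equiv> real k / P ^ card J"
  shows "\<bar>real (card {a\<in>L. sqrt ((\<Sum>i\<in>J. (real_of_int (a i))\<^sup>2) + (\<Sum>i\<in>J. c i * real_of_int (a i))\<^sup>2) \<le> T})
     - \<kappa> * (unit_ball_vol (real M) * T ^ M / sqrt (1 + (\<Sum>i\<in>J. (c i)\<^sup>2)))\<bar>
     \<le> \<kappa> * (unit_ball_vol (real M) * (2 * real M ^ 2 * (1 + 2 * real M) ^ (M - 1))) * P * T ^ (M - 1)"
proof -
  let ?M = "PiM J (\<lambda>_. lborel :: real measure)"
  define E where "E u = sqrt ((\<Sum>i\<in>J. (u i)\<^sup>2) + (\<Sum>i\<in>J. c i * u i)\<^sup>2)" for u :: "'a \<Rightarrow> real"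
  define D where "D = 2 * real M * P"
  define N where "N = real (card {a\<in>L. E (\<lambda>i. real_of_int (a i)) \<le> T})"
  define s where "s = sqrt (1 + (\<Sum>i\<in>J. (c i)\<^sup>2))"
  define V where "V = unit_ball_vol (real M)"
  define err where "err = V * (2 * real M ^ 2 * (1 + 2 * real M) ^ (M - 1)) * P * T ^ (M - 1)"
  have [measurable]: "E \<in> borel_measurable ?M" unfolding E_def[abs_def] by measurable
  have M: "1 \<le> M" using J by (simp add: M_def Suc_le_eq card_gt_0_iff)
  have V0: "0 < V" by (simp add: V_def)
  have s1: "1 \<le> s" by (simp add: s_def sum_nonneg)
  have T0: "0 < T" using P by simp
  have D0: "0 < D" using M P by (simp add: D_def)
  have \<kappa>0: "0 \<le> \<kappa>" using P by (simp add: \<kappa>_def)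
  have PM: "0 < P ^ M" using P by simp
  have lip: "E u \<le> E v + D" if "\<And>i. i \<in> J \<Longrightarrow> \<bar>u i - v i\<bar> \<le> P" for u v
    using ellipsoid_norm_lipschitz[OF J, of c P u v] c P that by (simp add: E_def D_def M_def)
  have ext: "E (restrict a J) = E a" for a by (simp add: E_def)
  note sw = box_count_sandwich[where J = J and P = P and E = E and D = D and L = L and k = k and T = T, OF J(1) P(1) _ ext lip box boxfin]
  have vol: "of_nat k * emeasure ?M {u \<in> space ?M. E u \<le> t} = ennreal (real k * (V * t ^ M / s))" if "0 < t" for t
  proof -
    have "0 \<le> V * t ^ M / s" using that s1 V0 by simp
    moreover have "emeasure ?M {u \<in> space ?M. E u \<le> t} = ennreal (V * t ^ M / s)"
      using emeasure_ellipsoid[OF J(1) that, of c] by (simp add: E_def s_def V_def M_def)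
    ultimately show ?thesis by (simp only: ennreal_mult'' ennreal_of_nat_eq_real_of_nat)
  qed
  have TD: "T + D \<le> (1 + 2 * real M) * T"
  proof -
    have "2 * real M * P \<le> 2 * real M * T" using P by (intro mult_left_mono) auto
    then show ?thesis by (simp add: D_def distrib_right)
  qed
  have pd: "x ^ M - y ^ M \<le> 2 * real M ^ 2 * (1 + 2 * real M) ^ (M - 1) * P * T ^ (M - 1)"
    if "0 \<le> y" "y \<le> x" "x \<le> T + D" "x - y \<le> D" for x y
  proof -
    have "x ^ M - y ^ M \<le> real M * (x - y) * x ^ (M - 1)" using that by (intro power_diff_le) auto
    also have "\<dots> \<le> real M * D * ((1 + 2 * real M) * T) ^ (M - 1)"
      using that TD D0 by (intro mult_mono power_mono) auto
    finally show ?thesis by (simp add: D_def power_mult_distrib power2_eq_square mult_ac)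
  qed
  have "ennreal (N * P ^ M) \<le> of_nat k * emeasure ?M {u \<in> space ?M. E u \<le> T + D}"
    using sw(2) fin unfolding N_def M_def E_def[abs_def] by simp
  also have "\<dots> = ennreal (real k * (V * (T + D) ^ M / s))" using T0 D0 by (intro vol) simp
  finally have "N * P ^ M \<le> real k * (V * (T + D) ^ M / s)"
    using T0 D0 V0 s1 by (subst (asm) ennreal_le_iff) auto
  then have "N \<le> \<kappa> * (V * (T + D) ^ M / s)"
  proof -
    assume "N * P ^ M \<le> real k * (V * (T + D) ^ M / s)"
    then have "N \<le> real k * (V * (T + D) ^ M / s) / P ^ M" using PM by (simp only: pos_le_divide_eq)
    then show ?thesis by (simp add: \<kappa>_def M_def mult_ac)
  qed
  also have "\<dots> = \<kappa> * (V * T ^ M / s) + \<kappa> * (V * ((T + D) ^ M - T ^ M)) / s"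
    by (simp add: algebra_simps diff_divide_distrib add_divide_distrib)
  also have "\<kappa> * (V * ((T + D) ^ M - T ^ M)) / s \<le> \<kappa> * (V * ((T + D) ^ M - T ^ M)) / 1"
    using s1 V0 \<kappa>0 T0 D0 by (intro divide_left_mono mult_nonneg_nonneg) (auto intro: power_mono)
  also have "\<dots> \<le> \<kappa> * err / 1"
    using pd[of T "T + D"] T0 D0 \<kappa>0 V0 unfolding err_def by (simp add: mult.assoc mult_left_mono)
  finally have up: "N - \<kappa> * (V * T ^ M / s) \<le> \<kappa> * err" by simp
  have lo: "\<kappa> * (V * T ^ M / s) - N \<le> \<kappa> * err"
  \<comment> \<open>For \<open>T <= D\<close> there is no inner ellipsoid; then the main term itself
    is below the error term, by the power estimate with \<open>y = 0\<close>.\<close>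
  proof (cases "D < T")
    case True
    have "ennreal (real k * (V * (T - D) ^ M / s)) = of_nat k * emeasure ?M {u \<in> space ?M. E u \<le> T - D}"
      using True by (intro vol[symmetric]) simp
    also have "\<dots> \<le> ennreal (N * P ^ M)"
      using sw(1) fin unfolding N_def M_def E_def[abs_def] by simp
    finally have "real k * (V * (T - D) ^ M / s) \<le> N * P ^ M"
      using PM by (subst (asm) ennreal_le_iff) (auto simp: N_def)
    then have "\<kappa> * (V * (T - D) ^ M / s) \<le> N"
    proof -
      assume "real k * (V * (T - D) ^ M / s) \<le> N * P ^ M"
      then have "real k * (V * (T - D) ^ M / s) / P ^ M \<le> N" using PM by (simp only: pos_divide_le_eq)
      then show ?thesis by (simp add: \<kappa>_def M_def mult_ac)
    qed
    then have "\<kappa> * (V * T ^ M / s) - N \<le> \<kappa> * (V * (T ^ M - (T - D) ^ M)) / s"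
      by (simp add: algebra_simps diff_divide_distrib add_divide_distrib)
    also have "\<dots> \<le> \<kappa> * (V * (T ^ M - (T - D) ^ M)) / 1"
      using s1 V0 \<kappa>0 True D0 by (intro divide_left_mono mult_nonneg_nonneg) (auto intro: power_mono)
    also have "\<dots> \<le> \<kappa> * err / 1"
      using pd[of "T - D" T] True D0 \<kappa>0 V0 unfolding err_def by (simp add: mult.assoc mult_left_mono)
    finally show ?thesis by simp
  next
    case False
    have "\<kappa> * (V * T ^ M / s) \<le> \<kappa> * (V * (T ^ M - 0 ^ M)) / 1"
    proof -
      have "\<kappa> * (V * T ^ M / s) = \<kappa> * (V * T ^ M) / s" by simp
      also have "\<dots> \<le> \<kappa> * (V * T ^ M) / 1" using s1 V0 \<kappa>0 T0 by (intro divide_left_mono) auto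
      also have "\<dots> = \<kappa> * (V * (T ^ M - 0 ^ M)) / 1" using M by (simp add: power_0_left)
      finally show ?thesis .
    qed
    also have "\<dots> \<le> \<kappa> * err / 1"
      using pd[of 0 T] False D0 T0 \<kappa>0 V0 unfolding err_def by (simp add: mult.assoc mult_left_mono)
    finally show ?thesis by (simp add: N_def)
  qed
  have "\<bar>N - \<kappa> * (V * T ^ M / s)\<bar> \<le> \<kappa> * err" using up lo by linarith
  then show ?thesis unfolding N_def E_def s_def V_def err_def by (simp add: mult.assoc)
qed

section \<open>Congruences in boxes\<close>

text \<open>The number \<open>N s\<close> of solutions turns out to be constant in \<open>s\<close>:
  its periods form a group of integers containing \<open>P\<close> and every \<open>y e\<close>,
  which by the gcd condition consists of all integers. Averaging over the residues \<open>s\<close>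
  gives the exact count. This covers the case where no single \<open>y e\<close> is invertible
  modulo \<open>P\<close>.\<close>

lemma card_box_linear_congruence:
  fixes y b :: "'a \<Rightarrow> int" and P s :: int
  assumes S: "finite S" and P: "0 < P"
    and gcd: "\<And>g. g dvd P \<Longrightarrow> (\<And>e. e \<in> S \<Longrightarrow> g dvd y e) \<Longrightarrow> is_unit g"
  shows "int (card {a \<in> PiE S (\<lambda>e. {b e..<b e + P}). P dvd s + (\<Sum>e\<in>S. y e * a e)}) * P = P ^ card S"
proof -
  let ?A = "PiE S (\<lambda>e. {b e..<b e + P})"
  let ?F = "\<lambda>a. \<Sum>e\<in>S. y e * a e"
  define N where "N s = card {a \<in> ?A. P dvd s + ?F a}" for s
  have finA: "finite ?A" using S by (intro finite_PiE) auto
  have step: "N (s + y e) \<le> N s" if e: "e \<in> S" for s e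
  proof -
    \<comment> \<open>A cyclic shift of coordinate \<open>e\<close> inside its box: that coordinate
      changes by \<open>1\<close> or by \<open>1 - P\<close>, so the linear form changes by
      \<open>y e\<close> modulo \<open>P\<close>.\<close>
    define \<phi> where "\<phi> a = a(e := if a e + 1 = b e + P then b e else a e + 1)" for a :: "'a \<Rightarrow> int"
    have ph: "\<phi> a \<in> ?A" if "a \<in> ?A" for a
    proof -
      have "b e \<le> a e" "a e < b e + P" using that e by (auto simp: PiE_iff)
      then show ?thesis using that e P unfolding \<phi>_def by (auto simp: PiE_iff extensional_def)
    qed
    have inj: "inj_on \<phi> ?A"
    proof (rule inj_onI)
      fix a a' assume a: "a \<in> ?A" "a' \<in> ?A" and eq: "\<phi> a = \<phi> a'"
      have "a e \<in> {b e..<b e + P}" "a' e \<in> {b e..<b e + P}" using a e by (auto simp: PiE_iff)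
      moreover have "\<phi> a e = \<phi> a' e" using eq by simp
      ultimately have "a e = a' e" unfolding \<phi>_def by (auto split: if_splits)
      moreover have "a i = a' i" if "i \<noteq> e" for i using fun_cong[OF eq, of i] that by (simp add: \<phi>_def)
      ultimately show "a = a'" by (metis ext)
    qed
    have F: "?F (\<phi> a) = ?F a + y e * (\<phi> a e - a e)" for a
    proof -
      have "?F (\<phi> a) - ?F a = (\<Sum>i\<in>S. y i * (\<phi> a i - a i))" by (simp add: right_diff_distrib sum_subtractf)
      also have "\<dots> = (\<Sum>i\<in>{e}. y i * (\<phi> a i - a i))"
        using S e by (intro sum.mono_neutral_right) (auto simp: \<phi>_def)
      finally show ?thesis by simp
    qed
    have dv: "P dvd s + ?F (\<phi> a)" if "P dvd s + y e + ?F a" for a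
    proof -
      have "\<phi> a e - a e = 1 \<or> \<phi> a e - a e = 1 - P" by (auto simp: \<phi>_def)
      then have "s + ?F (\<phi> a) = s + y e + ?F a \<or> s + ?F (\<phi> a) = s + y e + ?F a - P * y e"
      proof
        assume h: "\<phi> a e - a e = 1"
        show ?thesis unfolding F h by (intro disjI1) linarith
      next
        assume h: "\<phi> a e - a e = 1 - P"
        show ?thesis unfolding F h by (intro disjI2) (simp add: right_diff_distrib mult.commute)
      qed
      then show ?thesis
      proof
        assume h: "s + ?F (\<phi> a) = s + y e + ?F a"
        show ?thesis unfolding h by (rule that)
      next
        assume h: "s + ?F (\<phi> a) = s + y e + ?F a - P * y e"
        show ?thesis unfolding h by (intro dvd_diff that dvd_triv_left)
      qed
    qed
    show ?thesis unfolding N_def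
    proof (rule card_inj_on_le)
      show "inj_on \<phi> {a \<in> ?A. P dvd s + y e + ?F a}" by (rule inj_on_subset[OF inj]) blast
      show "\<phi> ` {a \<in> ?A. P dvd s + y e + ?F a} \<subseteq> {a \<in> ?A. P dvd s + ?F a}" using ph dv by blast
      show "finite {a \<in> ?A. P dvd s + ?F a}" using finA by simp
    qed
  qed
  have per: "N (s + P * k) = N s" for s k
  proof -
    have "P dvd s + P * k + z \<longleftrightarrow> P dvd s + z" for z
    proof -
      have "s + P * k + z = k * P + (s + z)" by simp
      then show ?thesis by (simp only: dvd_add_times_triv_left_iff)
    qed
    then show ?thesis by (simp only: N_def)
  qed
  define G where "G = {t. \<forall>s. N (s + t) = N s}"
  have GP: "P \<in> G" using per[of _ 1] by (simp add: G_def)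
  have Gy: "y e \<in> G" if e: "e \<in> S" for e
  proof -
    \<comment> \<open>The shift gives only \<open>N (s + y e) <= N s\<close>. Repeating it
      \<open>P\<close> times leads back to the start, since \<open>P * y e\<close> is a period, and
      this forces equality.\<close>
    have dec: "N (s + int k * y e) \<le> N s" for k s
    proof (induction k)
      case (Suc k)
      have "N (s + int (Suc k) * y e) = N (s + int k * y e + y e)" by (simp add: algebra_simps)
      also have "\<dots> \<le> N (s + int k * y e)" by (rule step[OF e])
      finally show ?case using Suc by simp
    qed simp
    have "N s \<le> N (s + y e)" for s
    proof -
      have "N s = N (s + P * y e)" by (simp add: per)
      also have "s + P * y e = (s + y e) + int (nat (P - 1)) * y e" using P by (simp add: algebra_simps)
      also have "N \<dots> \<le> N (s + y e)" by (rule dec)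
      finally show ?thesis .
    qed
    then show ?thesis using step[OF e] by (auto simp: G_def intro: antisym)
  qed
  have Gdiff: "t - t' \<in> G" if "t \<in> G" "t' \<in> G" for t t'
  proof -
    have "N (s + (t - t')) = N s" for s
    proof -
      have e: "N (z + t') = N z" for z using that(2) by (simp add: G_def)
      have "N (s + (t - t')) = N ((s + (t - t')) + t')" by (rule e[symmetric])
      also have "(s + (t - t')) + t' = s + t" by simp
      also have "N (s + t) = N s" using that(1) by (simp add: G_def)
      finally show ?thesis .
    qed
    then show ?thesis by (simp add: G_def)
  qed
  have G0: "0 \<in> G" by (simp add: G_def)
  have Gadd: "t + t' \<in> G" if "t \<in> G" "t' \<in> G" for t t'
    using Gdiff[OF that(1) Gdiff[OF G0 that(2)]] by simp
  have Gmult: "t * k \<in> G" if t: "t \<in> G" for t k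
  proof -
    have n: "t * int m \<in> G" for m
    proof (induction m)
      case (Suc m)
      then have "t + t * int m \<in> G" by (rule Gadd[OF t])
      then show ?case by (simp add: distrib_left)
    qed (simp add: G0)
    show ?thesis
    proof (cases "0 \<le> k")
      case True then show ?thesis using n[of "nat k"] by simp
    next
      case False then show ?thesis using Gdiff[OF G0 n[of "nat (-k)"]] by simp
    qed
  qed
  text \<open>The least positive period divides every period, hence is \<open>1\<close>.\<close>
  define g where "g = (LEAST m. 0 < m \<and> int m \<in> G)"
  have ex: "0 < nat P \<and> int (nat P) \<in> G" using P GP by simp
  have g: "0 < g" "int g \<in> G" using LeastI[of "\<lambda>m. 0 < m \<and> int m \<in> G", OF ex] by (auto simp: g_def)
  have gdvd: "int g dvd t" if t: "t \<in> G" for t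
  proof (rule ccontr)
    assume "\<not> int g dvd t"
    then have "t mod int g \<noteq> 0" by (simp add: dvd_eq_mod_eq_0)
    moreover have "0 \<le> t mod int g" "t mod int g < int g" using g by auto
    moreover have "t mod int g \<in> G"
      using Gdiff[OF t Gmult[OF g(2), of "t div int g"]] by (simp add: minus_mult_div_eq_mod)
    ultimately have "0 < nat (t mod int g) \<and> int (nat (t mod int g)) \<in> G" "nat (t mod int g) < g" by auto
    then show False using not_less_Least[of _ "\<lambda>m. 0 < m \<and> int m \<in> G"] unfolding g_def by blast
  qed
  have "is_unit (int g)" using gdvd GP Gy by (intro gcd) auto
  then have "1 \<in> G" using g by simp
  have const: "N s = N 0" for s
  proof -
    have "1 * s \<in> G" using \<open>1 \<in> G\<close> by (rule Gmult)
    then have "N (0 + 1 * s) = N 0" unfolding G_def mem_Collect_eq by (rule spec)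
    then show ?thesis by simp
  qed
  \<comment> \<open>Each \<open>a\<close> in the box satisfies the congruence for exactly one
    residue \<open>s\<close>, so the \<open>P\<close> equal numbers \<open>N s\<close> add up to the
    size of the box.\<close>
  have "(\<Sum>s\<in>{0..<P}. N s) = (\<Sum>s\<in>{0..<P}. \<Sum>a\<in>?A. if P dvd s + ?F a then 1 else 0)"
    unfolding N_def by (intro sum.cong refl) (simp only: card_eq_sum sum.inter_filter[OF finA])
  also have "\<dots> = (\<Sum>a\<in>?A. \<Sum>s\<in>{0..<P}. if P dvd s + ?F a then 1 else 0)" by (rule sum.swap)
  also have "\<dots> = (\<Sum>a\<in>?A. 1)"
  proof (rule sum.cong[OF refl])
    fix a
    have "{s \<in> {0..<P}. P dvd s + ?F a} = {(- ?F a) mod P}"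
    proof -
      have "P dvd s + ?F a \<longleftrightarrow> s mod P = (- ?F a) mod P" for s
        by (simp add: mod_eq_dvd_iff)
      note iff = this
      show ?thesis
      proof (rule set_eqI)
        fix s
        show "s \<in> {s \<in> {0..<P}. P dvd s + ?F a} \<longleftrightarrow> s \<in> {(- ?F a) mod P}"
          unfolding mem_Collect_eq iff singleton_iff
        proof
          assume h: "s \<in> {0..<P} \<and> s mod P = (- ?F a) mod P"
          then have "s mod P = s" by (intro mod_pos_pos_trivial) auto
          then show "s = (- ?F a) mod P" using h by (simp only:)
        next
          assume "s = (- ?F a) mod P"
          then show "s \<in> {0..<P} \<and> s mod P = (- ?F a) mod P" using P by simp
        qed
      qed
    qed
    then have "card {s \<in> {0..<P}. P dvd s + ?F a} = 1" by simp
    then show "(\<Sum>s\<in>{0..<P}. if P dvd s + ?F a then 1 else 0) = (1::nat)"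
      by (simp only: card_eq_sum sum.inter_filter[OF finite_atLeastLessThan_int])
  qed
  also have "\<dots> = (\<Prod>e\<in>S. nat P)" using S by (simp add: card_PiE)
  also have "(\<Sum>s\<in>{0..<P}. N s) = (\<Sum>s\<in>{0..<P}. N 0)" by (intro sum.cong refl const)
  finally have "nat P * N 0 = nat P ^ card S" by simp
  then have "int (nat P) * int (N 0) = int (nat P) ^ card S" by (simp only: flip: of_nat_mult of_nat_power)
  then have "int (N s) * P = P ^ card S" unfolding const[of s] using P by (simp add: mult.commute)
  then show ?thesis unfolding N_def .
qed

text \<open>The congruence modulo \<open>P ^ D\<close> is solved digit by digit: the variables of weight \<open>0\<close> settle it modulo \<open>P\<close>,
  and after division by \<open>P\<close> the remaining ones are left with a congruence of the same shape modulo \<open>P ^ (D - 1)\<close>.\<close>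
lemma card_box_weighted_congruence:
  fixes y b :: "'a \<Rightarrow> int" and P s :: int and w :: "'a \<Rightarrow> nat"
  assumes "finite J" and P: "0 < P" and "\<And>e. e \<in> J \<Longrightarrow> w e < D"
    and "\<And>v g. v < D \<Longrightarrow> g dvd P \<Longrightarrow> (\<And>e. e \<in> J \<Longrightarrow> w e = v \<Longrightarrow> g dvd y e) \<Longrightarrow> is_unit g"
  shows "int (card {a \<in> PiE J (\<lambda>e. {b e..<b e + P}). P ^ D dvd s + (\<Sum>e\<in>J. P ^ w e * y e * a e)}) * P ^ D = P ^ card J"
  using assms(1,3,4)
proof (induction D arbitrary: J w s)
  \<comment> \<open>No weight lies below \<open>0\<close>, so there are no variables and both sides
    are \<open>1\<close>.\<close>
  case 0
  then have "J = {}" by auto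
  then show ?case by simp
next
  case (Suc D)
  define J0 where "J0 = {e \<in> J. w e = 0}"
  define J1 where "J1 = {e \<in> J. w e \<noteq> 0}"
  have J: "J = J0 \<union> J1" "J0 \<inter> J1 = {}" "finite J0" "finite J1" using Suc.prems(1) by (auto simp: J0_def J1_def)
  let ?B = "\<lambda>e. {b e..<b e + P}"
  let ?F0 = "\<lambda>a. \<Sum>e\<in>J0. y e * a e"
  let ?F1 = "\<lambda>a. \<Sum>e\<in>J1. P ^ (w e - 1) * y e * a e"
  define A0 where "A0 = {a \<in> PiE J0 ?B. P dvd s + ?F0 a}"
  \<comment> \<open>The carry \<open>(s + ?F0 a0) div P\<close> is the new constant term, so this
    set depends on the first choice. Its cardinality does not, because the induction hypothesis
    holds for every \<open>s\<close>.\<close>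
  define A1 where "A1 a0 = {a \<in> PiE J1 ?B. P ^ D dvd (s + ?F0 a0) div P + ?F1 a}" for a0
  let ?A = "{a \<in> PiE J ?B. P ^ Suc D dvd s + (\<Sum>e\<in>J. P ^ w e * y e * a e)}"
  have split: "s + (\<Sum>e\<in>J. P ^ w e * y e * a e) = (s + ?F0 a) + P * ?F1 a" for a
  proof -
    have "(\<Sum>e\<in>J. P ^ w e * y e * a e) = (\<Sum>e\<in>J0. P ^ w e * y e * a e) + (\<Sum>e\<in>J1. P ^ w e * y e * a e)"
      unfolding J(1) using J by (intro sum.union_disjoint) auto
    also have "(\<Sum>e\<in>J0. P ^ w e * y e * a e) = ?F0 a" by (intro sum.cong) (auto simp: J0_def)
    also have "(\<Sum>e\<in>J1. P ^ w e * y e * a e) = P * ?F1 a"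
      unfolding sum_distrib_left
    proof (rule sum.cong[OF refl])
      fix e assume "e \<in> J1"
      then have "P ^ w e = P * P ^ (w e - 1)" by (cases "w e") (auto simp: J1_def)
      then show "P ^ w e * y e * a e = P * (P ^ (w e - 1) * y e * a e)" by simp
    qed
    finally show ?thesis by simp
  qed
  have dvd_iff: "P ^ Suc D dvd (s + ?F0 a) + P * ?F1 a' \<longleftrightarrow> P dvd s + ?F0 a \<and> P ^ D dvd (s + ?F0 a) div P + ?F1 a'" for a a'
  proof (cases "P dvd s + ?F0 a")
    case True
    then obtain q where q: "s + ?F0 a = P * q" by blast
    have "(s + ?F0 a) + P * ?F1 a' = P * (q + ?F1 a')" using q by (simp add: distrib_left)
    then show ?thesis using q P by simp
  next
    case False
    have "\<not> P ^ Suc D dvd (s + ?F0 a) + P * ?F1 a'"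
    proof
      assume "P ^ Suc D dvd (s + ?F0 a) + P * ?F1 a'"
      then have "P dvd (s + ?F0 a) + P * ?F1 a'" by (metis dvd_mult_left power_Suc)
      then show False using False by (simp add: dvd_add_left_iff)
    qed
    then show ?thesis using False by simp
  qed
  have c0: "?F0 (restrict a J0) = ?F0 a" and c1: "?F1 (restrict a J1) = ?F1 a" for a by simp_all
  have m0: "?F0 (merge J0 J1 (a, a')) = ?F0 a" and m1: "?F1 (merge J0 J1 (a, a')) = ?F1 a'" for a a'
    using J by (auto intro!: sum.cong)
  have "bij_betw (\<lambda>a. (restrict a J0, restrict a J1)) ?A (Sigma A0 A1)"
  proof (rule bij_betw_byWitness[where f' = "merge J0 J1"])
    show "\<forall>a\<in>?A. merge J0 J1 (restrict a J0, restrict a J1) = a"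
      using J by (auto simp: PiE_def extensional_restrict merge_def fun_eq_iff extensional_def)
    show "\<forall>a'\<in>Sigma A0 A1. (restrict (merge J0 J1 a') J0, restrict (merge J0 J1 a') J1) = a'"
      using J by (auto simp: A0_def A1_def PiE_def extensional_restrict)
    show "(\<lambda>a. (restrict a J0, restrict a J1)) ` ?A \<subseteq> Sigma A0 A1"
    proof (rule image_subsetI)
      fix a assume a: "a \<in> ?A"
      then have "P ^ Suc D dvd (s + ?F0 a) + P * ?F1 a" using split by simp
      then have "P dvd s + ?F0 a \<and> P ^ D dvd (s + ?F0 a) div P + ?F1 a" by (simp only: dvd_iff)
      moreover have "restrict a J0 \<in> PiE J0 ?B" "restrict a J1 \<in> PiE J1 ?B"
        using a by (auto simp: PiE_iff J(1))
      ultimately show "(restrict a J0, restrict a J1) \<in> Sigma A0 A1"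
        unfolding A0_def A1_def mem_Sigma_iff mem_Collect_eq c0 c1 by simp
    qed
    show "merge J0 J1 ` Sigma A0 A1 \<subseteq> ?A"
    proof (rule image_subsetI)
      fix z assume "z \<in> Sigma A0 A1"
      then obtain a a' where z: "z = (a, a')" "a \<in> A0" "a' \<in> A1 a" by auto
      have "merge J0 J1 (a, a') \<in> PiE J ?B"
        unfolding J(1) using z J(2) by (auto simp: A0_def A1_def PiE_def)
      moreover have "P ^ Suc D dvd s + (\<Sum>e\<in>J. P ^ w e * y e * merge J0 J1 (a, a') e)"
        unfolding split dvd_iff m0 m1 using z by (simp add: A0_def A1_def)
      ultimately show "merge J0 J1 z \<in> ?A" using z(1) by blast
    qed
  qed
  then have "card ?A = card (Sigma A0 A1)" by (rule bij_betw_same_card)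
  also have "\<dots> = (\<Sum>a\<in>A0. card (A1 a))"
    using J by (intro card_SigmaI) (auto simp: A0_def A1_def intro!: finite_PiE)
  finally have "int (card ?A) * P ^ Suc D = (\<Sum>a\<in>A0. int (card (A1 a))) * P ^ D * P" by simp
  also have "(\<Sum>a\<in>A0. int (card (A1 a))) * P ^ D = (\<Sum>a\<in>A0. int (card (A1 a)) * P ^ D)"
    by (rule sum_distrib_right)
  also have "(\<Sum>a\<in>A0. int (card (A1 a)) * P ^ D) = (\<Sum>a\<in>A0. P ^ card J1)"
  proof (rule sum.cong[OF refl])
    fix a assume "a \<in> A0"
    show "int (card (A1 a)) * P ^ D = P ^ card J1" unfolding A1_def
    proof (rule Suc.IH)
      show "finite J1" by fact
      \<comment> \<open>Division by \<open>P\<close> lowers the remaining weights by one, and level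
        \<open>v\<close> of the new congruence is level \<open>v + 1\<close> of the old one.\<close>
      show "w e - 1 < D" if "e \<in> J1" for e using that Suc.prems(2)[of e] by (auto simp: J1_def)
      show "is_unit g" if "v < D" "g dvd P" "\<And>e. e \<in> J1 \<Longrightarrow> w e - 1 = v \<Longrightarrow> g dvd y e" for v g
        using that by (intro Suc.prems(3)[of "Suc v" g]) (auto simp: J1_def)
    qed
  qed
  also have "\<dots> * P = (int (card A0) * P) * P ^ card J1" by simp
  also have "int (card A0) * P = P ^ card J0" unfolding A0_def
    using J P Suc.prems(3)[of 0] by (intro card_box_linear_congruence) (auto simp: J0_def)
  also have "P ^ card J0 * P ^ card J1 = P ^ card J"
    using J by (simp add: card_Un_disjoint power_add)
  finally show ?case .
qed

section \<open>Short vectors of a lattice\<close>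

text \<open>A spacing above \<open>2 * T\<close> keeps balls of radius \<open>T\<close> around the
  grid points apart, and at most \<open>3 * T\<close> keeps the grid short; since
  \<open>a <= T\<close>, some multiple falls in between.\<close>

lemma exists_multiple_between:
  fixes a T :: real
  assumes "0 < a" "a \<le> T"
  obtains j :: int where "2 * T < of_int j * a" "of_int j * a \<le> 3 * T" "0 < j"
proof
  let ?j = "\<lfloor>2 * T / a\<rfloor> + 1"
  have "2 * T / a < of_int ?j" by linarith
  then show 1: "2 * T < of_int ?j * a" using assms by (simp only: pos_divide_less_eq)
  have "of_int ?j \<le> 2 * T / a + 1" by linarith
  then have "of_int ?j * a \<le> (2 * T / a + 1) * a" using assms by (intro mult_right_mono) auto
  also have "\<dots> = 2 * T + a" using assms by (simp add: distrib_right)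
  finally show "of_int ?j * a \<le> 3 * T" using assms by simp
  show "0 < ?j" using 1 assms by (smt (verit) mult_nonpos_nonneg of_int_le_0_iff)
qed

text \<open>Two independent short vectors span, after Gram--Schmidt, a grid of about \<open>(P / T)\<^sup>2\<close> lattice points
  around which the balls of radius \<open>T\<close> are disjoint.\<close>
lemma card_short_vectors_rank_two:
  fixes G :: "('a \<Rightarrow> int) set" and I :: "'a set" and T P :: real
  defines "nrm \<equiv> \<lambda>a :: 'a \<Rightarrow> int. L2_set (\<lambda>i. real_of_int (a i)) I"
  assumes I: "finite I"
    and comb: "\<And>a b k l. a \<in> G \<Longrightarrow> b \<in> G \<Longrightarrow> (\<lambda>i. k * a i + l * b i) \<in> G"
    and fin: "\<And>t. finite {a\<in>G. nrm a \<le> t}"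
    and v: "v \<in> G" "nrm v \<le> T" and w: "w \<in> G" "nrm w \<le> T"
    and indep: "(\<Sum>i\<in>I. real_of_int (v i) * real_of_int (w i))\<^sup>2
      < (\<Sum>i\<in>I. (real_of_int (v i))\<^sup>2) * (\<Sum>i\<in>I. (real_of_int (w i))\<^sup>2)"
    and T: "0 < T" "T \<le> P"
  shows "real (card {a\<in>G. nrm a \<le> T}) * (P / (7 * T))\<^sup>2 \<le> real (card {a\<in>G. nrm a \<le> 2 * P})"
proof -
  define \<alpha> where "\<alpha> = (\<Sum>i\<in>I. (real_of_int (v i))\<^sup>2)"
  define \<beta> where "\<beta> = (\<Sum>i\<in>I. real_of_int (v i) * real_of_int (w i))"
  define \<gamma> where "\<gamma> = (\<Sum>i\<in>I. (real_of_int (w i))\<^sup>2)"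
  \<comment> \<open>The squared length of the component of \<open>w\<close> orthogonal to
    \<open>v\<close>.\<close>
  define \<delta> where "\<delta> = \<gamma> - \<beta>\<^sup>2 / \<alpha>"
  have n2: "(nrm a)\<^sup>2 = (\<Sum>i\<in>I. (real_of_int (a i))\<^sup>2)" for a by (simp add: nrm_def L2_set_def sum_nonneg)
  have n0: "0 \<le> nrm a" for a by (simp add: nrm_def)
  have "0 \<le> \<alpha>" "0 \<le> \<gamma>" by (simp_all add: \<alpha>_def \<gamma>_def sum_nonneg)
  have ind: "\<beta>\<^sup>2 < \<alpha> * \<gamma>" using indep by (simp add: \<alpha>_def \<beta>_def \<gamma>_def)
  have \<alpha>: "0 < \<alpha>" using ind \<open>0 \<le> \<alpha>\<close> zero_le_power2[of \<beta>] by (cases "\<alpha> = 0") auto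
  have \<delta>: "0 < \<delta>" using ind \<alpha> by (simp add: \<delta>_def pos_divide_less_eq mult.commute)
  have \<alpha>T: "sqrt \<alpha> \<le> T" using v(2) by (simp add: \<alpha>_def nrm_def L2_set_def)
  have "\<delta> \<le> \<gamma>" using \<alpha> by (simp add: \<delta>_def)
  then have \<delta>T: "sqrt \<delta> \<le> T" using w(2) by (simp add: \<gamma>_def nrm_def L2_set_def)
      (meson order_trans real_sqrt_le_mono)
  have form: "(nrm (\<lambda>i. k * v i + l * w i))\<^sup>2 = \<alpha> * (of_int k + of_int l * \<beta> / \<alpha>)\<^sup>2 + (of_int l)\<^sup>2 * \<delta>" for k l
  proof -
    have "(nrm (\<lambda>i. k * v i + l * w i))\<^sup>2 = (\<Sum>i\<in>I. (of_int k)\<^sup>2 * (real_of_int (v i))\<^sup>2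
       + 2 * of_int k * of_int l * (real_of_int (v i) * real_of_int (w i)) + (of_int l)\<^sup>2 * (real_of_int (w i))\<^sup>2)"
      unfolding n2 by (intro sum.cong refl) (simp add: power2_eq_square algebra_simps)
    also have "\<dots> = (of_int k)\<^sup>2 * \<alpha> + 2 * of_int k * of_int l * \<beta> + (of_int l)\<^sup>2 * \<gamma>"
      by (simp only: sum.distrib \<alpha>_def \<beta>_def \<gamma>_def flip: sum_distrib_left)
    also have "\<dots> = \<alpha> * (of_int k + of_int l * \<beta> / \<alpha>)\<^sup>2 + (of_int l)\<^sup>2 * \<delta>"
      using \<alpha> by (simp add: \<delta>_def power2_eq_square field_simps)
    finally show ?thesis .
  qed
  obtain j where j: "2 * T < of_int j * sqrt \<alpha>" "of_int j * sqrt \<alpha> \<le> 3 * T" "0 < j"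
    using exists_multiple_between[of "sqrt \<alpha>" T] \<alpha> \<alpha>T by auto
  obtain b where b: "2 * T < of_int b * sqrt \<delta>" "of_int b * sqrt \<delta> \<le> 3 * T" "0 < b"
    using exists_multiple_between[of "sqrt \<delta>" T] \<delta> \<delta>T by auto
  \<comment> \<open>Size reduction: adding \<open>a0 * v\<close> to \<open>b * w\<close> leaves a
    component along \<open>v\<close> that is no longer than \<open>v\<close> itself.\<close>
  define a0 where "a0 = - \<lfloor>of_int b * \<beta> / \<alpha>\<rfloor>"
  have a0: "\<bar>of_int a0 + of_int b * \<beta> / \<alpha>\<bar> \<le> 1" unfolding a0_def by linarith
  have j2: "4 * T\<^sup>2 < (of_int j)\<^sup>2 * \<alpha>" "(of_int j)\<^sup>2 * \<alpha> \<le> 9 * T\<^sup>2"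
    using power_strict_mono[OF j(1), of 2] power_mono[OF j(2), of 2] T j(3) \<alpha> by (auto simp: power_mult_distrib)
  have b2: "4 * T\<^sup>2 < (of_int b)\<^sup>2 * \<delta>" "(of_int b)\<^sup>2 * \<delta> \<le> 9 * T\<^sup>2"
    using power_strict_mono[OF b(1), of 2] power_mono[OF b(2), of 2] T b(3) \<delta> by (auto simp: power_mult_distrib)
  \<comment> \<open>The summand \<open>0 * w i\<close> gives \<open>V\<close> the shape that
    \<open>comb\<close> and \<open>form\<close> speak of.\<close>
  define V where "V i = j * v i + 0 * w i" for i
  define W where "W i = a0 * v i + b * w i" for i
  have nV: "nrm V \<le> 3 * T"
  proof (rule power2_le_imp_le)
    show "(nrm V)\<^sup>2 \<le> (3 * T)\<^sup>2" using form[of j 0] j2 by (simp add: V_def[abs_def] mult.commute power_mult_distrib)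
  qed (use T in simp)
  have nW: "nrm W \<le> 4 * T"
  proof (rule power2_le_imp_le)
    have "(of_int a0 + of_int b * \<beta> / \<alpha>)\<^sup>2 \<le> 1" using a0 by (simp add: abs_square_le_1)
    then have "\<alpha> * (of_int a0 + of_int b * \<beta> / \<alpha>)\<^sup>2 \<le> \<alpha>" using \<alpha> by (simp add: mult_left_le)
    also have "\<alpha> \<le> T\<^sup>2" using \<alpha>T \<alpha> by (metis less_eq_real_def real_sqrt_ge_0_iff real_sqrt_pow2 power_mono)
    finally have "(nrm W)\<^sup>2 \<le> T\<^sup>2 + 9 * T\<^sup>2" using form[of a0 b] b2 by (simp add: W_def[abs_def])
    also have "\<dots> \<le> (4 * T)\<^sup>2" by (simp add: power_mult_distrib)
    finally show "(nrm W)\<^sup>2 \<le> (4 * T)\<^sup>2" .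
  qed (use T in simp)
  \<comment> \<open>\<open>7 * T = 3 * T + 4 * T\<close> bounds the norms of \<open>V\<close> and
    \<open>W\<close> together, so \<open>p * V + q * W\<close> with \<open>p\<close> and
    \<open>q\<close> at most \<open>h\<close> has norm at most \<open>P\<close>, and adding a vector
    of norm at most \<open>T\<close> stays within \<open>2 * P\<close>.\<close>
  define h where "h = nat \<lfloor>P / (7 * T)\<rfloor>"
  have h: "real h \<le> P / (7 * T)" "P / (7 * T) \<le> real h + 1" using T by (auto simp: h_def)
  define S where "S = {a\<in>G. nrm a \<le> T}"
  define Y where "Y = (\<lambda>((p, q), a) i. int p * V i + int q * W i + a i)"
  have scale: "nrm (\<lambda>i. int p * a i) = real p * nrm a" for p a
    unfolding nrm_def by (simp add: L2_set_right_distrib)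
  have tri: "nrm (\<lambda>i. a i + a' i) \<le> nrm a + nrm a'" for a a'
    unfolding nrm_def of_int_add by (rule L2_set_triangle_ineq)
  have GV: "V \<in> G" and GW: "W \<in> G" unfolding V_def[abs_def] W_def[abs_def] by (rule comb[OF v(1) w(1)])+
  have sub: "Y ` (({0..h} \<times> {0..h}) \<times> S) \<subseteq> {a\<in>G. nrm a \<le> 2 * P}"
  proof (rule image_subsetI)
    fix z assume "z \<in> ({0..h} \<times> {0..h}) \<times> S"
    then obtain p q a where z: "z = ((p, q), a)" "p \<le> h" "q \<le> h" "a \<in> G" "nrm a \<le> T" by (auto simp: S_def)
    have "(\<lambda>i. int p * V i + int q * W i) \<in> G" by (rule comb[OF GV GW])
    from comb[OF this z(4), of 1 1] have "Y z \<in> G" by (simp add: Y_def z(1))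
    moreover have "nrm (Y z) \<le> nrm (\<lambda>i. int p * V i + int q * W i) + nrm a"
      unfolding Y_def z(1) prod.case by (rule tri)
    moreover have "nrm (\<lambda>i. int p * V i + int q * W i) \<le> real p * nrm V + real q * nrm W"
      using tri[of "\<lambda>i. int p * V i" "\<lambda>i. int q * W i"] by (simp only: scale)
    moreover have "real p * nrm V + real q * nrm W \<le> real h * (3 * T) + real h * (4 * T)"
      using z nV nW n0 T by (intro add_mono mult_mono) auto
    moreover have "real h * (7 * T) \<le> P" using h T by (simp add: pos_le_divide_eq)
    ultimately have "nrm (Y z) \<le> P + T" using z(5) by (simp add: mult_ac)
    then show "Y z \<in> {a\<in>G. nrm a \<le> 2 * P}" using T \<open>Y z \<in> G\<close> by simp
  qed
  have inj: "inj_on Y (({0..h} \<times> {0..h}) \<times> S)"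
  proof (rule inj_onI)
    fix z z' assume zz: "z \<in> ({0..h} \<times> {0..h}) \<times> S" "z' \<in> ({0..h} \<times> {0..h}) \<times> S" and eq: "Y z = Y z'"
    obtain p q a where z: "z = ((p, q), a)" "nrm a \<le> T" using zz(1) by (auto simp: S_def)
    obtain p' q' a' where z': "z' = ((p', q'), a')" "nrm a' \<le> T" using zz(2) by (auto simp: S_def)
    define dp where "dp = int p - int p'"
    define dq where "dq = int q - int q'"
    have "(dp * j + dq * a0) * v i + (dq * b) * w i = a' i - a i" for i
    proof -
      have "int p * V i + int q * W i + a i = int p' * V i + int q' * W i + a' i"
        using fun_cong[OF eq, of i] by (simp add: Y_def z z')
      then have "dp * V i + dq * W i = a' i - a i" by (simp add: dp_def dq_def algebra_simps)
      then show ?thesis by (simp add: V_def W_def algebra_simps)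
    qed
    then have "nrm (\<lambda>i. (dp * j + dq * a0) * v i + (dq * b) * w i) = nrm (\<lambda>i. a' i + - a i)" by simp
    also have "\<dots> \<le> nrm a' + nrm (\<lambda>i. - a i)" by (rule tri)
    also have "nrm (\<lambda>i. - a i) = nrm a" by (simp add: nrm_def L2_set_def)
    finally have "nrm (\<lambda>i. (dp * j + dq * a0) * v i + (dq * b) * w i) \<le> 2 * T" using z z' by simp
    then have "(nrm (\<lambda>i. (dp * j + dq * a0) * v i + (dq * b) * w i))\<^sup>2 \<le> (2 * T)\<^sup>2"
      using n0 by (intro power_mono) auto
    then have le: "\<alpha> * (of_int (dp * j + dq * a0) + of_int (dq * b) * \<beta> / \<alpha>)\<^sup>2 + (of_int (dq * b))\<^sup>2 * \<delta> \<le> 4 * T\<^sup>2"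
      unfolding form by (simp add: power_mult_distrib)
    have sq: "1 \<le> (real_of_int k)\<^sup>2" if "k \<noteq> 0" for k
    proof -
      have "1 \<le> \<bar>k\<bar>" using that by linarith
      then have "1 \<le> k\<^sup>2" by (metis power2_abs one_le_power)
      then show ?thesis by (metis of_int_1_le_iff of_int_power)
    qed
    \<comment> \<open>The difference of two short vectors has norm at most \<open>2 * T\<close>. A
      nonzero \<open>dq\<close> would make its component orthogonal to \<open>v\<close> longer than
      that, and once \<open>dq = 0\<close>, a nonzero \<open>dp\<close> would do the same along
      \<open>v\<close>.\<close>
    have "dq = 0"
    proof (rule ccontr)
      assume "dq \<noteq> 0"
      then have "1 * ((of_int b)\<^sup>2 * \<delta>) \<le> (of_int dq)\<^sup>2 * ((of_int b)\<^sup>2 * \<delta>)"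
        using sq \<delta> by (intro mult_right_mono) auto
      moreover have "0 \<le> \<alpha> * (of_int (dp * j + dq * a0) + of_int (dq * b) * \<beta> / \<alpha>)\<^sup>2" using \<alpha> by simp
      ultimately show False using le b2 by (simp add: power_mult_distrib mult.assoc)
    qed
    moreover have "dp = 0"
    proof (rule ccontr)
      assume "dp \<noteq> 0"
      then have "1 * ((of_int j)\<^sup>2 * \<alpha>) \<le> (of_int dp)\<^sup>2 * ((of_int j)\<^sup>2 * \<alpha>)"
        using sq \<alpha> by (intro mult_right_mono) auto
      then show False using le j2 \<open>dq = 0\<close> by (simp add: power_mult_distrib mult_ac)
    qed
    ultimately have "p = p'" "q = q'" by (auto simp: dp_def dq_def)
    then have "a = a'" using eq by (auto simp: Y_def z z' fun_eq_iff)
    then show "z = z'" using z z' \<open>p = p'\<close> \<open>q = q'\<close> by simp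
  qed
  have "card (({0..h} \<times> {0..h}) \<times> S) \<le> card {a\<in>G. nrm a \<le> 2 * P}"
    by (rule card_inj_on_le[OF inj sub fin])
  then have "real ((Suc h * Suc h) * card S) \<le> real (card {a\<in>G. nrm a \<le> 2 * P})"
    by (simp only: card_cartesian_product card_atLeastAtMost of_nat_le_iff) simp
  moreover have "real (card S) * (P / (7 * T))\<^sup>2 \<le> real (card S) * (real h + 1)\<^sup>2"
    using h T by (intro mult_left_mono power_mono) auto
  moreover have "real (card S) * (real h + 1)\<^sup>2 = real ((Suc h * Suc h) * card S)"
    by (simp add: power2_eq_square algebra_simps)
  ultimately show ?thesis unfolding S_def by linarith
qed

text \<open>Equality in Cauchy--Schwarz makes every vector of \<open>S\<close> proportional to a
  fixed nonzero \<open>v\<close>. With \<open>v k\<close> nonzero, the entry at \<open>k\<close>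
  determines the vector, and for a nonzero vector it is a nonzero integer of absolute value at most
  \<open>T\<close>.\<close>

lemma card_short_vectors_rank_one:
  fixes S :: "('a \<Rightarrow> int) set" and I :: "'a set" and T :: real
  assumes I: "finite I" and T: "0 \<le> T"
    and supp: "\<And>a i. a \<in> S \<Longrightarrow> i \<notin> I \<Longrightarrow> a i = 0"
    and short: "\<And>a. a \<in> S \<Longrightarrow> L2_set (\<lambda>i. real_of_int (a i)) I \<le> T"
    and dep: "\<And>v w. v \<in> S \<Longrightarrow> w \<in> S \<Longrightarrow> (\<Sum>i\<in>I. (real_of_int (v i))\<^sup>2) * (\<Sum>i\<in>I. (real_of_int (w i))\<^sup>2)
      \<le> (\<Sum>i\<in>I. real_of_int (v i) * real_of_int (w i))\<^sup>2"
  shows "real (card {a\<in>S. a \<noteq> (\<lambda>_. 0)}) \<le> 2 * T"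
proof (cases "{a\<in>S. a \<noteq> (\<lambda>_. 0)} = {}")
  case True
  show ?thesis unfolding True using T by simp
next
  case False
  then obtain v where v: "v \<in> S" "v \<noteq> (\<lambda>_. 0)" by auto
  then obtain k where k: "v k \<noteq> 0" by auto
  then have kI: "k \<in> I" using supp[OF v(1)] by auto
  define \<alpha> where "\<alpha> = (\<Sum>i\<in>I. (real_of_int (v i))\<^sup>2)"
  have \<alpha>: "0 < \<alpha>" unfolding \<alpha>_def using I kI k by (intro sum_pos2[of _ k]) auto
  define \<beta> where "\<beta> w = (\<Sum>i\<in>I. real_of_int (v i) * real_of_int (w i))" for w
  have par: "\<alpha> * real_of_int (w i) = \<beta> w * real_of_int (v i)" if w: "w \<in> S" and i: "i \<in> I" for w i
  proof -
    \<comment> \<open>Expanding the squares leaves \<alpha> times the difference of \<alpha> times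
      the squared norm of \<open>w\<close> and \<open>(\<beta> w)^2\<close>, which
      \<open>dep\<close> makes nonpositive.\<close>
    have "(\<Sum>i\<in>I. (\<alpha> * real_of_int (w i) - \<beta> w * real_of_int (v i))\<^sup>2)
       = (\<Sum>i\<in>I. \<alpha>\<^sup>2 * (real_of_int (w i))\<^sup>2 - 2 * \<alpha> * \<beta> w * (real_of_int (v i) * real_of_int (w i)) + (\<beta> w)\<^sup>2 * (real_of_int (v i))\<^sup>2)"
      by (intro sum.cong refl) (simp add: power2_eq_square algebra_simps)
    also have "\<dots> = \<alpha>\<^sup>2 * (\<Sum>i\<in>I. (real_of_int (w i))\<^sup>2) - 2 * \<alpha> * \<beta> w * \<beta> w + (\<beta> w)\<^sup>2 * \<alpha>"
      by (simp only: sum.distrib sum_subtractf \<beta>_def \<alpha>_def flip: sum_distrib_left)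
    also have "\<dots> = \<alpha> * (\<alpha> * (\<Sum>i\<in>I. (real_of_int (w i))\<^sup>2) - (\<beta> w)\<^sup>2)"
      by (simp add: power2_eq_square algebra_simps)
    also have "\<dots> \<le> 0" using dep[OF v(1) w] \<alpha> by (intro mult_nonneg_nonpos) (auto simp: \<alpha>_def \<beta>_def)
    finally have "(\<Sum>i\<in>I. (\<alpha> * real_of_int (w i) - \<beta> w * real_of_int (v i))\<^sup>2) = 0"
      by (intro antisym sum_nonneg) auto
    then show ?thesis using I i by (simp add: sum_nonneg_eq_0_iff)
  qed
  have eqI: "a = a'" if "a \<in> S" "a' \<in> S" "\<beta> a = \<beta> a'" for a a'
  proof
    fix i show "a i = a' i"
    proof (cases "i \<in> I")
      case True
      then have "\<alpha> * real_of_int (a i) = \<alpha> * real_of_int (a' i)" using par that by simp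
      then show ?thesis using \<alpha> by simp
    next
      case False then show ?thesis using supp[of a i] supp[of a' i] that by simp
    qed
  qed
  let ?m = "\<lfloor>T\<rfloor>"
  have inj: "inj_on (\<lambda>a. a k) {a\<in>S. a \<noteq> (\<lambda>_. 0)}"
  proof (rule inj_onI)
    fix a a' assume a: "a \<in> {a\<in>S. a \<noteq> (\<lambda>_. 0)}" "a' \<in> {a\<in>S. a \<noteq> (\<lambda>_. 0)}" and e: "a k = a' k"
    then have "\<beta> a * real_of_int (v k) = \<beta> a' * real_of_int (v k)" using par[of a k] par[of a' k] kI by auto
    then have "\<beta> a = \<beta> a'" using k by auto
    then show "a = a'" using a by (intro eqI) auto
  qed
  have im: "(\<lambda>a. a k) ` {a\<in>S. a \<noteq> (\<lambda>_. 0)} \<subseteq> {-?m..?m} - {0}"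
  proof (rule image_subsetI)
    fix a assume a: "a \<in> {a\<in>S. a \<noteq> (\<lambda>_. 0)}"
    have "\<bar>real_of_int (a k)\<bar> \<le> L2_set (\<lambda>i. \<bar>real_of_int (a i)\<bar>) I"
      using I kI by (intro member_le_L2_set)
    also have "\<dots> \<le> T" using short a by (simp add: L2_set_def)
    finally have "real_of_int \<bar>a k\<bar> \<le> T" by simp
    then have "\<bar>a k\<bar> \<le> ?m" by linarith
    moreover have "a k \<noteq> 0"
    proof
      assume "a k = 0"
      then have z: "\<beta> a = 0" using par[of a k] a kI k by simp
      have "a i = 0" for i using par[of a i] supp[of a i] a z \<alpha> by (cases "i \<in> I") auto
      then show False using a by auto
    qed
    ultimately show "a k \<in> {-?m..?m} - {0}" by auto
  qed
  have "card {a\<in>S. a \<noteq> (\<lambda>_. 0)} \<le> card ({-?m..?m} - {0})"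
    by (rule card_inj_on_le[OF inj im]) simp
  also have "\<dots> = nat (2 * ?m)" using T by (subst card_Diff_singleton) auto
  finally have "real (card {a\<in>S. a \<noteq> (\<lambda>_. 0)}) \<le> real (nat (2 * ?m))" by simp
  also have "\<dots> \<le> 2 * T" using T by linarith
  finally show ?thesis .
qed

text \<open>The dichotomy is strict inequality in Cauchy--Schwarz for some pair of short vectors
  against equality for all of them. The 49 is the square of the 7 in the grid construction. Leaving
  out the zero vector is what allows a bound proportional to \<open>T\<close> on a line.\<close>

lemma card_short_vectors:
  fixes G :: "('a \<Rightarrow> int) set" and I :: "'a set" and T P :: real
  defines "nrm \<equiv> \<lambda>a :: 'a \<Rightarrow> int. L2_set (\<lambda>i. real_of_int (a i)) I"
  assumes I: "finite I"
    and comb: "\<And>a b k l. a \<in> G \<Longrightarrow> b \<in> G \<Longrightarrow> (\<lambda>i. k * a i + l * b i) \<in> G"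
    and supp: "\<And>a i. a \<in> G \<Longrightarrow> i \<notin> I \<Longrightarrow> a i = 0"
    and fin: "\<And>t. finite {a\<in>G. nrm a \<le> t}"
    and T: "0 < T" "T \<le> P"
  shows "real (card {a\<in>G. nrm a \<le> T \<and> a \<noteq> (\<lambda>_. 0)})
    \<le> 2 * T + 49 * (T / P)\<^sup>2 * real (card {a\<in>G. nrm a \<le> 2 * P})"
proof (cases "\<exists>v\<in>{a\<in>G. nrm a \<le> T}. \<exists>w\<in>{a\<in>G. nrm a \<le> T}. (\<Sum>i\<in>I. real_of_int (v i) * real_of_int (w i))\<^sup>2
      < (\<Sum>i\<in>I. (real_of_int (v i))\<^sup>2) * (\<Sum>i\<in>I. (real_of_int (w i))\<^sup>2)")
  case True
  then obtain v w where vw: "v \<in> G" "nrm v \<le> T" "w \<in> G" "nrm w \<le> T"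
    "(\<Sum>i\<in>I. real_of_int (v i) * real_of_int (w i))\<^sup>2
      < (\<Sum>i\<in>I. (real_of_int (v i))\<^sup>2) * (\<Sum>i\<in>I. (real_of_int (w i))\<^sup>2)" by blast
  have "real (card {a\<in>G. nrm a \<le> T}) * (P / (7 * T))\<^sup>2 \<le> real (card {a\<in>G. nrm a \<le> 2 * P})"
    using vw I comb fin T unfolding nrm_def by (intro card_short_vectors_rank_two[of I G v T w P]) auto
  then have "real (card {a\<in>G. nrm a \<le> T}) \<le> 49 * (T / P)\<^sup>2 * real (card {a\<in>G. nrm a \<le> 2 * P})"
    using T by (simp add: power_divide power_mult_distrib field_simps)
  moreover have "card {a\<in>G. nrm a \<le> T \<and> a \<noteq> (\<lambda>_. 0)} \<le> card {a\<in>G. nrm a \<le> T}"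
    using fin by (intro card_mono) auto
  ultimately show ?thesis using T by linarith
next
  case False
  have "real (card {a\<in>{a\<in>G. nrm a \<le> T}. a \<noteq> (\<lambda>_. 0)}) \<le> 2 * T"
    using False T I supp by (intro card_short_vectors_rank_one[of I]) (auto simp: nrm_def not_less)
  moreover have "{a\<in>{a\<in>G. nrm a \<le> T}. a \<noteq> (\<lambda>_. 0)} = {a\<in>G. nrm a \<le> T \<and> a \<noteq> (\<lambda>_. 0)}" by auto
  moreover have "0 \<le> 49 * (T / P)\<^sup>2 * real (card {a\<in>G. nrm a \<le> 2 * P})" by simp
  ultimately show ?thesis by (simp only:)
qed

section \<open>The lattice of hypersurfaces through a point\<close>

lemma abs_le_L2_set:
  assumes "finite I" "i \<in> I"
  shows "\<bar>real_of_int (a i)\<bar> \<le> L2_set (\<lambda>i. real_of_int (a i)) I"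
proof -
  have "\<bar>real_of_int (a i)\<bar> \<le> L2_set (\<lambda>i. \<bar>real_of_int (a i)\<bar>) I" using assms by (rule member_le_L2_set)
  then show ?thesis by (simp add: L2_set_def)
qed

lemma finite_bounded_int_vectors:
  fixes I :: "'a set"
  assumes I: "finite I"
  shows "finite {a :: 'a \<Rightarrow> int. (\<forall>i. i \<notin> I \<longrightarrow> a i = 0) \<and> L2_set (\<lambda>i. real_of_int (a i)) I \<le> t}"
proof -
  have "{a :: 'a \<Rightarrow> int. (\<forall>i. i \<notin> I \<longrightarrow> a i = 0) \<and> L2_set (\<lambda>i. real_of_int (a i)) I \<le> t}
     \<subseteq> {a. \<forall>i. (i \<in> I \<longrightarrow> a i \<in> {-\<lfloor>t\<rfloor>..\<lfloor>t\<rfloor>}) \<and> (i \<notin> I \<longrightarrow> a i = 0)}"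
  proof (intro subsetI CollectI allI conjI impI)
    fix a :: "'a \<Rightarrow> int" and i
    assume "a \<in> {a. (\<forall>i. i \<notin> I \<longrightarrow> a i = 0) \<and> L2_set (\<lambda>i. real_of_int (a i)) I \<le> t}"
    then have a: "L2_set (\<lambda>i. real_of_int (a i)) I \<le> t" and z: "i \<notin> I \<Longrightarrow> a i = 0" by auto
    show "a i = 0" if "i \<notin> I" using z that .
    assume i: "i \<in> I"
    have "real_of_int \<bar>a i\<bar> \<le> t" using abs_le_L2_set[OF I i, of a] a by simp
    then have "\<bar>a i\<bar> \<le> \<lfloor>t\<rfloor>" by linarith
    then show "a i \<in> {-\<lfloor>t\<rfloor>..\<lfloor>t\<rfloor>}" by auto
  qed
  then show ?thesis by (rule finite_subset) (intro finite_set_of_finite_funs I finite_atLeastAtMost_int)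
qed

text \<open>The constant of the error term in \<open>lattice_count_ellipsoid\<close>, in terms of
  the rank alone.\<close>

definition lattice_const :: "nat \<Rightarrow> real" where
  "lattice_const M = unit_ball_vol (real M) * (2 * real M ^ 2 * (1 + 2 * real M) ^ (M - 1))"

lemma lattice_const_nonneg: "0 \<le> lattice_const M"
  by (simp add: lattice_const_def)

text \<open>Every half-open unit box contains one integer vector, obtained by rounding its corner
  up, so the ellipsoid count applies with zero linear form, \<open>P = 1\<close> and
  \<open>k = 1\<close>.\<close>

lemma count_int_vectors:
  fixes I :: "'a set"
  assumes I: "finite I" "I \<noteq> {}" and T: "1 \<le> T"
  shows "\<bar>real (card {a :: 'a \<Rightarrow> int. (\<forall>i. i \<notin> I \<longrightarrow> a i = 0) \<and> L2_set (\<lambda>i. real_of_int (a i)) I \<le> T})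
    - unit_ball_vol (real (card I)) * T ^ card I\<bar> \<le> lattice_const (card I) * T ^ (card I - 1)"
proof -
  define L where "L = {a :: 'a \<Rightarrow> int. \<forall>i. i \<notin> I \<longrightarrow> a i = 0}"
  have one: "{a\<in>L. \<forall>i\<in>I. real_of_int (a i) \<in> {u i..<u i + 1}} = {\<lambda>i. if i \<in> I then \<lceil>u i\<rceil> else 0}" for u :: "'a \<Rightarrow> real"
  proof -
    have "real_of_int z \<in> {t..<t + 1} \<longleftrightarrow> z = \<lceil>t\<rceil>" for z :: int and t :: real
      by (simp add: ceiling_eq_iff eq_commute[of z]) linarith
    then have *: "(\<forall>i\<in>I. real_of_int (a i) \<in> {u i..<u i + 1}) \<longleftrightarrow> (\<forall>i\<in>I. a i = \<lceil>u i\<rceil>)" for a :: "'a \<Rightarrow> int" by simp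
    show ?thesis unfolding * by (auto simp: L_def fun_eq_iff)
  qed
  have e: "sqrt ((\<Sum>i\<in>I. (real_of_int (a i))\<^sup>2) + (\<Sum>i\<in>I. 0 * real_of_int (a i))\<^sup>2) = L2_set (\<lambda>i. real_of_int (a i)) I" for a :: "'a \<Rightarrow> int"
    by (simp add: L2_set_def)
  have "{a\<in>L. L2_set (\<lambda>i. real_of_int (a i)) I \<le> T} = {a. (\<forall>i. i \<notin> I \<longrightarrow> a i = 0) \<and> L2_set (\<lambda>i. real_of_int (a i)) I \<le> T}"
    by (auto simp: L_def)
  moreover from this have "finite {a\<in>L. L2_set (\<lambda>i. real_of_int (a i)) I \<le> T}" using finite_bounded_int_vectors[OF I(1)] by simp
  ultimately show ?thesis
    using lattice_count_ellipsoid[where c = "\<lambda>_. 0" and L = L and P = 1 and k = 1 and T = T, OF I] T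
    unfolding e one by (simp add: lattice_const_def)
qed

text \<open>The gcd of a nonzero vector divides a nonzero entry, so it is at most \<open>T\<close>;
  and the vectors whose gcd is divisible by \<open>k\<close> are the \<open>k\<close>-fold multiples
  of vectors of \<open>G\<close>. The zero vector has gcd \<open>0\<close> and must be left out on
  the right. The weight \<open>f\<close> is \<open>1\<close> for counting and the inverse Veronese
  norm for the sum over points.\<close>

lemma sum_primitive_eq_moebius_sum:
  fixes I :: "'a set" and G :: "('a \<Rightarrow> int) set" and f :: "('a \<Rightarrow> int) \<Rightarrow> real" and T :: real
  defines "nrm \<equiv> \<lambda>a :: 'a \<Rightarrow> int. L2_set (\<lambda>i. real_of_int (a i)) I"
  assumes I: "finite I" and T: "0 \<le> T"
    and supp: "\<And>a i. a \<in> G \<Longrightarrow> i \<notin> I \<Longrightarrow> a i = 0"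
    and scale: "\<And>a k. 0 < k \<Longrightarrow> (\<lambda>i. k * a i) \<in> G \<longleftrightarrow> a \<in> G"
  shows "(\<Sum>a | a \<in> G \<and> Gcd (a ` I) = 1 \<and> nrm a \<le> T. f a)
    = (\<Sum>k\<in>{1..nat \<lfloor>T\<rfloor>}. moebius_mu k * (\<Sum>a | a \<in> G \<and> a \<noteq> (\<lambda>_. 0) \<and> nrm a \<le> T / real k. f (\<lambda>i. int k * a i)))"
proof -
  define S where "S = {a. a \<in> G \<and> a \<noteq> (\<lambda>_. 0) \<and> nrm a \<le> T}"
  define g where "g a = nat (Gcd (a ` I))" for a :: "'a \<Rightarrow> int"
  have gdvd: "int (g a) dvd a i" if "i \<in> I" for a i
    using that by (simp add: g_def)
  have "S \<subseteq> {a. (\<forall>i. i \<notin> I \<longrightarrow> a i = 0) \<and> L2_set (\<lambda>i. real_of_int (a i)) I \<le> T}"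
    using supp by (auto simp: S_def nrm_def)
  then have finS: "finite S" using finite_bounded_int_vectors[OF I] by (rule finite_subset)
  have nz: "\<exists>i\<in>I. a i \<noteq> 0" if "a \<in> S" for a
    using that supp by (auto simp: S_def fun_eq_iff)
  have gpos: "0 < g a" if a: "a \<in> S" for a
  proof -
    have "Gcd (a ` I) \<noteq> 0" using nz[OF a] by (auto simp: Gcd_0_iff)
    moreover have "0 \<le> Gcd (a ` I)" by simp
    ultimately show ?thesis unfolding g_def by linarith
  qed
  have gle: "g a \<le> nat \<lfloor>T\<rfloor>" if a: "a \<in> S" for a
  proof -
    obtain i where i: "i \<in> I" "a i \<noteq> 0" using nz[OF a] by auto
    have "int (g a) \<le> \<bar>a i\<bar>" using gdvd[OF i(1)] i(2) by (intro zdvd_imp_le) auto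
    moreover have "\<bar>real_of_int (a i)\<bar> \<le> T" using abs_le_L2_set[OF I i(1), of a] a by (simp add: S_def nrm_def)
    then have "\<bar>a i\<bar> \<le> \<lfloor>T\<rfloor>" by linarith
    ultimately show ?thesis by linarith
  qed
  have "{a. a \<in> G \<and> Gcd (a ` I) = 1 \<and> nrm a \<le> T} = {a. a \<in> S \<and> g a = 1}"
  proof (intro Collect_cong iffI)
    fix a assume a: "a \<in> G \<and> Gcd (a ` I) = 1 \<and> nrm a \<le> T"
    have "a \<noteq> (\<lambda>_. 0)"
    proof
      assume "a = (\<lambda>_. 0)"
      then have "Gcd (a ` I) = 0" by (auto simp: Gcd_0_iff)
      then show False using a by simp
    qed
    then show "a \<in> S \<and> g a = 1" using a by (simp add: S_def g_def)
  next
    fix a assume "a \<in> S \<and> g a = 1"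
    then show "a \<in> G \<and> Gcd (a ` I) = 1 \<and> nrm a \<le> T" by (auto simp: S_def g_def)
  qed
  then have "(\<Sum>a | a \<in> G \<and> Gcd (a ` I) = 1 \<and> nrm a \<le> T. f a) = (\<Sum>a | a \<in> S \<and> g a = 1. f a)" by simp
  also have "\<dots> = (\<Sum>k\<in>{1..nat \<lfloor>T\<rfloor>}. moebius_mu k * (\<Sum>a | a \<in> S \<and> k dvd g a. f a))"
    using finS gpos gle by (rule sum_gcd_one_eq_moebius_sum)
  also have "\<dots> = (\<Sum>k\<in>{1..nat \<lfloor>T\<rfloor>}. moebius_mu k * (\<Sum>a | a \<in> G \<and> a \<noteq> (\<lambda>_. 0) \<and> nrm a \<le> T / real k. f (\<lambda>i. int k * a i)))"
  proof (rule sum.cong[OF refl])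
    fix k assume "k \<in> {1..nat \<lfloor>T\<rfloor>}"
    then have k: "0 < k" by simp
    have nk: "nrm (\<lambda>i. int k * a i) = real k * nrm a" for a
      unfolding nrm_def by (simp add: L2_set_right_distrib)
    have "(\<Sum>a | a \<in> S \<and> k dvd g a. f a) = (\<Sum>a | a \<in> G \<and> a \<noteq> (\<lambda>_. 0) \<and> nrm a \<le> T / real k. f (\<lambda>i. int k * a i))"
    proof (rule sum.reindex_bij_witness[where i = "\<lambda>a i. int k * a i" and j = "\<lambda>a i. a i div int k"])
      fix a assume a: "a \<in> {a. a \<in> S \<and> k dvd g a}"
      have "int k dvd a i" for i
      proof (cases "i \<in> I")
        case True
        have "int k dvd int (g a)" using a by simp
        then show ?thesis using gdvd[OF True] by (rule dvd_trans)
      next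
        case False
        have "a \<in> G" using a by (simp add: S_def)
        then have "a i = 0" using False by (rule supp)
        then show ?thesis by simp
      qed
      then show *: "(\<lambda>i. int k * (a i div int k)) = a" by simp
      then show "f (\<lambda>i. int k * (a i div int k)) = f a" by simp
      define a' where "a' i = a i div int k" for i
      have a': "a = (\<lambda>i. int k * a' i)" using * by (simp add: a'_def)
      have "a' \<in> G" using a scale[of "int k" a'] k by (simp add: S_def a')
      moreover have "a' \<noteq> (\<lambda>_. 0)" using a by (auto simp: S_def a')
      moreover have "nrm a' \<le> T / real k" using a k nk[of a'] by (simp add: S_def pos_le_divide_eq mult.commute flip: a')
      ultimately show "(\<lambda>i. a i div int k) \<in> {a. a \<in> G \<and> a \<noteq> (\<lambda>_. 0) \<and> nrm a \<le> T / real k}" by (simp add: a'_def[abs_def])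
    next
      fix a assume a: "a \<in> {a. a \<in> G \<and> a \<noteq> (\<lambda>_. 0) \<and> nrm a \<le> T / real k}"
      show "(\<lambda>i. (int k * a i) div int k) = a" using k by simp
      have "int k dvd Gcd ((\<lambda>i. int k * a i) ` I)" by (rule Gcd_greatest) auto
      then have "int k dvd int (g (\<lambda>i. int k * a i))" by (simp add: g_def)
      then have "k dvd g (\<lambda>i. int k * a i)" by simp
      moreover have "(\<lambda>i. int k * a i) \<noteq> (\<lambda>_. 0)" using a k by (auto simp: fun_eq_iff)
      moreover have "nrm (\<lambda>i. int k * a i) \<le> T" using a k nk[of a] by (simp add: pos_le_divide_eq mult.commute)
      ultimately show "(\<lambda>i. int k * a i) \<in> {a. a \<in> S \<and> k dvd g a}"
        using a k scale[of "int k" a] by (simp add: S_def)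
    qed
    then show "moebius_mu k * (\<Sum>a | a \<in> S \<and> k dvd g a. f a)
      = moebius_mu k * (\<Sum>a | a \<in> G \<and> a \<noteq> (\<lambda>_. 0) \<and> nrm a \<le> T / real k. f (\<lambda>i. int k * a i))" by (rule arg_cong)
  qed
  finally show ?thesis .
qed

section \<open>Monomials of degree d, and forms vanishing at a point\<close>

lemma finite_mons: "finite (mons d n)"
proof -
  have "mons d n \<subseteq> {e. \<forall>i. (i \<in> {..n} \<longrightarrow> e i \<in> {..d}) \<and> (i \<notin> {..n} \<longrightarrow> e i = 0)}"
    by (auto simp: mons_def intro!: member_le_sum)
  then show ?thesis by (rule finite_subset) (intro finite_set_of_finite_funs; simp)
qed

text \<open>Stars and bars, after writing the exponents as a list of length \<open>n + 1\<close>
  with sum \<open>d\<close>.\<close>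

lemma card_mons: "card (mons d n) = Ndn d n"
proof -
  have "bij_betw (\<lambda>e. map e [0..<Suc n]) (mons d n) {l. length l = Suc n \<and> sum_list l = d}"
  proof (rule bij_betw_byWitness[where f' = "\<lambda>l i. if i < Suc n then l ! i else 0"])
    have s: "sum_list (map e [0..<Suc n]) = (\<Sum>i\<le>n. e i)" for e :: "nat \<Rightarrow> nat"
      by (subst interv_sum_list_conv_sum_set_nat) (simp only: set_upt atLeast0LessThan lessThan_Suc_atMost)
    show "(\<lambda>e. map e [0..<Suc n]) ` mons d n \<subseteq> {l. length l = Suc n \<and> sum_list l = d}"
      using s by (auto simp: mons_def simp del: upt_Suc)
    show "\<forall>e\<in>mons d n. (\<lambda>i. if i < Suc n then map e [0..<Suc n] ! i else 0) = e"
      by (auto simp: mons_def fun_eq_iff simp del: upt_Suc)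
    show "\<forall>l\<in>{l. length l = Suc n \<and> sum_list l = d}. map (\<lambda>i. if i < Suc n then l ! i else 0) [0..<Suc n] = l"
      by (auto intro!: nth_equalityI simp del: upt_Suc)
    show "(\<lambda>l i. if i < Suc n then l ! i else 0) ` {l. length l = Suc n \<and> sum_list l = d} \<subseteq> mons d n"
    proof safe
      fix l :: "nat list" assume l: "length l = Suc n" "d = sum_list l"
      have "(\<Sum>i\<le>n. if i < Suc n then l ! i else 0) = (\<Sum>i\<le>n. l ! i)" by (intro sum.cong) auto
      also have "\<dots> = sum_list l" unfolding sum_list_sum_nth l(1) by (simp add: atLeast0LessThan lessThan_Suc_atMost)
      finally show "(\<lambda>i. if i < Suc n then l ! i else 0) \<in> mons (sum_list l) n" by (simp add: mons_def)
    qed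
  qed
  then have "card (mons d n) = card {l. length l = Suc n \<and> sum_list l = d}" by (rule bij_betw_same_card)
  also have "\<dots> = (d + Suc n - 1) choose d" by (rule card_length_sum_list)
  finally show ?thesis by (simp add: Ndn_def add.commute)
qed

definition pure_mon :: "nat \<Rightarrow> nat \<Rightarrow> nat \<Rightarrow> nat" where
  "pure_mon d p = (\<lambda>i. if i = p then d else 0)"

lemma pure_mon_in_mons: "p \<le> n \<Longrightarrow> pure_mon d p \<in> mons d n"
  by (auto simp: mons_def pure_mon_def)

lemma mons_le: "e \<in> mons d n \<Longrightarrow> e p \<le> d"
  by (cases "p \<le> n") (auto simp: mons_def intro!: member_le_sum)

lemma mons_eq_pure_mon:
  assumes e: "e \<in> mons d n" and p: "p \<le> n" and "e p = d"
  shows "e = pure_mon d p"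
proof -
  have "(\<Sum>i\<le>n. e i) = e p + (\<Sum>i\<in>{..n}-{p}. e i)" using p by (intro sum.remove) auto
  then have "(\<Sum>i\<in>{..n}-{p}. e i) = 0" using assms by (simp add: mons_def)
  then have "e i = 0" if "i \<noteq> p" for i using e that by (cases "i \<le> n") (auto simp: mons_def)
  then show ?thesis using assms by (auto simp: pure_mon_def)
qed

lemma prod_pure_mon: "p \<le> n \<Longrightarrow> (\<Prod>i\<le>n. x i ^ pure_mon d p i) = (x p :: 'a :: comm_semiring_1) ^ d"
proof -
  assume p: "p \<le> n"
  have "(\<Prod>i\<le>n. x i ^ pure_mon d p i) = (\<Prod>i\<le>n. if i = p then x p ^ d else 1)"
    by (intro prod.cong) (auto simp: pure_mon_def)
  then show ?thesis using p by simp
qed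

lemma prod_powers_le:
  fixes x :: "nat \<Rightarrow> real"
  assumes "e \<in> mons d n" "\<And>i. i \<le> n \<Longrightarrow> \<bar>x i\<bar> \<le> R"
  shows "\<bar>\<Prod>i\<le>n. x i ^ e i\<bar> \<le> R ^ d"
proof -
  have "\<bar>\<Prod>i\<le>n. x i ^ e i\<bar> = (\<Prod>i\<le>n. \<bar>x i\<bar> ^ e i)" by (simp add: abs_prod power_abs)
  also have "\<dots> \<le> (\<Prod>i\<le>n. R ^ e i)" using assms by (intro prod_mono conjI power_mono) auto
  also have "\<dots> = R ^ d" using assms by (simp add: mons_def flip: power_sum)
  finally show ?thesis .
qed

definition coeff_lattice :: "nat \<Rightarrow> nat \<Rightarrow> (nat \<Rightarrow> int) \<Rightarrow> ((nat \<Rightarrow> nat) \<Rightarrow> int) set" where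
  "coeff_lattice d n x = {a. coeff_vec d n a \<and> form_eval d n a x = 0}"

text \<open>The coefficient of \<open>x p ^ d\<close> is determined by the others, and it is an
  integer exactly when a congruence modulo \<open>P ^ d\<close> holds. In that congruence the
  monomial \<open>e\<close> has weight \<open>e p\<close>, the power of \<open>x p\<close> contained
  in it. Primitivity of \<open>x\<close> makes the cofactors of each weight below \<open>d\<close>
  jointly coprime to \<open>P\<close>, as the digit by digit count requires.\<close>

lemma card_coeff_lattice_box:
  fixes x :: "nat \<Rightarrow> int" and u :: "(nat \<Rightarrow> nat) \<Rightarrow> real" and d n p :: nat
  assumes x: "prim_vec n x" and p: "p \<le> n" "x p \<noteq> 0"
  defines "J \<equiv> mons d n - {pure_mon d p}" and "P \<equiv> \<bar>x p\<bar>"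
  shows "int (card {a \<in> coeff_lattice d n x. \<forall>i\<in>J. real_of_int (a i) \<in> {u i..<u i + real_of_int P}}) * P ^ d = P ^ card J"
    and "finite {a \<in> coeff_lattice d n x. \<forall>i\<in>J. real_of_int (a i) \<in> {u i..<u i + real_of_int P}}"
proof -
  let ?q = "pure_mon d p"
  \<comment> \<open>The cofactor of \<open>P ^ e p\<close> in the monomial; a sign enters because
    \<open>P\<close> is the absolute value of \<open>x p\<close>.\<close>
  define y where "y e = sgn (x p) ^ e p * (\<Prod>i\<in>{..n}-{p}. x i ^ e i)" for e :: "nat \<Rightarrow> nat"
  have P: "0 < P" using p by (simp add: P_def)
  have J: "finite J" using finite_mons by (simp add: J_def)
  have mon: "(\<Prod>i\<le>n. x i ^ e i) = P ^ e p * y e" for e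
  proof -
    have "(\<Prod>i\<le>n. x i ^ e i) = x p ^ e p * (\<Prod>i\<in>{..n}-{p}. x i ^ e i)" using p by (intro prod.remove) auto
    also have "x p = P * sgn (x p)" by (simp add: P_def abs_mult_sgn)
    finally show ?thesis by (simp add: y_def power_mult_distrib)
  qed
  have q: "?q \<in> mons d n" using p by (intro pure_mon_in_mons)
  have ev: "form_eval d n a x = a ?q * x p ^ d + (\<Sum>e\<in>J. P ^ e p * y e * a e)" for a
  proof -
    have "form_eval d n a x = a ?q * (\<Prod>i\<le>n. x i ^ ?q i) + (\<Sum>e\<in>J. a e * (\<Prod>i\<le>n. x i ^ e i))"
      unfolding form_eval_def J_def using q finite_mons by (intro sum.remove) auto
    also have "(\<Sum>e\<in>J. a e * (\<Prod>i\<le>n. x i ^ e i)) = (\<Sum>e\<in>J. P ^ e p * y e * a e)"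
      unfolding mon by (intro sum.cong refl) simp
    finally show ?thesis using p by (simp add: prod_pure_mon)
  qed
  have Pd: "P ^ d dvd z \<longleftrightarrow> x p ^ d dvd z" for z
    by (simp add: P_def flip: power_abs)
  let ?B = "\<lambda>e. {\<lceil>u e\<rceil>..<\<lceil>u e\<rceil> + P}"
  have box: "real_of_int z \<in> {t..<t + real_of_int P} \<longleftrightarrow> z \<in> {\<lceil>t\<rceil>..<\<lceil>t\<rceil> + P}" for z t
    by (simp add: ceiling_le_iff) linarith
  let ?S = "{a \<in> coeff_lattice d n x. \<forall>i\<in>J. real_of_int (a i) \<in> {u i..<u i + real_of_int P}}"
  let ?R = "{a \<in> PiE J ?B. P ^ d dvd 0 + (\<Sum>e\<in>J. P ^ e p * y e * a e)}"
  \<comment> \<open>The inverse of the restriction to \<open>J\<close>: the eliminated coefficient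
    is recovered by a division that is exact on \<open>?R\<close>.\<close>
  let ?ext = "\<lambda>a e. if e \<in> J then a e else if e = ?q then - (\<Sum>e\<in>J. P ^ e p * y e * a e) div x p ^ d else (0::int)"
  have bij: "bij_betw (\<lambda>a. restrict a J) ?S ?R"
  proof (rule bij_betw_byWitness[where f' = ?ext])
    show "\<forall>a\<in>?S. ?ext (restrict a J) = a"
    proof (intro ballI ext)
      fix a e assume a: "a \<in> ?S"
      then have z: "a ?q * x p ^ d + (\<Sum>e\<in>J. P ^ e p * y e * a e) = 0"
        using ev[of a] by (simp add: coeff_lattice_def)
      then have "- (\<Sum>e\<in>J. P ^ e p * y e * a e) = a ?q * x p ^ d" by simp
      then have "- (\<Sum>e\<in>J. P ^ e p * y e * a e) div x p ^ d = a ?q" using p(2) by simp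
      moreover have "a e = 0" if "e \<notin> J" "e \<noteq> ?q" using a that by (auto simp: coeff_lattice_def coeff_vec_def J_def)
      ultimately show "?ext (restrict a J) e = a e" by simp
    qed
    show "\<forall>a\<in>?R. restrict (?ext a) J = a"
    proof (intro ballI ext)
      fix a e assume "a \<in> ?R"
      then have "a \<in> extensional J" by (simp add: PiE_def)
      then show "restrict (?ext a) J e = a e" by (simp add: restrict_def extensional_def)
    qed
    show "(\<lambda>a. restrict a J) ` ?S \<subseteq> ?R"
    proof (rule image_subsetI)
      fix a assume a: "a \<in> ?S"
      then have z: "a ?q * x p ^ d + (\<Sum>e\<in>J. P ^ e p * y e * a e) = 0"
        using ev[of a] by (simp add: coeff_lattice_def)
      then have "(\<Sum>e\<in>J. P ^ e p * y e * a e) = x p ^ d * (- a ?q)" by (simp add: algebra_simps)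
      then have "x p ^ d dvd (\<Sum>e\<in>J. P ^ e p * y e * a e)" by (metis dvd_triv_left)
      then show "restrict a J \<in> ?R" using a box by (simp add: Pd)
    qed
    show "?ext ` ?R \<subseteq> ?S"
    proof (rule image_subsetI)
      fix a assume a: "a \<in> ?R"
      have q0: "?q \<notin> J" by (simp add: J_def)
      have "x p ^ d dvd (\<Sum>e\<in>J. P ^ e p * y e * a e)" using a by (simp add: Pd)
      then have "(- (\<Sum>e\<in>J. P ^ e p * y e * a e) div x p ^ d) * x p ^ d = - (\<Sum>e\<in>J. P ^ e p * y e * a e)"
        by (intro dvd_div_mult_self) simp
      then have "form_eval d n (?ext a) x = 0" unfolding ev using q0 by simp
      moreover have "coeff_vec d n (?ext a)" using q by (auto simp: coeff_vec_def J_def)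
      ultimately show "?ext a \<in> ?S" using a box by (auto simp: coeff_lattice_def)
    qed
  qed
  have "finite (PiE J ?B)" using J by (intro finite_PiE) auto
  then have "finite ?R" by simp
  then show "finite ?S" using bij by (simp add: bij_betw_finite)
  have "int (card ?S) * P ^ d = int (card ?R) * P ^ d" using bij by (simp add: bij_betw_same_card)
  also have "\<dots> = P ^ card J"
  proof (rule card_box_weighted_congruence[OF J P])
    fix e assume e: "e \<in> J"
    then have "e p \<noteq> d" using mons_eq_pure_mon[of e d n p] p by (auto simp: J_def)
    then show "e p < d" using mons_le[of e d n p] e by (auto simp: J_def)
  next
    fix v g assume v: "v < d" and g: "g dvd P" and gy: "\<And>e. e \<in> J \<Longrightarrow> e p = v \<Longrightarrow> g dvd y e"
    show "is_unit g"
    proof (rule ccontr)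
      assume nu: "\<not> is_unit g"
      have "g \<noteq> 0" using g P by auto
      then obtain r where r: "prime r" "r dvd g" using nu prime_divisor_exists by blast
      have rp: "r dvd x p" using r g by (metis P_def dvd_abs_iff dvd_trans)
      have "r dvd x i" if i: "i \<le> n" for i
      proof (cases "i = p")
        case False
        \<comment> \<open>The monomial \<open>x p ^ v * x i ^ (d - v)\<close> has weight
          \<open>v\<close>, and its cofactor is, up to sign, a positive power of \<open>x i\<close>.
          So a prime that divides \<open>P\<close> and all cofactors of weight \<open>v\<close>
          divides every coordinate.\<close>
        define e where "e = (\<lambda>k. if k = p then v else if k = i then d - v else 0)"
        have "(\<Sum>k\<le>n. e k) = (\<Sum>k\<le>n. (if k = p then v else 0) + (if k = i then d - v else 0))"
          using False by (intro sum.cong) (auto simp: e_def)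
        also have "\<dots> = v + (d - v)" using p i by (simp add: sum.distrib)
        finally have "e \<in> mons d n" using p i v by (auto simp: mons_def e_def)
        moreover have "e p = v" by (simp add: e_def)
        moreover from this have "e \<noteq> ?q" using v by (auto simp: pure_mon_def)
        ultimately have "g dvd y e" by (intro gy) (auto simp: J_def)
        then have "r dvd y e" using r by (meson dvd_trans)
        moreover have "(\<Prod>k\<in>{..n}-{p}. x k ^ e k) = (\<Prod>k\<in>{..n}-{p}. if k = i then x i ^ (d - v) else 1)"
          by (intro prod.cong) (auto simp: e_def)
        moreover have "\<dots> = x i ^ (d - v)" using False i by simp
        ultimately have "r dvd sgn (x p) ^ v * x i ^ (d - v)" by (simp add: y_def \<open>e p = v\<close>)
        moreover have "is_unit (sgn (x p) ^ v)" using p(2) by (intro is_unit_power_iff[THEN iffD2]) (simp add: sgn_if)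
        ultimately have "r dvd x i ^ (d - v)" by (metis dvd_mult_unit_iff' mult.commute dvd_mult_unit_iff)
        then show ?thesis by (rule prime_dvd_power[OF r(1)])
      qed (use rp in simp)
      then have "r dvd Gcd (x ` {..n})" by (intro Gcd_greatest) auto
      then show False using x r(1) by (simp add: prim_vec_def not_prime_unit)
    qed
  qed
  finally show "int (card ?S) * P ^ d = P ^ card J" .
qed

text \<open>\<open>M = N - 1\<close> then satisfies \<open>d + 2 <= M\<close>, the inequality that
  absorbs short vectors on a line into the error term. Since \<open>n >= 2\<close>, it suffices to
  bound the binomial coefficient \<open>d + 2\<close> over \<open>2\<close>.\<close>

lemma Ndn_ge: "2 \<le> d \<Longrightarrow> d \<le> n \<Longrightarrow> d + 3 \<le> Ndn d n"
proof -
  assume d: "2 \<le> d" "d \<le> n"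
  have "2 * (d + 3) \<le> (d + 2) * (d + 1)"
  proof -
    have "2 * 2 \<le> d * d" using d by (intro mult_mono) auto
    then show ?thesis using d by simp
  qed
  then have "d + 3 \<le> (2 + d) choose 2" by (simp add: choose_two)
  also have "\<dots> = (2 + d) choose d" by (subst binomial_symmetric) auto
  also have "\<dots> \<le> (n + d) choose d" using d by (intro binomial_right_mono) auto
  finally show ?thesis by (simp add: Ndn_def)
qed

lemma cnorm_eq_L2_set: "cnorm d n a = L2_set (\<lambda>e. real_of_int (a e)) (mons d n)"
  by (simp add: cnorm_def L2_set_def)

lemma vnorm_eq_L2_set: "vnorm n x = L2_set (\<lambda>i. real_of_int (x i)) {..n}"
  by (simp add: vnorm_def L2_set_def)

lemma veronese_norm_eq: "veronese_norm d n t = sqrt (\<Sum>e\<in>mons d n. (\<Prod>i\<le>n. t i ^ e i)\<^sup>2)"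
  by (simp add: veronese_norm_def veronese_def)

lemma veronese_norm_ge:
  assumes "p \<le> n" shows "\<bar>t p\<bar> ^ d \<le> veronese_norm d n t"
proof -
  have "\<bar>t p\<bar> ^ d = sqrt ((\<Prod>i\<le>n. t i ^ pure_mon d p i)\<^sup>2)" using assms by (simp add: prod_pure_mon power_abs)
  also have "\<dots> \<le> veronese_norm d n t" unfolding veronese_norm_eq
    using assms finite_mons by (intro real_sqrt_le_mono member_le_sum) (auto simp: pure_mon_in_mons)
  finally show ?thesis .
qed

text \<open>The index \<open>p\<close> of a largest coordinate is taken so that the ratios
  \<open>c e\<close> of the monomials to \<open>x p ^ d\<close> are at most 1 in absolute value. On
  the lattice the eliminated coefficient is minus the linear form with coefficients
  \<open>c e\<close>, so \<open>cnorm\<close> is the ellipsoid norm. The boxes give the density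
  \<open>P ^ (M - d) / P ^ M = 1 / P ^ d\<close>, and \<open>P ^ d\<close> times the square root
  from the ellipsoid volume is the Veronese norm.\<close>

lemma coeff_lattice_count:
  fixes x :: "nat \<Rightarrow> int" and T :: real and d n p :: nat
  defines "M \<equiv> Ndn d n - 1" and "P \<equiv> \<bar>real_of_int (x p)\<bar>"
  assumes d: "2 \<le> d" "d \<le> n" and x: "prim_vec n x" and p: "p \<le> n" "x p \<noteq> 0"
    and max: "\<And>i. i \<le> n \<Longrightarrow> \<bar>x i\<bar> \<le> \<bar>x p\<bar>" and T: "P \<le> T"
  shows "\<bar>real (card {a \<in> coeff_lattice d n x. cnorm d n a \<le> T})
      - unit_ball_vol (real M) * T ^ M / veronese_norm d n (\<lambda>i. real_of_int (x i))\<bar>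
    \<le> lattice_const M * (P / P ^ d) * T ^ (M - 1)"
proof -
  let ?q = "pure_mon d p"
  define J where "J = mons d n - {?q}"
  let ?m = "\<lambda>e. \<Prod>i\<le>n. real_of_int (x i) ^ e i"
  define c where "c e = ?m e / real_of_int (x p) ^ d" for e
  have q: "?q \<in> mons d n" using p by (intro pure_mon_in_mons)
  have cardJ: "card J = M" using q finite_mons by (simp add: J_def M_def card_mons)
  have Md: "d + 2 \<le> M" using Ndn_ge[OF d] by (simp add: M_def)
  have "card J \<noteq> 0" using cardJ Md by simp
  then have J: "finite J" "J \<noteq> {}" by (auto simp: card_eq_0_iff)
  have P: "0 < P" using p by (simp add: P_def)
  have Pi: "real_of_int \<bar>x p\<bar> = P" by (simp add: P_def)
  have xd: "real_of_int (x p) ^ d \<noteq> 0" using p by simp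
  have xP: "(real_of_int (x p) ^ d)\<^sup>2 = (P ^ d)\<^sup>2" unfolding P_def by (metis power2_abs power_abs)
  have c1: "\<bar>c e\<bar> \<le> 1" if "e \<in> J" for e
  proof -
    have "\<bar>real_of_int (x i)\<bar> \<le> P" if "i \<le> n" for i using max[OF that] unfolding P_def by linarith
    then have "\<bar>?m e\<bar> \<le> P ^ d" using that by (intro prod_powers_le) (auto simp: J_def)
    then show ?thesis using P by (simp add: c_def abs_divide P_def power_abs)
  qed
  define k where "k = nat \<bar>x p\<bar> ^ (M - d)"
  have k: "card {a \<in> coeff_lattice d n x. \<forall>i\<in>J. real_of_int (a i) \<in> {u i..<u i + P}} = k" for u
  proof -
    have "int (card {a \<in> coeff_lattice d n x. \<forall>i\<in>J. real_of_int (a i) \<in> {u i..<u i + P}}) * \<bar>x p\<bar> ^ d = \<bar>x p\<bar> ^ (M - d + d)"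
      using card_coeff_lattice_box(1)[OF x p, of d u] cardJ Md unfolding J_def Pi by simp
    then have "int (card {a \<in> coeff_lattice d n x. \<forall>i\<in>J. real_of_int (a i) \<in> {u i..<u i + P}}) * \<bar>x p\<bar> ^ d = int k * \<bar>x p\<bar> ^ d"
      unfolding power_add by (simp add: k_def)
    then show ?thesis using p by (simp del: abs_of_nonneg)
  qed
  have kfin: "finite {a \<in> coeff_lattice d n x. \<forall>i\<in>J. real_of_int (a i) \<in> {u i..<u i + P}}" for u
    using card_coeff_lattice_box(2)[OF x p, of d u] unfolding J_def Pi .
  have nrm: "sqrt ((\<Sum>i\<in>J. (real_of_int (a i))\<^sup>2) + (\<Sum>i\<in>J. c i * real_of_int (a i))\<^sup>2) = cnorm d n a"
    if a: "a \<in> coeff_lattice d n x" for a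
  proof -
    have "real_of_int (form_eval d n a x) = real_of_int (a ?q) * ?m ?q + (\<Sum>e\<in>J. real_of_int (a e) * ?m e)"
      unfolding form_eval_def J_def of_int_sum of_int_mult of_int_prod of_int_power
      using q finite_mons by (intro sum.remove) auto
    then have "real_of_int (a ?q) * real_of_int (x p) ^ d + (\<Sum>e\<in>J. real_of_int (a e) * ?m e) = 0"
      using a p by (simp add: coeff_lattice_def prod_pure_mon)
    moreover have "(\<Sum>e\<in>J. real_of_int (a e) * ?m e) = (\<Sum>i\<in>J. c i * real_of_int (a i)) * real_of_int (x p) ^ d"
      unfolding sum_distrib_right using xd by (intro sum.cong refl) (simp add: c_def)
    ultimately have "(real_of_int (a ?q) + (\<Sum>i\<in>J. c i * real_of_int (a i))) * real_of_int (x p) ^ d = 0"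
      by (simp add: distrib_right)
    then have "(\<Sum>i\<in>J. c i * real_of_int (a i)) = - real_of_int (a ?q)" using xd p by (auto simp: eq_neg_iff_add_eq_0 add.commute)
    moreover have "(\<Sum>e\<in>mons d n. (real_of_int (a e))\<^sup>2) = (real_of_int (a ?q))\<^sup>2 + (\<Sum>e\<in>J. (real_of_int (a e))\<^sup>2)"
      unfolding J_def using q finite_mons by (intro sum.remove) auto
    ultimately show ?thesis by (simp add: cnorm_def add.commute)
  qed
  have "finite {a. (\<forall>i. i \<notin> mons d n \<longrightarrow> a i = 0) \<and> L2_set (\<lambda>i. real_of_int (a i)) (mons d n) \<le> T}"
    by (rule finite_bounded_int_vectors[OF finite_mons])
  then have fin: "finite {a \<in> coeff_lattice d n x. cnorm d n a \<le> T}"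
    by (rule finite_subset[rotated]) (auto simp: coeff_lattice_def coeff_vec_def cnorm_eq_L2_set)
  have vn: "veronese_norm d n (\<lambda>i. real_of_int (x i)) = P ^ d * sqrt (1 + (\<Sum>i\<in>J. (c i)\<^sup>2))"
  proof -
    have "(\<Sum>e\<in>mons d n. (?m e)\<^sup>2) = (?m ?q)\<^sup>2 + (\<Sum>e\<in>J. (?m e)\<^sup>2)"
      unfolding J_def using q finite_mons by (intro sum.remove) auto
    also have "(?m ?q)\<^sup>2 = (P ^ d)\<^sup>2" using p xP by (simp add: prod_pure_mon)
    also have "(\<Sum>e\<in>J. (?m e)\<^sup>2) = (P ^ d)\<^sup>2 * (\<Sum>e\<in>J. (c e)\<^sup>2)"
      unfolding sum_distrib_left c_def power_divide xP[symmetric] using xd by (intro sum.cong refl) simp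
    finally have "(\<Sum>e\<in>mons d n. (?m e)\<^sup>2) = (P ^ d)\<^sup>2 * (1 + (\<Sum>i\<in>J. (c i)\<^sup>2))" by (simp add: distrib_left)
    then show ?thesis unfolding veronese_norm_eq using P by (simp add: real_sqrt_mult)
  qed
  have \<kappa>: "real k / P ^ M = 1 / P ^ d"
  proof -
    have "real k = P ^ (M - d)" using Pi by (simp add: k_def)
    moreover have "P ^ M = P ^ (M - d) * P ^ d" using Md by (simp flip: power_add)
    ultimately show ?thesis using P cardJ by simp
  qed
  have set: "{a \<in> coeff_lattice d n x. sqrt ((\<Sum>i\<in>J. (real_of_int (a i))\<^sup>2) + (\<Sum>i\<in>J. c i * real_of_int (a i))\<^sup>2) \<le> T}
      = {a \<in> coeff_lattice d n x. cnorm d n a \<le> T}"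
    using nrm by auto
  have "\<bar>real (card {a \<in> coeff_lattice d n x. cnorm d n a \<le> T})
     - 1 / P ^ d * (unit_ball_vol (real M) * T ^ M / sqrt (1 + (\<Sum>i\<in>J. (c i)\<^sup>2)))\<bar>
     \<le> 1 / P ^ d * (unit_ball_vol (real M) * (2 * real M ^ 2 * (1 + 2 * real M) ^ (M - 1))) * P * T ^ (M - 1)"
    by (rule lattice_count_ellipsoid[where c = c and L = "coeff_lattice d n x" and T = T, OF J c1 P T k kfin,
          unfolded set cardJ, OF _ fin, unfolded \<kappa>])
  also have "\<dots> = lattice_const M * (P / P ^ d) * T ^ (M - 1)" by (simp add: lattice_const_def)
  finally show ?thesis unfolding vn by simp
qed

lemma power_exchange_le:
  fixes P A :: real
  assumes "0 \<le> P" "P \<le> A" "j \<le> i"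
  shows "A ^ j * P ^ i \<le> A ^ i * P ^ j"
proof -
  have "A ^ j * P ^ i = (A ^ j * P ^ j) * P ^ (i - j)" using assms by (simp flip: power_add)
  also have "\<dots> \<le> (A ^ j * P ^ j) * A ^ (i - j)" using assms by (intro mult_left_mono power_mono) auto
  also have "\<dots> = A ^ i * P ^ j" using assms(3) by (simp add: mult_ac flip: power_add)
  finally show ?thesis .
qed

text \<open>The Moebius sum over \<open>k <= A\<close> is cut at \<open>k = A / P\<close>. Up to
  there the radius \<open>A / k\<close> is at least \<open>P\<close> and the volume asymptotics
  applies; beyond, the counts are only bounded from above. In \<open>K\<close>, the terms
  \<open>2 * (lc + 1) + 8 * V\<close> come from the first part and \<open>2 + 98 * C1\<close> from
  the second.\<close>

lemma primitive_coeff_lattice_count: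
  fixes d n :: nat
  defines "M \<equiv> Ndn d n - 1"
  assumes d: "2 \<le> d" "d \<le> n"
  obtains K where "0 \<le> K"
    "\<And>x p A. prim_vec n x \<Longrightarrow> p \<le> n \<Longrightarrow> x p \<noteq> 0 \<Longrightarrow> (\<And>i. i \<le> n \<Longrightarrow> \<bar>x i\<bar> \<le> \<bar>x p\<bar>) \<Longrightarrow>
      \<bar>real_of_int (x p)\<bar> \<le> A \<Longrightarrow>
      \<bar>real (card {a. prim_coeff d n a \<and> form_eval d n a x = 0 \<and> cnorm d n a \<le> A})
        - unit_ball_vol (real M) / veronese_norm d n (\<lambda>i. real_of_int (x i)) * A ^ M / zeta_nat M\<bar>
      \<le> K * A ^ (M - 1) * (\<bar>real_of_int (x p)\<bar> / \<bar>real_of_int (x p)\<bar> ^ d)"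
proof
  define lc where "lc = lattice_const M"
  define V where "V = unit_ball_vol (real M)"
  define C1 where "C1 = 2 ^ M * (V + lc)"
  define K where "K = 2 * (lc + 1) + 8 * V + (2 + 98 * C1)"
  have lc: "0 \<le> lc" by (simp add: lc_def lattice_const_nonneg)
  have V: "0 \<le> V" by (simp add: V_def)
  have C1: "0 \<le> C1" using lc V by (simp add: C1_def)
  show "0 \<le> K" using lc V C1 by (simp add: K_def)
  have Md: "d + 2 \<le> M" using Ndn_ge[OF d] by (simp add: M_def)
  fix x p A
  assume x: "prim_vec n x" and p: "p \<le> n" "x p \<noteq> 0" and max: "\<And>i. i \<le> n \<Longrightarrow> \<bar>x i\<bar> \<le> \<bar>x p\<bar>"
    and A: "\<bar>real_of_int (x p)\<bar> \<le> A"
  define P where "P = \<bar>real_of_int (x p)\<bar>"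
  define Q where "Q = P / P ^ d"
  define G where "G = coeff_lattice d n x"
  define \<nu> where "\<nu> = veronese_norm d n (\<lambda>i. real_of_int (x i))"
  define a where "a = V / \<nu>"
  have P1: "1 \<le> P" using p(2) unfolding P_def by linarith
  have PA: "P \<le> A" using A by (simp add: P_def)
  have A1: "1 \<le> A" using P1 PA by linarith
  have Q: "0 < Q" using P1 by (simp add: Q_def)
  have \<nu>: "P ^ d \<le> \<nu>" unfolding \<nu>_def P_def by (rule veronese_norm_ge[OF p(1)])
  have \<nu>0: "0 < \<nu>" using \<nu> P1 by (meson less_le_trans zero_less_power zero_less_one)
  have a0: "0 \<le> a" using V \<nu>0 by (simp add: a_def)
  have aP: "a \<le> V / P ^ d" unfolding a_def using \<nu> V P1 \<nu>0 by (intro divide_left_mono) auto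
  have cnt: "\<bar>real (card {b \<in> G. cnorm d n b \<le> T}) - a * T ^ M\<bar> \<le> lc * Q * T ^ (M - 1)" if "P \<le> T" for T
    using coeff_lattice_count[OF d x p max, of T] that
    unfolding G_def P_def Q_def a_def V_def lc_def \<nu>_def M_def by simp
  have comb: "(\<lambda>i. k * b i + l * b' i) \<in> G" if "b \<in> G" "b' \<in> G" for b b' k l
  proof -
    have "form_eval d n (\<lambda>i. k * b i + l * b' i) x = k * form_eval d n b x + l * form_eval d n b' x"
      by (simp add: form_eval_def sum_distrib_left sum.distrib algebra_simps)
    then show ?thesis using that by (simp add: G_def coeff_lattice_def coeff_vec_def)
  qed
  have scale: "(\<lambda>i. k * b i) \<in> G \<longleftrightarrow> b \<in> G" if "0 < k" for b and k :: int
  proof -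
    have "form_eval d n (\<lambda>i. k * b i) x = k * form_eval d n b x"
      by (simp add: form_eval_def sum_distrib_left mult.assoc)
    then show ?thesis using that by (auto simp: G_def coeff_lattice_def coeff_vec_def)
  qed
  have supp: "b i = 0" if "b \<in> G" "i \<notin> mons d n" for b i
    using that by (simp add: G_def coeff_lattice_def coeff_vec_def)
  have fin: "finite {b \<in> G. cnorm d n b \<le> T}" for T
    by (rule finite_subset[OF _ finite_bounded_int_vectors[OF finite_mons[of d n], of T]])
      (auto simp: cnorm_eq_L2_set supp)
  have G0: "(\<lambda>_. 0) \<in> G" by (simp add: G_def coeff_lattice_def coeff_vec_def form_eval_def)
  define R where "R T = real (card {b \<in> G. b \<noteq> (\<lambda>_. 0) \<and> cnorm d n b \<le> T})" for T
  have R_eq: "R T = real (card {b \<in> G. cnorm d n b \<le> T}) - 1" if "0 \<le> T" for T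
  proof -
    have z: "(\<lambda>_. 0) \<in> {b \<in> G. cnorm d n b \<le> T}" using G0 that by (simp add: cnorm_def)
    have "{b \<in> G. b \<noteq> (\<lambda>_. 0) \<and> cnorm d n b \<le> T} = {b \<in> G. cnorm d n b \<le> T} - {\<lambda>_. 0}" by auto
    then have "card {b \<in> G. b \<noteq> (\<lambda>_. 0) \<and> cnorm d n b \<le> T} = card {b \<in> G. cnorm d n b \<le> T} - 1"
      using z by (simp add: card_Diff_singleton)
    moreover have "1 \<le> card {b \<in> G. cnorm d n b \<le> T}" using z fin by (auto simp: Suc_le_eq card_gt_0_iff)
    ultimately show ?thesis by (simp add: R_def of_nat_diff)
  qed
  have R_long: "\<bar>R T - a * T ^ M\<bar> \<le> (lc + 1) * Q * T ^ (M - 1)" if T: "P \<le> T" for T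
  proof -
    \<comment> \<open>The zero vector, which \<open>R\<close> omits, costs 1; this is absorbed
      because \<open>Q * T ^ (M - 1)\<close> is at least 1.\<close>
    have "P ^ d \<le> P ^ M" using P1 Md by (intro power_increasing) auto
    also have "\<dots> = P * P ^ (M - 1)" using Md by (cases M) auto
    also have "\<dots> \<le> P * T ^ (M - 1)" using P1 T by (intro mult_left_mono power_mono) auto
    finally have "1 \<le> Q * T ^ (M - 1)" using P1 by (simp add: Q_def field_simps)
    then show ?thesis using cnt[OF T] R_eq[of T] P1 T by (simp add: algebra_simps)
  qed
  define y where "y = A / P"
  have y: "1 \<le> y" using P1 PA by (simp add: y_def)
  have yA: "y \<le> A" using P1 A1 unfolding y_def by (simp add: divide_le_eq)
  let ?m = "nat \<lfloor>y\<rfloor>" and ?A = "nat \<lfloor>A\<rfloor>"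
  have "1 \<le> \<lfloor>y\<rfloor>" using y by simp
  moreover have "y < of_int \<lfloor>y\<rfloor> + 1" by linarith
  ultimately have "y \<le> 2 * real ?m" by linarith
  moreover have "?m \<le> ?A" using floor_mono[OF yA] by (rule nat_mono)
  moreover have "1 \<le> ?m" using \<open>1 \<le> \<lfloor>y\<rfloor>\<close> by linarith
  ultimately have m: "1 \<le> ?m" "?m \<le> ?A" "y \<le> 2 * real ?m" by auto
  have "{b. prim_coeff d n b \<and> form_eval d n b x = 0 \<and> cnorm d n b \<le> A} = {b. b \<in> G \<and> Gcd (b ` mons d n) = 1 \<and> cnorm d n b \<le> A}"
    by (auto simp: prim_coeff_def G_def coeff_lattice_def)
  then have "real (card {b. prim_coeff d n b \<and> form_eval d n b x = 0 \<and> cnorm d n b \<le> A})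
     = (\<Sum>b | b \<in> G \<and> Gcd (b ` mons d n) = 1 \<and> cnorm d n b \<le> A. 1)" by simp
  also have "\<dots> = (\<Sum>k\<in>{1..?A}. moebius_mu k * (\<Sum>b | b \<in> G \<and> b \<noteq> (\<lambda>_. 0) \<and> cnorm d n b \<le> A / real k. 1))"
    unfolding cnorm_eq_L2_set using A1 supp scale finite_mons by (intro sum_primitive_eq_moebius_sum) auto
  also have "\<dots> = (\<Sum>k\<in>{1..?A}. moebius_mu k * R (A / real k))" by (simp add: R_def)
  also have "\<dots> = (\<Sum>k\<in>{1..?m} \<union> {?m<..?A}. moebius_mu k * R (A / real k))"
    using m by (intro sum.cong) auto
  also have "\<dots> = (\<Sum>k\<in>{1..?m}. moebius_mu k * R (A / real k)) + (\<Sum>k\<in>{?m<..?A}. moebius_mu k * R (A / real k))"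
    by (intro sum.union_disjoint) auto
  finally have split: "real (card {b. prim_coeff d n b \<and> form_eval d n b x = 0 \<and> cnorm d n b \<le> A})
     = (\<Sum>k\<in>{1..?m}. moebius_mu k * R (A / real k)) + (\<Sum>k\<in>{?m<..?A}. moebius_mu k * R (A / real k))" .
  have "\<bar>(\<Sum>k\<in>{1..?m}. moebius_mu k * R (A / real k)) - a * A ^ M / zeta_nat M\<bar>
      \<le> 2 * ((lc + 1) * Q) * A ^ (M - 1) + 8 * a * A ^ M / y"
  proof (rule moebius_transform_asymptotic)
    fix k assume k: "1 \<le> k" "real k \<le> y"
    then have "P \<le> A / real k" using P1 by (simp add: y_def field_simps)
    then show "\<bar>R (A / real k) - a * (A / real k) ^ M\<bar> \<le> (lc + 1) * Q * (A / real k) ^ (M - 1)" by (rule R_long)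
  qed (use Md d y A1 a0 lc Q in auto)
  also have "8 * a * A ^ M / y \<le> 8 * V * Q * A ^ (M - 1)"
  proof -
    have "A ^ M = A * A ^ (M - 1)" using Md by (cases M) auto
    then have "8 * a * A ^ M / y = 8 * P * A ^ (M - 1) * a" using A1 P1 by (simp add: y_def)
    also have "\<dots> \<le> 8 * P * A ^ (M - 1) * (V / P ^ d)" using aP P1 A1 by (intro mult_left_mono) auto
    finally show ?thesis by (simp add: Q_def mult_ac)
  qed
  finally have main: "\<bar>(\<Sum>k\<in>{1..?m}. moebius_mu k * R (A / real k)) - a * A ^ M / zeta_nat M\<bar>
      \<le> (2 * (lc + 1) + 8 * V) * A ^ (M - 1) * Q" by (simp add: algebra_simps)
  have R0: "0 \<le> R T" for T by (simp add: R_def)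
  \<comment> \<open>The asymptotics already holds at radius \<open>2 * P\<close>, where it gives
    \<open>O(P ^ (M - d))\<close> points.\<close>
  have c2P: "real (card {b \<in> G. cnorm d n b \<le> 2 * P}) \<le> C1 * P ^ M / P ^ d"
  proof -
    have "real (card {b \<in> G. cnorm d n b \<le> 2 * P}) \<le> a * (2 * P) ^ M + lc * Q * (2 * P) ^ (M - 1)"
      using cnt[of "2 * P"] P1 by linarith
    also have "a * (2 * P) ^ M \<le> V / P ^ d * (2 * P) ^ M" using aP P1 by (intro mult_right_mono) auto
    also have "lc * Q * (2 * P) ^ (M - 1) \<le> lc * Q * (2 * (2 * P) ^ (M - 1))" using lc Q P1 by (intro mult_left_mono) auto
    also have "lc * Q * (2 * (2 * P) ^ (M - 1)) = lc / P ^ d * (2 * P) ^ M" using Md by (cases M) (auto simp: Q_def)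
    finally show ?thesis by (simp add: C1_def power_mult_distrib algebra_simps add_divide_distrib)
  qed
  have short: "R (A / real k) \<le> 2 * P + 49 * C1 * (P ^ (M - 2) / P ^ d) * A\<^sup>2 * (1 / real k ^ 2)" if k: "k \<in> {?m<..?A}" for k
  proof -
    have k0: "0 < k" using k by simp
    have "y < real k" using k y by (simp add: nat_less_iff floor_less_iff) 
    then have T: "0 < A / real k" "A / real k \<le> P" using P1 A1 k0 by (auto simp: y_def field_simps)
    have "R (A / real k) \<le> 2 * (A / real k) + 49 * (A / real k / P)\<^sup>2 * real (card {b \<in> G. cnorm d n b \<le> 2 * P})"
    proof -
      have "{b \<in> G. b \<noteq> (\<lambda>_. 0) \<and> cnorm d n b \<le> A / real k} = {b \<in> G. cnorm d n b \<le> A / real k \<and> b \<noteq> (\<lambda>_. 0)}" by auto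
      moreover have "real (card {b \<in> G. L2_set (\<lambda>i. real_of_int (b i)) (mons d n) \<le> A / real k \<and> b \<noteq> (\<lambda>_. 0)})
        \<le> 2 * (A / real k) + 49 * (A / real k / P)\<^sup>2
          * real (card {b \<in> G. L2_set (\<lambda>i. real_of_int (b i)) (mons d n) \<le> 2 * P})"
      proof (rule card_short_vectors)
        show "(\<lambda>i. k * b i + l * b' i) \<in> G" if "b \<in> G" "b' \<in> G" for b b' k l using that by (rule comb)
        show "b i = 0" if "b \<in> G" "i \<notin> mons d n" for b i using that by (rule supp)
        show "finite {b \<in> G. L2_set (\<lambda>i. real_of_int (b i)) (mons d n) \<le> t}" for t
          using fin[of t] unfolding cnorm_eq_L2_set .
      qed (use finite_mons T in auto)
      ultimately show ?thesis unfolding R_def cnorm_eq_L2_set by (simp only:)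
    qed
    also have "\<dots> \<le> 2 * P + 49 * (A / real k / P)\<^sup>2 * (C1 * P ^ M / P ^ d)"
      using T c2P by (intro add_mono mult_left_mono) auto
    also have "49 * (A / real k / P)\<^sup>2 * (C1 * P ^ M / P ^ d) = 49 * C1 * (P ^ (M - 2) / P ^ d) * A\<^sup>2 * (1 / real k ^ 2)"
    proof -
      have "M = 2 + (M - 2)" using Md by simp
      then have "P ^ M = P\<^sup>2 * P ^ (M - 2)" by (metis power_add)
      then show ?thesis using P1 by (simp add: power_divide power_mult_distrib mult_ac)
    qed
    finally show ?thesis .
  qed
  have "\<bar>\<Sum>k\<in>{?m<..?A}. moebius_mu k * R (A / real k)\<bar> \<le> (\<Sum>k\<in>{?m<..?A}. \<bar>moebius_mu k * R (A / real k)\<bar>)"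
    by (rule sum_abs)
  also have "\<dots> \<le> (\<Sum>k\<in>{?m<..?A}. 2 * P + 49 * C1 * (P ^ (M - 2) / P ^ d) * A\<^sup>2 * (1 / real k ^ 2))"
  proof (rule sum_mono)
    fix k assume k: "k \<in> {?m<..?A}"
    have "\<bar>moebius_mu k * R (A / real k)\<bar> \<le> 1 * R (A / real k)"
      unfolding abs_mult using abs_moebius_le_1 R0 by (intro mult_mono) auto
    then show "\<bar>moebius_mu k * R (A / real k)\<bar> \<le> 2 * P + 49 * C1 * (P ^ (M - 2) / P ^ d) * A\<^sup>2 * (1 / real k ^ 2)"
      using short[OF k] by linarith
  qed
  also have "\<dots> = real (?A - ?m) * (2 * P) + 49 * C1 * (P ^ (M - 2) / P ^ d) * A\<^sup>2 * (\<Sum>k\<in>{?m<..?A}. 1 / real k ^ 2)"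
    by (simp only: sum.distrib sum_distrib_left sum_constant card_greaterThanAtMost)
  \<comment> \<open>At most \<open>A\<close> values of \<open>k\<close> carry the term
    \<open>2 * P\<close>, and the tail of the sum of \<open>1 / k^2\<close> beyond
    \<open>y = A / P\<close> is at most \<open>2 / y\<close>.\<close>
  also have "\<dots> \<le> A * (2 * P) + 49 * C1 * (P ^ (M - 2) / P ^ d) * A\<^sup>2 * (2 / y)"
  proof (intro add_mono mult_mono mult_left_mono)
    have "real (?A - ?m) \<le> real ?A" by simp
    also have "\<dots> \<le> A" using A1 by linarith
    finally show "real (?A - ?m) \<le> A" .
    have "(\<Sum>k\<in>{?m<..?A}. 1 / real k ^ 2) \<le> 1 / real ?m" using m y by (intro sum_inverse_powers_tail_le) auto
    also have "\<dots> = 2 / (2 * real ?m)" by simp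
    also have "\<dots> \<le> 2 / y" using m y by (intro divide_left_mono) auto
    finally show "(\<Sum>k\<in>{?m<..?A}. 1 / real k ^ 2) \<le> 2 / y" .
  qed (use P1 A1 C1 in \<open>auto intro!: sum_nonneg\<close>)
  \<comment> \<open>Rests on \<open>P ^ d <= A ^ (M - 2)\<close>, which follows from
    \<open>d <= M - 2\<close> and \<open>1 <= P <= A\<close>.\<close>
  also have "A * (2 * P) \<le> 2 * A ^ (M - 1) * Q"
  proof -
    have "A * P ^ d \<le> A * A ^ (M - 2)"
      using PA P1 A1 Md by (intro mult_left_mono order_trans[OF power_mono[OF PA] power_increasing]) auto
    also have "A * A ^ (M - 2) = A ^ (M - 1)"
      using Md by (simp add: numeral_2_eq_2 Suc_diff_Suc flip: power_Suc)
    finally have "A * P ^ d * P \<le> A ^ (M - 1) * P" using P1 by (intro mult_right_mono) auto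
    then show ?thesis using P1 by (simp add: Q_def field_simps)
  qed
  \<comment> \<open>\<open>2 / y = 2 * P / A\<close> removes one factor \<open>A\<close>, and the
    remaining \<open>A * P ^ (M - 1)\<close> is at most \<open>A ^ (M - 1) * P\<close>.\<close>
  also have "49 * C1 * (P ^ (M - 2) / P ^ d) * A\<^sup>2 * (2 / y) \<le> 98 * C1 * A ^ (M - 1) * Q"
  proof -
    have "49 * C1 * (P ^ (M - 2) / P ^ d) * A\<^sup>2 * (2 / y) = 98 * C1 / P ^ d * (A * (P * P ^ (M - 2)))"
      using A1 P1 by (simp add: y_def power2_eq_square field_simps)
    also have "P * P ^ (M - 2) = P ^ (M - 1)"
      using Md by (simp add: numeral_2_eq_2 Suc_diff_Suc flip: power_Suc)
    also have "98 * C1 / P ^ d * (A * P ^ (M - 1)) \<le> 98 * C1 / P ^ d * (A ^ (M - 1) * P)"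
      using power_exchange_le[of P A 1 "M - 1"] PA P1 C1 Md by (intro mult_left_mono) auto
    finally show ?thesis by (simp add: Q_def mult_ac)
  qed
  finally have rest: "\<bar>\<Sum>k\<in>{?m<..?A}. moebius_mu k * R (A / real k)\<bar> \<le> (2 + 98 * C1) * A ^ (M - 1) * Q"
    by (simp add: algebra_simps)
  have "\<bar>real (card {b. prim_coeff d n b \<and> form_eval d n b x = 0 \<and> cnorm d n b \<le> A}) - a * A ^ M / zeta_nat M\<bar>
     \<le> K * A ^ (M - 1) * Q"
  proof -
    have "K * A ^ (M - 1) * Q = (2 * (lc + 1) + 8 * V) * A ^ (M - 1) * Q + (2 + 98 * C1) * A ^ (M - 1) * Q"
      unfolding K_def by (simp only: distrib_right)
    then show ?thesis using main rest unfolding split by linarith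
  qed
  then show "\<bar>real (card {a. prim_coeff d n a \<and> form_eval d n a x = 0 \<and> cnorm d n a \<le> A})
        - unit_ball_vol (real M) / veronese_norm d n (\<lambda>i. real_of_int (x i)) * A ^ M / zeta_nat M\<bar>
      \<le> K * A ^ (M - 1) * (\<bar>real_of_int (x p)\<bar> / \<bar>real_of_int (x p)\<bar> ^ d)"
    by (simp add: a_def V_def \<nu>_def Q_def P_def)
qed

section \<open>Sums and integrals of the inverse Veronese norm\<close>

text \<open>A natural number, so that it can index shells; it agrees with \<open>vnorm\<close> up to
  the factor \<open>n + 1\<close>.\<close>

definition sup_abs :: "nat \<Rightarrow> (nat \<Rightarrow> int) \<Rightarrow> nat" where
  "sup_abs n x = Max ((\<lambda>i. nat \<bar>x i\<bar>) ` {..n})"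

lemma abs_le_sup_abs: "i \<le> n \<Longrightarrow> nat \<bar>x i\<bar> \<le> sup_abs n x"
  by (simp add: sup_abs_def)

lemma sup_abs_attained:
  obtains p where "p \<le> n" "nat \<bar>x p\<bar> = sup_abs n x"
proof -
  have "sup_abs n x \<in> (\<lambda>i. nat \<bar>x i\<bar>) ` {..n}" unfolding sup_abs_def by (intro Max_in) auto
  then show ?thesis using that by auto
qed

text \<open>Some coordinate is plus or minus \<open>k\<close>: there are \<open>n + 1\<close>
  positions, two signs, and at most \<open>2 * k + 1 <= 3 * k\<close> values for each of the other
  \<open>n\<close> coordinates.\<close>

lemma card_sup_abs_shell:
  assumes "1 \<le> k"
  shows "finite {x. int_vec n x \<and> sup_abs n x = k}"
    and "card {x. int_vec n x \<and> sup_abs n x = k} \<le> (2 * (n + 1) * 3 ^ n) * k ^ n"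
proof -
  define B where "B p i = (if i = p then {int k, - int k} else {- int k..int k})" for p i :: nat
  define U where "U p = {x. int_vec n x \<and> (\<forall>i\<le>n. x i \<in> B p i)}" for p
  have sub: "{x. int_vec n x \<and> sup_abs n x = k} \<subseteq> (\<Union>p\<le>n. U p)"
  proof safe
    fix x assume x: "int_vec n x" "k = sup_abs n x"
    obtain p where p: "p \<le> n" "nat \<bar>x p\<bar> = sup_abs n x" by (rule sup_abs_attained)
    have "x i \<in> B p i" if "i \<le> n" for i
      using abs_le_sup_abs[OF that, of x] p x by (auto simp: B_def)
    then show "x \<in> (\<Union>p\<le>n. U p)" using p x by (auto simp: U_def)
  qed
  have U: "finite (U p) \<and> card (U p) \<le> 2 * 3 ^ n * k ^ n" if p: "p \<le> n" for p
  proof -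
    have fin: "finite (PiE {..n} (B p))" by (intro finite_PiE) (auto simp: B_def)
    have inj: "inj_on (\<lambda>x. restrict x {..n}) (U p)"
    proof (rule inj_onI)
      fix x y assume xy: "x \<in> U p" "y \<in> U p" and e: "restrict x {..n} = restrict y {..n}"
      show "x = y"
      proof
        fix i show "x i = y i"
          using xy fun_cong[OF e, of i] by (cases "i \<le> n") (auto simp: U_def int_vec_def)
      qed
    qed
    have im: "(\<lambda>x. restrict x {..n}) ` U p \<subseteq> PiE {..n} (B p)"
    proof (rule image_subsetI)
      fix x assume "x \<in> U p"
      then show "restrict x {..n} \<in> PiE {..n} (B p)" by (intro restrict_PiE_iff[THEN iffD2]) (auto simp: U_def)
    qed
    have "card (U p) \<le> card (PiE {..n} (B p))" by (rule card_inj_on_le[OF inj im fin])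
    also have "\<dots> = (\<Prod>i\<le>n. card (B p i))" by (simp add: card_PiE)
    also have "\<dots> = card (B p p) * (\<Prod>i\<in>{..n}-{p}. card (B p i))" using p by (intro prod.remove) auto
    also have "card (B p p) \<le> 2" by (simp add: B_def card_insert_if)
    also have "(\<Prod>i\<in>{..n}-{p}. card (B p i)) = (2 * k + 1) ^ n"
    proof -
      have "(\<Prod>i\<in>{..n}-{p}. card (B p i)) = (\<Prod>i\<in>{..n}-{p}. 2 * k + 1)"
        by (intro prod.cong) (auto simp: B_def)
      then show ?thesis using p by simp
    qed
    also have "(2 * k + 1) ^ n \<le> (3 * k) ^ n" using assms by (intro power_mono) auto
    finally have "card (U p) \<le> 2 * 3 ^ n * k ^ n" by (simp add: power_mult_distrib mult.assoc)
    moreover have "finite (U p)" by (rule inj_on_finite[OF inj im fin])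
    ultimately show ?thesis by simp
  qed
  show "finite {x. int_vec n x \<and> sup_abs n x = k}" using U by (intro finite_subset[OF sub]) auto
  have "card {x. int_vec n x \<and> sup_abs n x = k} \<le> card (\<Union>p\<le>n. U p)" using U by (intro card_mono sub) auto
  also have "\<dots> \<le> (\<Sum>p\<le>n. card (U p))" by (rule card_UN_le) simp
  also have "\<dots> \<le> (\<Sum>p\<le>n. 2 * 3 ^ n * k ^ n)" using U by (intro sum_mono) auto
  finally show "card {x. int_vec n x \<and> sup_abs n x = k} \<le> (2 * (n + 1) * 3 ^ n) * k ^ n" by (simp add: algebra_simps)
qed

lemma sum_over_shells_le:
  fixes \<phi> :: "nat \<Rightarrow> real"
  assumes S: "finite S" "\<And>x. x \<in> S \<Longrightarrow> int_vec n x \<and> sup_abs n x \<in> {1..R}" and \<phi>: "\<And>k. 0 \<le> \<phi> k"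
  shows "(\<Sum>x\<in>S. \<phi> (sup_abs n x)) \<le> 2 * real (n + 1) * 3 ^ n * (\<Sum>k\<in>{1..R}. real k ^ n * \<phi> k)"
proof -
  have "(\<Sum>x\<in>S. \<phi> (sup_abs n x)) = (\<Sum>k\<in>{1..R}. \<Sum>x | x \<in> S \<and> sup_abs n x = k. \<phi> (sup_abs n x))"
    using S by (intro sum.group[symmetric]) auto
  also have "\<dots> \<le> (\<Sum>k\<in>{1..R}. 2 * real (n + 1) * 3 ^ n * (real k ^ n * \<phi> k))"
  proof (rule sum_mono)
    fix k assume k: "k \<in> {1..R}"
    have "card {x. x \<in> S \<and> sup_abs n x = k} \<le> card {x. int_vec n x \<and> sup_abs n x = k}"
      using S k card_sup_abs_shell(1) by (intro card_mono) auto
    also have "\<dots> \<le> (2 * (n + 1) * 3 ^ n) * k ^ n" using k by (intro card_sup_abs_shell) auto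
    finally have "real (card {x. x \<in> S \<and> sup_abs n x = k}) \<le> real ((2 * (n + 1) * 3 ^ n) * k ^ n)"
      by (simp only: of_nat_le_iff)
    then have "real (card {x. x \<in> S \<and> sup_abs n x = k}) * \<phi> k \<le> real ((2 * (n + 1) * 3 ^ n) * k ^ n) * \<phi> k"
      using \<phi> by (rule mult_right_mono)
    then show "(\<Sum>x | x \<in> S \<and> sup_abs n x = k. \<phi> (sup_abs n x)) \<le> 2 * real (n + 1) * 3 ^ n * (real k ^ n * \<phi> k)"
      by (simp add: algebra_simps)
  qed
  finally show ?thesis by (simp only: sum_distrib_left)
qed

lemma monomial_scale:
  assumes "e \<in> mons d n"
  shows "(\<Prod>i\<le>n. (c * t i) ^ e i) = (c :: real) ^ d * (\<Prod>i\<le>n. t i ^ e i)"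
proof -
  have "(\<Prod>i\<le>n. (c * t i) ^ e i) = (\<Prod>i\<le>n. c ^ e i) * (\<Prod>i\<le>n. t i ^ e i)"
    by (simp only: power_mult_distrib prod.distrib)
  also have "(\<Prod>i\<le>n. c ^ e i) = c ^ d" using assms by (simp only: mons_def mem_Collect_eq flip: power_sum)
  finally show ?thesis .
qed

lemma veronese_norm_scale: "0 \<le> c \<Longrightarrow> veronese_norm d n (\<lambda>i. c * t i) = c ^ d * veronese_norm d n t"
proof -
  assume c: "0 \<le> c"
  have "(\<Sum>e\<in>mons d n. (\<Prod>i\<le>n. (c * t i) ^ e i)\<^sup>2) = (\<Sum>e\<in>mons d n. (c ^ d)\<^sup>2 * (\<Prod>i\<le>n. t i ^ e i)\<^sup>2)"
    by (intro sum.cong refl) (subst monomial_scale, assumption, rule power_mult_distrib)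
  also have "\<dots> = (c ^ d)\<^sup>2 * (\<Sum>e\<in>mons d n. (\<Prod>i\<le>n. t i ^ e i)\<^sup>2)" by (simp only: sum_distrib_left)
  finally show ?thesis using c by (simp add: veronese_norm_eq real_sqrt_mult)
qed

text \<open>Division by \<open>R\<close> moves both points into the cube where all coordinates are
  at most 1 in absolute value. There the difference of two products is at most the sum of the
  differences of the factors, and the exponents add up to \<open>d\<close>.\<close>

lemma monomial_diff_le:
  fixes t x :: "nat \<Rightarrow> real"
  assumes e: "e \<in> mons d n" and R: "0 < R" and d: "0 < d"
    and t: "\<And>i. i \<le> n \<Longrightarrow> \<bar>t i\<bar> \<le> R" and x: "\<And>i. i \<le> n \<Longrightarrow> \<bar>x i\<bar> \<le> R" and tx: "\<And>i. i \<le> n \<Longrightarrow> \<bar>t i - x i\<bar> \<le> 1"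
  shows "\<bar>(\<Prod>i\<le>n. t i ^ e i) - (\<Prod>i\<le>n. x i ^ e i)\<bar> \<le> real d * R ^ (d - 1)"
proof -
  have sc: "(\<Prod>i\<le>n. z i ^ e i) = R ^ d * (\<Prod>i\<le>n. (z i / R) ^ e i)" for z :: "nat \<Rightarrow> real"
  proof -
    have "(\<Prod>i\<le>n. z i ^ e i) = (\<Prod>i\<le>n. (R * (z i / R)) ^ e i)" using R by simp
    then show ?thesis by (simp only: monomial_scale[OF e])
  qed
  have u: "norm (t i / R) \<le> 1" "norm (x i / R) \<le> 1" if "i \<le> n" for i using t x R that by (auto simp: abs_divide)
  have "norm ((\<Prod>i\<le>n. (t i / R) ^ e i) - (\<Prod>i\<le>n. (x i / R) ^ e i)) \<le> (\<Sum>i\<le>n. norm ((t i / R) ^ e i - (x i / R) ^ e i))"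
  proof (rule norm_prod_diff)
    fix i assume "i \<in> {..n}"
    then show "norm ((t i / R) ^ e i) \<le> 1" "norm ((x i / R) ^ e i) \<le> 1"
      unfolding norm_power by (intro power_le_one u norm_ge_zero; simp)+
  qed
  also have "\<dots> \<le> (\<Sum>i\<le>n. real (e i) * (1 / R))"
  proof (rule sum_mono)
    fix i assume "i \<in> {..n}"
    then have i: "i \<le> n" by simp
    have "norm ((t i / R) ^ e i - (x i / R) ^ e i) \<le> real (e i) * norm (t i / R - x i / R)"
      using u[OF i] by (rule norm_power_diff)
    also have "norm (t i / R - x i / R) \<le> 1 / R"
      using tx[OF i] R by (simp only: diff_divide_distrib[symmetric] real_norm_def abs_divide) (simp add: divide_right_mono)
    finally show "norm ((t i / R) ^ e i - (x i / R) ^ e i) \<le> real (e i) * (1 / R)" by (simp add: mult_left_mono)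
  qed
  also have "\<dots> = real (\<Sum>i\<le>n. e i) * (1 / R)" by (simp only: of_nat_sum sum_distrib_right)
  also have "\<dots> = real d / R" using e by (simp add: mons_def)
  finally have le: "norm ((\<Prod>i\<le>n. (t i / R) ^ e i) - (\<Prod>i\<le>n. (x i / R) ^ e i)) \<le> real d / R" .
  have "\<bar>(\<Prod>i\<le>n. t i ^ e i) - (\<Prod>i\<le>n. x i ^ e i)\<bar> = R ^ d * norm ((\<Prod>i\<le>n. (t i / R) ^ e i) - (\<Prod>i\<le>n. (x i / R) ^ e i))"
  proof -
    have "(\<Prod>i\<le>n. t i ^ e i) - (\<Prod>i\<le>n. x i ^ e i) = R ^ d * ((\<Prod>i\<le>n. (t i / R) ^ e i) - (\<Prod>i\<le>n. (x i / R) ^ e i))"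
      using sc[of t] sc[of x] by (simp only: right_diff_distrib)
    then show ?thesis using R by (simp only: abs_mult real_norm_def) simp
  qed
  also have "\<dots> \<le> R ^ d * (real d / R)" using le R by (intro mult_left_mono) auto
  also have "\<dots> = real d * R ^ (d - 1)" using R d by (cases d) auto
  finally show ?thesis .
qed

lemma veronese_norm_eq_L2_set: "veronese_norm d n t = L2_set (\<lambda>e. \<Prod>i\<le>n. t i ^ e i) (mons d n)"
  by (simp add: veronese_norm_eq L2_set_def)

lemma veronese_norm_diff_le:
  fixes t x :: "nat \<Rightarrow> real"
  assumes R: "0 < R" and d: "0 < d"
    and t: "\<And>i. i \<le> n \<Longrightarrow> \<bar>t i\<bar> \<le> R" and x: "\<And>i. i \<le> n \<Longrightarrow> \<bar>x i\<bar> \<le> R" and tx: "\<And>i. i \<le> n \<Longrightarrow> \<bar>t i - x i\<bar> \<le> 1"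
  shows "veronese_norm d n t \<le> veronese_norm d n x + real (Ndn d n) * real d * R ^ (d - 1)"
proof -
  let ?t = "\<lambda>e. \<Prod>i\<le>n. t i ^ e i" and ?x = "\<lambda>e. \<Prod>i\<le>n. x i ^ e i"
  have "veronese_norm d n t = L2_set (\<lambda>e. ?x e + (?t e - ?x e)) (mons d n)" by (simp add: veronese_norm_eq_L2_set)
  also have "\<dots> \<le> L2_set ?x (mons d n) + L2_set (\<lambda>e. ?t e - ?x e) (mons d n)" by (rule L2_set_triangle_ineq)
  also have "L2_set (\<lambda>e. ?t e - ?x e) (mons d n) \<le> (\<Sum>e\<in>mons d n. \<bar>?t e - ?x e\<bar>)" by (rule L2_set_le_sum_abs)
  also have "\<dots> \<le> (\<Sum>e\<in>mons d n. real d * R ^ (d - 1))"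
    using assms by (intro sum_mono monomial_diff_le) auto
  finally show ?thesis by (simp add: veronese_norm_eq_L2_set card_mons mult_ac)
qed

text \<open>Write \<open>r = sup_abs n x\<close>. For \<open>r >= 2\<close>, a point within 1 of
  \<open>x\<close> in each coordinate still has a coordinate of size at least \<open>r / 2\<close>,
  so both norms are at least \<open>(r / 2) ^ d\<close>. Their difference is
  \<open>O(r ^ (d - 1))\<close>, and dividing by their product gives
  \<open>O(r ^ (- d - 1))\<close>.\<close>

lemma inverse_veronese_norm_diff_le:
  fixes t :: "nat \<Rightarrow> real" and x :: "nat \<Rightarrow> int"
  assumes d: "0 < d" and r: "2 \<le> sup_abs n x" and tx: "\<And>i. i \<le> n \<Longrightarrow> \<bar>t i - real_of_int (x i)\<bar> \<le> 1"
  shows "1 / veronese_norm d n (\<lambda>i. real_of_int (x i)) \<le> 1 / real (sup_abs n x) ^ d"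
    and "1 / veronese_norm d n t \<le> 2 ^ d / real (sup_abs n x) ^ d"
    and "\<bar>1 / veronese_norm d n t - 1 / veronese_norm d n (\<lambda>i. real_of_int (x i))\<bar>
      \<le> real (Ndn d n) * real d * 4 ^ d / real (sup_abs n x) ^ (d + 1)"
proof -
  define r where "r = real (sup_abs n x)"
  let ?x = "\<lambda>i. real_of_int (x i)"
  obtain p where p: "p \<le> n" "nat \<bar>x p\<bar> = sup_abs n x" by (rule sup_abs_attained)
  have r2: "2 \<le> r" using r by (simp add: r_def)
  have xp: "\<bar>?x p\<bar> = r" using p(2) by (simp add: r_def)
  have xr: "\<bar>?x i\<bar> \<le> r" if "i \<le> n" for i
    using abs_le_sup_abs[OF that, of x] unfolding r_def by linarith
  have tr: "\<bar>t i\<bar> \<le> 2 * r" if "i \<le> n" for i using xr[OF that] tx[OF that] r2 by linarith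
  have tp: "r / 2 \<le> \<bar>t p\<bar>" using tx[OF p(1)] xp r2 by linarith
  have \<nu>x: "r ^ d \<le> veronese_norm d n ?x" using veronese_norm_ge[OF p(1), of ?x d] xp by simp
  have "(r / 2) ^ d \<le> \<bar>t p\<bar> ^ d" using tp r2 by (intro power_mono) auto
  also have "\<dots> \<le> veronese_norm d n t" by (rule veronese_norm_ge[OF p(1)])
  finally have \<nu>t: "(r / 2) ^ d \<le> veronese_norm d n t" .
  have pos: "0 < r ^ d" "0 < (r / 2) ^ d" using r2 by auto
  then have pos2: "0 < veronese_norm d n ?x" "0 < veronese_norm d n t" using \<nu>x \<nu>t by linarith+
  show "1 / veronese_norm d n ?x \<le> 1 / real (sup_abs n x) ^ d"
    using \<nu>x pos pos2 unfolding r_def[symmetric] by (intro divide_left_mono) auto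
  have "1 / veronese_norm d n t \<le> 1 / (r / 2) ^ d" using \<nu>t pos pos2 by (intro divide_left_mono) auto
  then show "1 / veronese_norm d n t \<le> 2 ^ d / real (sup_abs n x) ^ d" by (simp add: r_def power_divide)
  define E where "E = real (Ndn d n) * real d * (2 * r) ^ (d - 1)"
  have near: "\<bar>t i\<bar> \<le> 2 * r" "\<bar>?x i\<bar> \<le> 2 * r" "\<bar>t i - ?x i\<bar> \<le> 1" "\<bar>?x i - t i\<bar> \<le> 1" if "i \<le> n" for i
    using tr[OF that] xr[OF that] tx[OF that] r2 by linarith+
  have "veronese_norm d n t \<le> veronese_norm d n ?x + E"
    unfolding E_def by (rule veronese_norm_diff_le) (use r2 d near in auto)
  moreover have "veronese_norm d n ?x \<le> veronese_norm d n t + E"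
    unfolding E_def by (rule veronese_norm_diff_le) (use r2 d near in auto)
  ultimately have dif: "\<bar>veronese_norm d n ?x - veronese_norm d n t\<bar> \<le> E" by linarith
  have "\<bar>1 / veronese_norm d n t - 1 / veronese_norm d n ?x\<bar>
     = \<bar>veronese_norm d n ?x - veronese_norm d n t\<bar> / (veronese_norm d n t * veronese_norm d n ?x)"
  proof -
    have "1 / veronese_norm d n t - 1 / veronese_norm d n ?x = (veronese_norm d n ?x - veronese_norm d n t) / (veronese_norm d n t * veronese_norm d n ?x)"
      using pos2 by (simp add: field_simps)
    then show ?thesis using pos2 by (simp add: abs_divide abs_mult)
  qed
  also have "\<dots> \<le> E / ((r / 2) ^ d * r ^ d)"
    using dif \<nu>x \<nu>t pos pos2 by (intro frac_le mult_mono mult_pos_pos) auto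
  also have "\<dots> \<le> real (Ndn d n) * real d * 4 ^ d / r ^ (d + 1)"
  proof -
    have e: "E / ((r / 2) ^ d * r ^ d) = real (Ndn d n) * real d * (2 ^ d * (2 * r) ^ (d - 1)) / (r ^ d * r ^ d)"
      using r2 by (simp add: E_def power_divide)
    have "2 ^ d * (2 * r) ^ (d - 1) * r \<le> 4 ^ d * r ^ d"
    proof -
      have "2 ^ d * (2 * r) ^ (d - 1) * r \<le> 2 ^ d * (2 * r) ^ (d - 1) * (2 * r)" using r2 by (intro mult_left_mono) auto
      also have "\<dots> = 2 ^ d * (2 * r) ^ d" using d by (cases d) auto
      also have "\<dots> = (2 * (2 * r)) ^ d" by (simp only: power_mult_distrib)
      also have "\<dots> = (4 * r) ^ d" by simp
      also have "\<dots> = 4 ^ d * r ^ d" by (rule power_mult_distrib)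
      finally show ?thesis .
    qed
    then have "2 ^ d * (2 * r) ^ (d - 1) / (r ^ d * r ^ d) \<le> 4 ^ d / r ^ (d + 1)"
    proof -
      assume le: "2 ^ d * (2 * r) ^ (d - 1) * r \<le> 4 ^ d * r ^ d"
      have "2 ^ d * (2 * r) ^ (d - 1) / (r ^ d * r ^ d) = 2 ^ d * (2 * r) ^ (d - 1) * r / (r ^ d * r ^ d * r)"
        using r2 by simp
      also have "\<dots> \<le> 4 ^ d * r ^ d / (r ^ d * r ^ d * r)" using le r2 by (intro divide_right_mono) auto
      also have "\<dots> = 4 ^ d / r ^ (d + 1)" using r2 by simp
      finally show ?thesis .
    qed
    then have "real (Ndn d n) * real d * (2 ^ d * (2 * r) ^ (d - 1) / (r ^ d * r ^ d)) \<le> real (Ndn d n) * real d * (4 ^ d / r ^ (d + 1))"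
      by (intro mult_left_mono) auto
    then show ?thesis unfolding e by simp
  qed
  finally show "\<bar>1 / veronese_norm d n t - 1 / veronese_norm d n ?x\<bar> \<le> real (Ndn d n) * real d * 4 ^ d / real (sup_abs n x) ^ (d + 1)"
    by (simp add: r_def)
qed

section \<open>Integrability of the inverse norm near the origin\<close>

abbreviation lborel_prod :: "nat \<Rightarrow> (nat \<Rightarrow> real) measure" where
  "lborel_prod n \<equiv> PiM {..n} (\<lambda>_. lborel)"

lemma veronese_norm_measurable [measurable]: "veronese_norm d n \<in> borel_measurable (lborel_prod n)"
  unfolding veronese_norm_eq[abs_def] by measurable

lemma emeasure_lborel_prod_box:
  assumes "\<And>i. i \<le> n \<Longrightarrow> a i \<le> b i"
  shows "emeasure (lborel_prod n) (PiE {..n} (\<lambda>i. {a i..b i})) = ennreal (\<Prod>i\<le>n. b i - a i)"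
    and "emeasure (lborel_prod n) (PiE {..n} (\<lambda>i. {a i..<b i})) = ennreal (\<Prod>i\<le>n. b i - a i)"
proof -
  interpret product_sigma_finite "\<lambda>_. lborel :: real measure" by standard
  show "emeasure (lborel_prod n) (PiE {..n} (\<lambda>i. {a i..b i})) = ennreal (\<Prod>i\<le>n. b i - a i)"
    using assms by (subst emeasure_PiM) (auto intro!: prod_ennreal)
  show "emeasure (lborel_prod n) (PiE {..n} (\<lambda>i. {a i..<b i})) = ennreal (\<Prod>i\<le>n. b i - a i)"
    using assms by (subst emeasure_PiM) (auto intro!: prod_ennreal)
qed

definition sym_box :: "nat \<Rightarrow> real \<Rightarrow> (nat \<Rightarrow> real) set" where
  "sym_box n \<rho> = PiE {..n} (\<lambda>_. {-\<rho>..\<rho>})"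

lemma sym_box_sets [measurable]: "sym_box n \<rho> \<in> sets (lborel_prod n)"
  unfolding sym_box_def by (intro sets_PiM_I_finite) auto

lemma emeasure_sym_box: "0 \<le> \<rho> \<Longrightarrow> emeasure (lborel_prod n) (sym_box n \<rho>) = ennreal ((2 * \<rho>) ^ (n + 1))"
  unfolding sym_box_def using emeasure_lborel_prod_box(1)[of n "\<lambda>_. - \<rho>" "\<lambda>_. \<rho>"] by (simp flip: mult_2)

lemma veronese_norm_zero:
  assumes "0 < d" "\<And>i. i \<le> n \<Longrightarrow> t i = 0"
  shows "veronese_norm d n t = 0"
proof -
  have "(\<Prod>i\<le>n. t i ^ e i) = 0" if e: "e \<in> mons d n" for e
  proof -
    obtain i where "i \<le> n" "e i \<noteq> 0"
    proof (rule ccontr)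
      assume "\<not> thesis"
      then have "(\<Sum>i\<le>n. e i) = 0" using that by auto
      then show False using e assms(1) by (simp add: mons_def)
    qed
    then have "t i ^ e i = 0" using assms(2)[of i] by simp
    then show ?thesis using \<open>i \<le> n\<close> by (intro prod_zero) auto
  qed
  then have "(\<Sum>e\<in>mons d n. (\<Prod>i\<le>n. t i ^ e i)\<^sup>2) = (\<Sum>e\<in>mons d n. 0\<^sup>2)"
    by (intro sum.cong refl arg_cong[where f = "\<lambda>z. z\<^sup>2"])
  then show ?thesis by (simp add: veronese_norm_eq)
qed

text \<open>Dyadic shells around the origin: on the shell of radius \<open>\<rho> / 2 ^ j\<close> the integrand is at most
  \<open>(2 ^ (j + 1) / \<rho>) ^ d\<close>.\<close>
lemma nn_integral_inverse_veronese_norm_box: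
  assumes d: "0 < d" "d \<le> n" and \<rho>: "0 < \<rho>"
  shows "(\<integral>\<^sup>+t. ennreal (1 / veronese_norm d n t * indicator (sym_box n \<rho>) t) \<partial>lborel_prod n)
    \<le> ennreal (2 ^ (d + n + 2) * \<rho> ^ (n + 1 - d))"
proof -
  let ?M = "lborel_prod n"
  define u where "u j = (2 ^ (j + 1) / \<rho>) ^ d" for j :: nat
  have u0: "0 \<le> u j" for j using \<rho> by (simp add: u_def)
  have pt: "ennreal (1 / veronese_norm d n t * indicator (sym_box n \<rho>) t)
      \<le> (\<Sum>j. ennreal (u j) * indicator (sym_box n (\<rho> / 2 ^ j)) t)" if t: "t \<in> space ?M" for t
  \<comment> \<open>At points where the norm vanishes the left side is \<open>0\<close>, because
    \<open>1 / 0 = 0\<close>.\<close>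
  proof (cases "t \<in> sym_box n \<rho> \<and> veronese_norm d n t \<noteq> 0")
    case False
    then show ?thesis by auto
  next
    case True
    define s where "s = Max ((\<lambda>i. \<bar>t i\<bar>) ` {..n})"
    have s_ge: "\<bar>t i\<bar> \<le> s" if "i \<le> n" for i unfolding s_def using that by simp
    have "s \<in> (\<lambda>i. \<bar>t i\<bar>) ` {..n}" unfolding s_def by (intro Max_in) auto
    then obtain p where p: "p \<le> n" "s = \<bar>t p\<bar>" by auto
    have "s \<noteq> 0"
    proof
      assume "s = 0"
      then have "t i = 0" if "i \<le> n" for i using s_ge[OF that] by simp
      then show False using veronese_norm_zero[OF d(1), of n t] True by simp
    qed
    then have s0: "0 < s" using p by simp
    have "t p \<in> {- \<rho>..\<rho>}" using True p(1) by (auto simp: sym_box_def PiE_iff)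
    then have s\<rho>: "s \<le> \<rho>" using p by (auto simp: abs_le_iff)
    have "\<exists>j. \<rho> / 2 ^ (j + 1) < s"
    proof -
      obtain j where "\<rho> / s < 2 ^ j" using real_arch_pow[of 2 "\<rho> / s"] by auto
      then have "\<rho> / 2 ^ j < s" using s0 by (simp add: field_simps)
      moreover have "\<rho> / 2 ^ (j + 1) \<le> \<rho> / 2 ^ j" using \<rho> by (simp add: field_simps)
      ultimately show ?thesis by (intro exI[of _ j]) linarith
    qed
    \<comment> \<open>The least index gives
      \<open>\<rho> / 2 ^ (j + 1) < s <= \<rho> / 2 ^ j\<close>; for \<open>j = 0\<close> the upper
      bound comes from membership in the outer box.\<close>
    define j where "j = (LEAST j. \<rho> / 2 ^ (j + 1) < s)"
    have j: "\<rho> / 2 ^ (j + 1) < s" unfolding j_def by (rule LeastI_ex) fact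
    have sj: "s \<le> \<rho> / 2 ^ j"
    proof (cases j)
      case (Suc k)
      then have "\<not> \<rho> / 2 ^ (k + 1) < s" using not_less_Least[of k "\<lambda>j. \<rho> / 2 ^ (j + 1) < s"] by (simp add: j_def)
      then show ?thesis using Suc by simp
    qed (use s\<rho> in simp)
    have tj: "t \<in> sym_box n (\<rho> / 2 ^ j)"
    proof -
      have "\<bar>t i\<bar> \<le> \<rho> / 2 ^ j" if "i \<le> n" for i using s_ge[OF that] sj by linarith
      then show ?thesis using t by (auto simp: sym_box_def space_PiM PiE_iff abs_le_iff) (smt (verit))
    qed
    have "(\<rho> / 2 ^ (j + 1)) ^ d \<le> s ^ d" using j \<rho> by (intro power_mono) auto
    also have "\<dots> \<le> veronese_norm d n t" using veronese_norm_ge[OF p(1), of t d] p by simp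
    finally have "1 / veronese_norm d n t \<le> 1 / (\<rho> / 2 ^ (j + 1)) ^ d"
      using \<rho> by (intro divide_left_mono mult_pos_pos) (auto intro: less_le_trans[of 0 "(\<rho> / 2 ^ (j + 1)) ^ d"])
    also have "\<dots> = u j" by (simp add: u_def power_divide)
    finally have "ennreal (1 / veronese_norm d n t * indicator (sym_box n \<rho>) t) \<le> ennreal (u j)"
      using True by (intro ennreal_leI) simp
    also have "\<dots> = (\<Sum>j\<in>{j}. ennreal (u j) * indicator (sym_box n (\<rho> / 2 ^ j)) t)" using tj by simp
    also have "\<dots> \<le> (\<Sum>j. ennreal (u j) * indicator (sym_box n (\<rho> / 2 ^ j)) t)"
      by (intro sum_le_suminf summableI) auto
    finally show ?thesis .
  qed
  have "(\<integral>\<^sup>+t. ennreal (1 / veronese_norm d n t * indicator (sym_box n \<rho>) t) \<partial>?M)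
     \<le> (\<integral>\<^sup>+t. (\<Sum>j. ennreal (u j) * indicator (sym_box n (\<rho> / 2 ^ j)) t) \<partial>?M)"
    by (intro nn_integral_mono pt)
  also have "\<dots> = (\<Sum>j. \<integral>\<^sup>+t. ennreal (u j) * indicator (sym_box n (\<rho> / 2 ^ j)) t \<partial>?M)"
    by (rule nn_integral_suminf) measurable
  also have "\<dots> = (\<Sum>j. ennreal (u j * (2 * (\<rho> / 2 ^ j)) ^ (n + 1)))"
  proof (rule suminf_cong)
    fix j :: nat
    have "(\<integral>\<^sup>+t. ennreal (u j) * indicator (sym_box n (\<rho> / 2 ^ j)) t \<partial>?M) = ennreal (u j) * emeasure ?M (sym_box n (\<rho> / 2 ^ j))"
      by (rule nn_integral_cmult_indicator) measurable
    also have "\<dots> = ennreal (u j) * ennreal ((2 * (\<rho> / 2 ^ j)) ^ (n + 1))"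
      using \<rho> by (subst emeasure_sym_box) auto
    also have "\<dots> = ennreal (u j * (2 * (\<rho> / 2 ^ j)) ^ (n + 1))"
      using \<rho> u0 by (intro ennreal_mult[symmetric]) auto
    finally show "(\<integral>\<^sup>+t. ennreal (u j) * indicator (sym_box n (\<rho> / 2 ^ j)) t \<partial>?M) = ennreal (u j * (2 * (\<rho> / 2 ^ j)) ^ (n + 1))" .
  qed
  also have "\<dots> \<le> (\<Sum>j. ennreal (2 ^ (d + n + 1) * \<rho> ^ (n + 1 - d) * (1 / 2) ^ j))"
  proof (intro suminf_le ennreal_leI summableI)
    fix j :: nat
    define w where "w = (2::real) ^ j"
    have w: "1 \<le> w" by (simp add: w_def)
    have e: "n + 1 = d + (n + 1 - d)" "n + 1 - d = Suc (n - d)" using d by auto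
    have "u j * (2 * (\<rho> / 2 ^ j)) ^ (n + 1) = (2 * w / \<rho>) ^ d * (2 * \<rho> / w) ^ (n + 1)"
      by (simp add: u_def w_def)
    also have "\<dots> = 2 ^ d * 2 ^ (n + 1) * ((w / \<rho>) ^ d * (\<rho> / w) ^ (n + 1))"
    proof -
      have "(2 * w / \<rho>) ^ d = 2 ^ d * (w / \<rho>) ^ d" "(2 * \<rho> / w) ^ (n + 1) = 2 ^ (n + 1) * (\<rho> / w) ^ (n + 1)"
        by (simp_all only: power_mult_distrib flip: times_divide_eq_right)
      then show ?thesis by (simp only: mult_ac)
    qed
    also have "(\<rho> / w) ^ (n + 1) = (\<rho> / w) ^ d * (\<rho> / w) ^ (n + 1 - d)" by (subst e(1)) (rule power_add)
    also have "(w / \<rho>) ^ d * ((\<rho> / w) ^ d * (\<rho> / w) ^ (n + 1 - d)) = (\<rho> / w) ^ (n + 1 - d)"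
      using \<rho> w by (simp add: power_divide)
    also have "\<dots> = \<rho> ^ (n + 1 - d) * (1 / w) ^ (n + 1 - d)" by (simp add: power_divide)
    \<comment> \<open>Volume and bound of shell \<open>j\<close> combine to the power
      \<open>-(n + 1 - d)\<close> of \<open>2 ^ j\<close>. This exponent is at most
      \<open>-1\<close> since \<open>d <= n\<close>, so the shells are dominated by a geometric
      series.\<close>
    also have "(1 / w) ^ (n + 1 - d) \<le> (1 / w) ^ 1" using w e(2) by (intro power_decreasing) auto
    finally have "u j * (2 * (\<rho> / 2 ^ j)) ^ (n + 1) \<le> 2 ^ d * 2 ^ (n + 1) * (\<rho> ^ (n + 1 - d) * (1 / w) ^ 1)"
      using \<rho> by (simp add: mult_left_mono)
    then show "u j * (2 * (\<rho> / 2 ^ j)) ^ (n + 1) \<le> 2 ^ (d + n + 1) * \<rho> ^ (n + 1 - d) * (1 / 2) ^ j"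
      by (simp add: w_def power_add power_one_over mult_ac)
  qed
  also have "\<dots> = ennreal (2 ^ (d + n + 2) * \<rho> ^ (n + 1 - d))"
  proof -
    have "(\<lambda>j. 2 ^ (d + n + 1) * \<rho> ^ (n + 1 - d) * (1 / 2) ^ j) sums (2 ^ (d + n + 1) * \<rho> ^ (n + 1 - d) * (1 / (1 - 1 / 2)))"
      by (intro sums_mult geometric_sums) simp
    then show ?thesis using \<rho> by (subst suminf_ennreal_eq) (auto simp: mult_ac)
  qed
  finally show ?thesis .
qed

lemma integrable_inverse_veronese_norm_box:
  assumes d: "0 < d" "d \<le> n" and \<rho>: "0 < \<rho>"
  shows "integrable (lborel_prod n) (\<lambda>t. 1 / veronese_norm d n t * indicator (sym_box n \<rho>) t)"
    and "(LINT t|lborel_prod n. 1 / veronese_norm d n t * indicator (sym_box n \<rho>) t) \<le> 2 ^ (d + n + 2) * \<rho> ^ (n + 1 - d)"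
proof -
  have nn: "0 \<le> 1 / veronese_norm d n t * indicator (sym_box n \<rho>) t" for t
    by (simp add: veronese_norm_eq sum_nonneg)
  note le = nn_integral_inverse_veronese_norm_box[OF assms]
  show int: "integrable (lborel_prod n) (\<lambda>t. 1 / veronese_norm d n t * indicator (sym_box n \<rho>) t)"
  proof (rule integrableI_nonneg)
    show "(\<integral>\<^sup>+t. ennreal (1 / veronese_norm d n t * indicator (sym_box n \<rho>) t) \<partial>lborel_prod n) < \<infinity>"
      using le by (rule le_less_trans) simp
  qed (use nn in auto)
  show "(LINT t|lborel_prod n. 1 / veronese_norm d n t * indicator (sym_box n \<rho>) t) \<le> 2 ^ (d + n + 2) * \<rho> ^ (n + 1 - d)"
    using le nn_integral_eq_integral[OF int] nn \<rho> by simp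
qed

section \<open>Step functions on the grid of mesh 1 / Y\<close>

definition grid_cube :: "nat \<Rightarrow> real \<Rightarrow> (nat \<Rightarrow> int) \<Rightarrow> (nat \<Rightarrow> real) set" where
  "grid_cube n Y x = PiE {..n} (\<lambda>i. {real_of_int (x i) / Y..<(real_of_int (x i) + 1) / Y})"

text \<open>The integer vector whose cube contains \<open>t\<close>; the value \<open>0\<close>
  beyond \<open>n\<close> makes it an \<open>int_vec\<close>.\<close>

definition grid_point :: "nat \<Rightarrow> real \<Rightarrow> (nat \<Rightarrow> real) \<Rightarrow> nat \<Rightarrow> int" where
  "grid_point n Y t = (\<lambda>i. if i \<le> n then \<lfloor>Y * t i\<rfloor> else 0)"

lemma grid_cube_sets [measurable]: "grid_cube n Y x \<in> sets (lborel_prod n)"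
  unfolding grid_cube_def by (intro sets_PiM_I_finite) auto

lemma emeasure_grid_cube: "0 < Y \<Longrightarrow> emeasure (lborel_prod n) (grid_cube n Y x) = ennreal (1 / Y ^ (n + 1))"
  unfolding grid_cube_def by (subst emeasure_lborel_prod_box(2)) (auto simp: divide_right_mono add_divide_distrib power_one_over)

lemma mem_grid_cube_iff:
  assumes "0 < Y" "t \<in> space (lborel_prod n)" "int_vec n x"
  shows "t \<in> grid_cube n Y x \<longleftrightarrow> x = grid_point n Y t"
proof -
  have "s \<in> {real_of_int z / Y..<(real_of_int z + 1) / Y} \<longleftrightarrow> z = \<lfloor>Y * s\<rfloor>" for s z
  proof -
    have "s \<in> {real_of_int z / Y..<(real_of_int z + 1) / Y} \<longleftrightarrow> real_of_int z \<le> Y * s \<and> Y * s < real_of_int z + 1"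
      using assms(1) by (simp add: pos_divide_le_eq pos_less_divide_eq mult.commute)
    also have "\<dots> \<longleftrightarrow> \<lfloor>Y * s\<rfloor> = z" by (simp add: floor_eq_iff)
    finally show ?thesis by auto
  qed
  then have "t \<in> grid_cube n Y x \<longleftrightarrow> (\<forall>i\<le>n. x i = \<lfloor>Y * t i\<rfloor>)"
    using assms(2) by (simp add: grid_cube_def space_PiM PiE_iff Ball_def)
  also have "\<dots> \<longleftrightarrow> x = grid_point n Y t"
    using assms(3) by (auto simp: grid_point_def int_vec_def fun_eq_iff)
  finally show ?thesis .
qed

text \<open>The cubes are disjoint, so at each \<open>t\<close> at most one term survives;
  integration weights every term by the volume \<open>1 / Y ^ (n + 1)\<close> of a cube.\<close>

lemma sum_grid_cubes:
  fixes c :: "(nat \<Rightarrow> int) \<Rightarrow> real"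
  assumes "0 < Y" "finite S" "\<And>x. x \<in> S \<Longrightarrow> int_vec n x"
  shows "t \<in> space (lborel_prod n) \<Longrightarrow> (\<Sum>x\<in>S. c x * indicator (grid_cube n Y x) t)
      = (if grid_point n Y t \<in> S then c (grid_point n Y t) else 0)"
    and "integrable (lborel_prod n) (\<lambda>t. \<Sum>x\<in>S. c x * indicator (grid_cube n Y x) t)"
    and "(LINT t|lborel_prod n. (\<Sum>x\<in>S. c x * indicator (grid_cube n Y x) t)) = (\<Sum>x\<in>S. c x) / Y ^ (n + 1)"
proof -
  show "(\<Sum>x\<in>S. c x * indicator (grid_cube n Y x) t) = (if grid_point n Y t \<in> S then c (grid_point n Y t) else 0)"
    if "t \<in> space (lborel_prod n)"
  proof -
    have "(\<Sum>x\<in>S. c x * indicator (grid_cube n Y x) t) = (\<Sum>x\<in>S. if x = grid_point n Y t then c x else 0)"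
      using assms(3) mem_grid_cube_iff[OF assms(1) that] by (intro sum.cong) (auto simp: indicator_def)
    then show ?thesis using assms(2) by (simp add: sum.delta)
  qed
  have i: "integrable (lborel_prod n) (\<lambda>t. c x * indicator (grid_cube n Y x) t)" for x
    using assms(1) by (intro integrable_mult_right integrable_real_indicator) (auto simp: emeasure_grid_cube)
  then show "integrable (lborel_prod n) (\<lambda>t. \<Sum>x\<in>S. c x * indicator (grid_cube n Y x) t)" by simp
  have m: "measure (lborel_prod n) (grid_cube n Y x) = 1 / Y ^ (n + 1)" for x
    using assms(1) by (simp add: measure_def emeasure_grid_cube del: power_Suc)
  have "(LINT t|lborel_prod n. (\<Sum>x\<in>S. c x * indicator (grid_cube n Y x) t))
     = (\<Sum>x\<in>S. (LINT t|lborel_prod n. c x * indicator (grid_cube n Y x) t))"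
    using i by (rule Bochner_Integration.integral_sum)
  also have "\<dots> = (\<Sum>x\<in>S. c x * (1 / Y ^ (n + 1)))"
    using m sets.sets_into_space[OF grid_cube_sets] by (intro sum.cong refl) (simp add: Int_absorb2)
  finally show "(LINT t|lborel_prod n. (\<Sum>x\<in>S. c x * indicator (grid_cube n Y x) t)) = (\<Sum>x\<in>S. c x) / Y ^ (n + 1)"
    by (simp add: sum_divide_distrib)
qed

lemma harmonic_sum_le: "1 \<le> R \<Longrightarrow> (\<Sum>k\<in>{1..R}. 1 / real k) \<le> 1 + ln (real R)"
proof (induction R rule: nat_induct_at_least)
  case (Suc R)
  have "ln (real R / real (Suc R)) \<le> real R / real (Suc R) - 1"
    using Suc.hyps by (intro ln_le_minus_one) auto
  also have "\<dots> = - (1 / real (Suc R))" by (simp add: field_simps)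
  finally have "1 / real (Suc R) \<le> ln (real (Suc R)) - ln (real R)"
    using Suc.hyps by (simp add: ln_div)
  then show ?case using Suc.IH by simp
qed simp

lemma vnorm_le_sup_abs: "vnorm n x \<le> real (n + 1) * real (sup_abs n x)"
proof -
  have "vnorm n x \<le> (\<Sum>i\<le>n. \<bar>real_of_int (x i)\<bar>)" unfolding vnorm_eq_L2_set by (rule L2_set_le_sum_abs)
  also have "\<dots> \<le> (\<Sum>i\<le>n. real (sup_abs n x))"
  proof (rule sum_mono)
    fix i assume "i \<in> {..n}"
    then have "nat \<bar>x i\<bar> \<le> sup_abs n x" by (intro abs_le_sup_abs) auto
    then show "\<bar>real_of_int (x i)\<bar> \<le> real (sup_abs n x)" by linarith
  qed
  finally show ?thesis by simp
qed

lemma sup_abs_le_vnorm: "real (sup_abs n x) \<le> vnorm n x"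
proof -
  obtain p where p: "p \<le> n" "nat \<bar>x p\<bar> = sup_abs n x" by (rule sup_abs_attained)
  have "\<bar>real_of_int (x p)\<bar> \<le> vnorm n x" unfolding vnorm_eq_L2_set using p by (intro abs_le_L2_set) auto
  then show ?thesis using p(2) by linarith
qed

lemma finite_vnorm_le: "finite {x. int_vec n x \<and> vnorm n x \<le> T}"
  using finite_bounded_int_vectors[of "{..n}" T] by (simp add: int_vec_def vnorm_eq_L2_set not_le)

lemma count_vnorm_le:
  assumes "1 \<le> T"
  shows "\<bar>real (card {x. int_vec n x \<and> vnorm n x \<le> T}) - unit_ball_vol (real (n + 1)) * T ^ (n + 1)\<bar>
    \<le> lattice_const (n + 1) * T ^ n"
  using count_int_vectors[of "{..n}" T] assms by (simp add: int_vec_def vnorm_eq_L2_set not_le)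

text \<open>The shell lies between two balls whose radii differ by a constant, so the main terms of
  the two ball counts cancel to order \<open>Y ^ n\<close>.\<close>

lemma count_thin_shell:
  fixes Y :: real
  assumes Y: "1 \<le> Y"
  shows "real (card {x. int_vec n x \<and> \<bar>vnorm n x - Y\<bar> \<le> real (n + 1)})
    \<le> real (n + 2) ^ n * (unit_ball_vol (real (n + 1)) * real (n + 1) * real (2 * n + 4) + 2 * lattice_const (n + 1)) * Y ^ n"
proof -
  let ?N = "\<lambda>T. real (card {x. int_vec n x \<and> vnorm n x \<le> T})"
  let ?V = "unit_ball_vol (real (n + 1))" and ?l = "lattice_const (n + 1)"
  define S where "S = {x. int_vec n x \<and> \<bar>vnorm n x - Y\<bar> \<le> real (n + 1)}"
  define a where "a = Y + real (n + 1)"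
  \<comment> \<open>One less than the inner radius of the shell, which makes the ball of radius
    \<open>b\<close> disjoint from it. If \<open>b < 1\<close>, then \<open>a < 2 * n + 4\<close>,
    and the whole ball of radius \<open>a\<close> has only \<open>O(a ^ n)\<close> points.\<close>
  define b where "b = Y - real (n + 2)"
  have l: "0 \<le> ?l" by (rule lattice_const_nonneg)
  have V: "0 \<le> ?V" by simp
  have a1: "1 \<le> a" using Y by (simp add: a_def)
  have Na: "?N a \<le> ?V * a ^ (n + 1) + ?l * a ^ n" using count_vnorm_le[OF a1, of n] by linarith
  have "real (card S) \<le> (?V * real (n + 1) * real (2 * n + 4) + 2 * ?l) * a ^ n"
  proof (cases "1 \<le> b")
    case True
    have "{x. int_vec n x \<and> vnorm n x \<le> b} \<union> S \<subseteq> {x. int_vec n x \<and> vnorm n x \<le> a}"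
      by (auto simp: S_def a_def b_def)
    then have "card ({x. int_vec n x \<and> vnorm n x \<le> b} \<union> S) \<le> card {x. int_vec n x \<and> vnorm n x \<le> a}"
      by (intro card_mono finite_vnorm_le)
    moreover have "finite S" by (rule finite_subset[OF _ finite_vnorm_le[of n a]]) (auto simp: S_def a_def)
    then have "card ({x. int_vec n x \<and> vnorm n x \<le> b} \<union> S) = card {x. int_vec n x \<and> vnorm n x \<le> b} + card S"
      by (intro card_Un_disjoint finite_vnorm_le) (auto simp: S_def b_def)
    ultimately have "real (card S) \<le> ?N a - ?N b" by linarith
    also have "\<dots> \<le> ?V * (a ^ (n + 1) - b ^ (n + 1)) + ?l * a ^ n + ?l * b ^ n"
      using Na count_vnorm_le[OF True, of n] by (simp add: right_diff_distrib)
    also have "a ^ (n + 1) - b ^ (n + 1) \<le> real (n + 1) * (a - b) * a ^ (n + 1 - 1)"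
      using True by (intro power_diff_le) (auto simp: a_def b_def)
    also have "b ^ n \<le> a ^ n" using True by (intro power_mono) (auto simp: a_def b_def)
    finally have "real (card S) \<le> ?V * (real (n + 1) * (a - b) * a ^ n) + ?l * a ^ n + ?l * a ^ n"
      using V l by (simp add: mult_left_mono)
    also have "\<dots> = (?V * real (n + 1) * (a - b) + 2 * ?l) * a ^ n" by (simp add: algebra_simps)
    also have "\<dots> \<le> (?V * real (n + 1) * real (2 * n + 4) + 2 * ?l) * a ^ n"
      using V a1 by (intro mult_right_mono add_mono mult_left_mono) (auto simp: a_def b_def)
    finally show ?thesis .
  next
    case False
    have "card S \<le> card {x. int_vec n x \<and> vnorm n x \<le> a}"
      by (intro card_mono finite_vnorm_le) (auto simp: S_def a_def)
    then have "real (card S) \<le> ?N a" by simp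
    also have "\<dots> \<le> ?V * a ^ (n + 1) + ?l * a ^ n" by (rule Na)
    also have "\<dots> = (?V * 1 * a + ?l) * a ^ n" by (simp add: algebra_simps)
    also have "\<dots> \<le> (?V * real (n + 1) * real (2 * n + 4) + 2 * ?l) * a ^ n"
      using V l a1 False by (intro mult_right_mono add_mono mult_mono) (auto simp: a_def b_def)
    finally show ?thesis .
  qed
  also have "\<dots> \<le> (?V * real (n + 1) * real (2 * n + 4) + 2 * ?l) * (real (n + 2) * Y) ^ n"
  proof (intro mult_left_mono power_mono)
    have "real (n + 1) * 1 \<le> real (n + 1) * Y" using Y by (intro mult_left_mono) auto
    then show "a \<le> real (n + 2) * Y" by (simp add: a_def algebra_simps)
  qed (use V l a1 in auto)
  finally show ?thesis unfolding S_def by (simp only: power_mult_distrib mult_ac)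
qed

text \<open>Shell \<open>k\<close> holds \<open>O(k ^ n)\<close> points and so contributes
  \<open>O(k ^ (n - d) / k)\<close>. The power \<open>k ^ (n - d)\<close> is replaced by its largest
  value and a harmonic sum remains.\<close>

lemma sum_inverse_sup_abs_powers_le:
  fixes Y :: real
  assumes Y: "1 \<le> Y" and d: "d \<le> n" and T: "finite T" "\<And>x. x \<in> T \<Longrightarrow> int_vec n x \<and> sup_abs n x \<in> {1..nat \<lfloor>Y\<rfloor> + 1}"
  shows "(\<Sum>x\<in>T. 1 / real (sup_abs n x) ^ (d + 1)) \<le> 4 * real (n + 1) * 6 ^ n * (Y ^ (n - d) * (1 + ln Y))"
proof -
  define R where "R = nat \<lfloor>Y\<rfloor> + 1"
  have R: "1 \<le> R" by (simp add: R_def)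
  have "real (nat \<lfloor>Y\<rfloor>) \<le> Y" using Y by linarith
  then have RY: "real R \<le> 2 * Y" unfolding R_def of_nat_add using Y by linarith
  have lnY: "0 \<le> ln Y" using Y by simp
  have "(\<Sum>x\<in>T. 1 / real (sup_abs n x) ^ (d + 1)) \<le> 2 * real (n + 1) * 3 ^ n * (\<Sum>k\<in>{1..R}. real k ^ n * (1 / real k ^ (d + 1)))"
    using T by (intro sum_over_shells_le) (auto simp: R_def)
  also have "(\<Sum>k\<in>{1..R}. real k ^ n * (1 / real k ^ (d + 1))) \<le> (\<Sum>k\<in>{1..R}. (2 * Y) ^ (n - d) * (1 / real k))"
  proof (rule sum_mono)
    fix k assume k: "k \<in> {1..R}"
    have "real k ^ n = real k ^ (n - d) * real k ^ d" using d by (simp flip: power_add)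
    then have "real k ^ n * (1 / real k ^ (d + 1)) = real k ^ (n - d) * (1 / real k)" using k by simp
    also have "\<dots> \<le> (2 * Y) ^ (n - d) * (1 / real k)"
      using k RY by (intro mult_right_mono power_mono) auto
    finally show "real k ^ n * (1 / real k ^ (d + 1)) \<le> (2 * Y) ^ (n - d) * (1 / real k)" .
  qed
  also have "\<dots> = (2 * Y) ^ (n - d) * (\<Sum>k\<in>{1..R}. 1 / real k)" by (simp only: sum_distrib_left)
  also have "(\<Sum>k\<in>{1..R}. 1 / real k) \<le> 2 * (1 + ln Y)"
  proof -
    have "(\<Sum>k\<in>{1..R}. 1 / real k) \<le> 1 + ln (real R)" using R by (rule harmonic_sum_le)
    also have "ln (real R) \<le> ln (2 * Y)" using RY R Y by (subst ln_le_cancel_iff) auto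
    also have "\<dots> = ln 2 + ln Y" using Y by (simp add: ln_mult)
    also have "ln 2 \<le> (1::real)" using ln_le_minus_one[of 2] by simp
    finally show ?thesis using lnY by simp
  qed
  also have "(2 * Y) ^ (n - d) * (2 * (1 + ln Y)) \<le> 2 ^ n * Y ^ (n - d) * (2 * (1 + ln Y))"
    using Y lnY d by (intro mult_right_mono) (auto simp: power_mult_distrib intro!: mult_right_mono power_increasing)
  finally have "(\<Sum>x\<in>T. 1 / real (sup_abs n x) ^ (d + 1)) \<le> 2 * real (n + 1) * 3 ^ n * (2 ^ n * Y ^ (n - d) * (2 * (1 + ln Y)))"
    using Y by (simp add: mult_left_mono)
  also have "\<dots> = 4 * real (n + 1) * (3 ^ n * 2 ^ n) * (Y ^ (n - d) * (1 + ln Y))" by (simp only: mult_ac)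
  also have "3 ^ n * 2 ^ n = (6::real) ^ n" by (simp flip: power_mult_distrib)
  finally show ?thesis .
qed

definition ver_density :: "nat \<Rightarrow> nat \<Rightarrow> (nat \<Rightarrow> real) \<Rightarrow> real" where
  "ver_density d n t = indicator {t. (\<Sum>i\<le>n. (t i)\<^sup>2) \<le> 1} t / veronese_norm d n t"

lemma ver_density_eq: "ver_density d n t = (if (\<Sum>i\<le>n. (t i)\<^sup>2) \<le> 1 then 1 / veronese_norm d n t else 0)"
  by (simp add: ver_density_def indicator_def)

lemma ver_density_measurable [measurable]: "ver_density d n \<in> borel_measurable (lborel_prod n)"
  unfolding ver_density_eq[abs_def] by measurable

lemma veronese_norm_nonneg: "0 \<le> veronese_norm d n t"
  by (simp add: veronese_norm_eq sum_nonneg)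

lemma ver_density_nonneg: "0 \<le> ver_density d n t"
  by (simp add: ver_density_eq veronese_norm_nonneg)

lemma unit_ball_subset_sym_box:
  assumes "t \<in> space (lborel_prod n)" "(\<Sum>i\<le>n. (t i)\<^sup>2) \<le> 1"
  shows "t \<in> sym_box n 1"
proof -
  have "\<bar>t i\<bar> \<le> 1" if "i \<le> n" for i
  proof -
    have "(t i)\<^sup>2 \<le> (\<Sum>i\<le>n. (t i)\<^sup>2)" using that by (intro member_le_sum) auto
    then have "(t i)\<^sup>2 \<le> 1" using assms(2) by linarith
    then show ?thesis by (simp add: abs_square_le_1)
  qed
  then show ?thesis using assms(1) by (auto simp: sym_box_def space_PiM PiE_iff abs_le_iff)
qed

lemma integrable_ver_density:
  assumes d: "0 < d" "d \<le> n"
  shows "integrable (lborel_prod n) (ver_density d n)"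
proof (rule Bochner_Integration.integrable_bound[OF integrable_inverse_veronese_norm_box(1)[OF d, of 1]])
  show "AE t in lborel_prod n. norm (ver_density d n t) \<le> norm (1 / veronese_norm d n t * indicator (sym_box n 1) t)"
    using unit_ball_subset_sym_box by (intro AE_I2) (auto simp: ver_density_eq)
qed (use d in auto)

text \<open>On a small cube of positive volume, inside the unit ball and away from the origin, the
  density is at least \<open>1 / N\<close>, because all \<open>N\<close> monomials are at most 1
  there.\<close>

lemma ver_integral_pos:
  assumes d: "0 < d" "d \<le> n"
  shows "0 < ver_integral d n"
proof -
  \<comment> \<open>For coordinates in \<open>[b, 2 * b]\<close> the sum of the squares is at most
    the sum of the coordinates, hence at most \<open>(n + 1) * 2 * b = 1\<close>.\<close>
  define b where "b = 1 / (2 * real (n + 1))"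
  define S where "S = PiE {..n} (\<lambda>_. {b..2 * b})"
  define N where "N = real (Ndn d n)"
  have b: "0 < b" "2 * b = 1 / real (n + 1)" by (simp_all add: b_def field_simps)
  have mS: "emeasure (lborel_prod n) S = ennreal (b ^ (n + 1))"
    unfolding S_def using emeasure_lborel_prod_box(1)[of n "\<lambda>_. b" "\<lambda>_. 2 * b"] b(1) by simp
  have S[measurable]: "S \<in> sets (lborel_prod n)" unfolding S_def by (intro sets_PiM_I_finite) auto
  have N: "0 < N" by (simp add: N_def Ndn_def)
  have le: "1 / N * indicator S t \<le> ver_density d n t" for t
  proof (cases "t \<in> S")
    case True
    then have t: "b \<le> t i" "t i \<le> 2 * b" if "i \<le> n" for i using that by (auto simp: S_def PiE_iff)
    have t1: "\<bar>t i\<bar> \<le> 1" if "i \<le> n" for i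
    proof -
      have "2 * b \<le> 1" unfolding b(2) by simp
      then show ?thesis using t[OF that] b(1) by linarith
    qed
    have "(\<Sum>i\<le>n. (t i)\<^sup>2) \<le> (\<Sum>i\<le>n. t i)"
    proof (rule sum_mono)
      fix i assume "i \<in> {..n}"
      then have "t i * t i \<le> t i * 1" using t(1)[of i] t1[of i] b(1) by (intro mult_left_mono) auto
      then show "(t i)\<^sup>2 \<le> t i" by (simp add: power2_eq_square)
    qed
    also have "\<dots> \<le> (\<Sum>i\<le>n. 2 * b)" using t by (intro sum_mono) auto
    also have "\<dots> = (\<Sum>i\<le>n. 1 / real (n + 1))" by (simp only: b(2))
    finally have ball: "(\<Sum>i\<le>n. (t i)\<^sup>2) \<le> 1" by simp
    have "veronese_norm d n t \<le> (\<Sum>e\<in>mons d n. \<bar>\<Prod>i\<le>n. t i ^ e i\<bar>)"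
      unfolding veronese_norm_eq_L2_set by (rule L2_set_le_sum_abs)
    also have "\<dots> \<le> (\<Sum>e\<in>mons d n. 1 ^ d)" using t1 by (intro sum_mono prod_powers_le) auto
    finally have "veronese_norm d n t \<le> N" by (simp add: card_mons N_def)
    moreover have "0 < veronese_norm d n t"
    proof -
      have "0 < \<bar>t 0\<bar> ^ d" using t[of 0] b by simp
      then show ?thesis using veronese_norm_ge[of 0 n t d] by linarith
    qed
    ultimately have "1 / N \<le> 1 / veronese_norm d n t" by (intro divide_left_mono) auto
    then show ?thesis using True ball by (simp add: ver_density_eq)
  qed (simp add: ver_density_nonneg)
  have "0 < 1 / N * b ^ (n + 1)" using N b by simp
  also have "\<dots> = (LINT t|lborel_prod n. 1 / N * indicator S t)"
  proof -
    have "measure (lborel_prod n) S = b ^ (n + 1)" using b mS by (simp add: measure_def)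
    moreover have "S \<inter> space (lborel_prod n) = S" using sets.sets_into_space[OF S] by auto
    ultimately show ?thesis by simp
  qed
  also have "\<dots> \<le> (LINT t|lborel_prod n. ver_density d n t)"
  proof (rule integral_mono)
    show "integrable (lborel_prod n) (\<lambda>t. 1 / N * indicator S t)"
      using mS by (intro integrable_mult_right integrable_real_indicator) auto
  qed (use le integrable_ver_density[OF d] in auto)
  finally show ?thesis by (simp add: ver_integral_def ver_density_def[abs_def])
qed

lemma sup_abs_eq_0_iff: "int_vec n x \<Longrightarrow> sup_abs n x = 0 \<longleftrightarrow> x = (\<lambda>_. 0)"
proof
  assume x: "int_vec n x" "sup_abs n x = 0"
  show "x = (\<lambda>_. 0)"
  proof
    fix i show "x i = 0" using x abs_le_sup_abs[of i n x] by (cases "i \<le> n") (auto simp: int_vec_def)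
  qed
next
  assume "x = (\<lambda>_. 0)"
  moreover obtain p where "nat \<bar>x p\<bar> = sup_abs n x" by (rule sup_abs_attained)
  ultimately show "sup_abs n x = 0" by simp
qed

text \<open>By homogeneity \<open>1 / veronese_norm\<close> at \<open>t\<close> is
  \<open>Y ^ d\<close> times its value at \<open>Y * t\<close>, a point of the unit cube with corner
  \<open>x\<close>. The error has three sources: the cubes next to the origin, where both terms are
  bounded separately; the oscillation of the inverse norm in the other cubes; and the cubes near the
  sphere of radius \<open>Y\<close>, where only one of the two terms may be present, but is bounded
  by \<open>C2\<close>.\<close>

lemma grid_approximation:
  fixes Y :: real and d n :: nat
  defines "F \<equiv> \<lambda>x. 1 / veronese_norm d n (\<lambda>i. real_of_int (x i))"
    and "S \<equiv> {x. int_vec n x \<and> x \<noteq> (\<lambda>_. 0) \<and> vnorm n x \<le> Y}"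
    and "C1 \<equiv> real (Ndn d n) * real d * 4 ^ d"
    and "C2 \<equiv> 2 ^ d * (2 * real (n + 1)) ^ d"
  assumes d: "0 < d" and Y: "1 \<le> Y" and t: "t \<in> space (lborel_prod n)"
  defines "x \<equiv> grid_point n Y t"
  shows "\<bar>ver_density d n t - (if x \<in> S then Y ^ d * F x else 0)\<bar>
    \<le> (1 / veronese_norm d n t * indicator (sym_box n (2 / Y)) t + Y ^ d * indicator (sym_box n (2 / Y)) t)
      + (if sup_abs n x \<in> {2..nat \<lfloor>Y\<rfloor> + 1}
         then Y ^ d * (C1 / real (sup_abs n x) ^ (d + 1)) + (if \<bar>vnorm n x - Y\<bar> \<le> real (n + 1) then C2 else 0) else 0)"
proof -
  define z where "z i = Y * t i" for i
  define r where "r = sup_abs n x"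
  let ?x = "\<lambda>i. real_of_int (x i)"
  have C: "0 \<le> C1" "0 \<le> C2" by (simp_all add: C1_def C2_def)
  have Y0: "0 < Y" using Y by simp
  have iv: "int_vec n x" by (simp add: x_def grid_point_def int_vec_def)
  have zx: "\<bar>z i - ?x i\<bar> \<le> 1" if "i \<le> n" for i
    using that unfolding x_def z_def grid_point_def by simp linarith
  have \<nu>z: "veronese_norm d n z = Y ^ d * veronese_norm d n t"
    using veronese_norm_scale[of Y d n t] Y0 by (simp add: z_def[abs_def])
  then have \<nu>t: "1 / veronese_norm d n t = Y ^ d * (1 / veronese_norm d n z)" using Y0 by simp
  have ball: "(\<Sum>i\<le>n. (t i)\<^sup>2) \<le> 1 \<longleftrightarrow> L2_set z {..n} \<le> Y"
  proof -
    have "L2_set z {..n} = Y * sqrt (\<Sum>i\<le>n. (t i)\<^sup>2)"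
      using Y0 by (simp add: L2_set_def z_def power_mult_distrib real_sqrt_mult flip: sum_distrib_left)
    then show ?thesis using Y0 by (simp add: mult_le_cancel_left2)
  qed
  have nrm: "\<bar>vnorm n x - L2_set z {..n}\<bar> \<le> real (n + 1)"
  proof -
    have sm: "L2_set (\<lambda>i. z i - ?x i) {..n} \<le> real (n + 1)"
    proof -
      have "L2_set (\<lambda>i. z i - ?x i) {..n} \<le> (\<Sum>i\<le>n. \<bar>z i - ?x i\<bar>)" by (rule L2_set_le_sum_abs)
      also have "\<dots> \<le> (\<Sum>i\<le>n. 1)" using zx by (intro sum_mono) auto
      finally show ?thesis by simp
    qed
    have "L2_set (\<lambda>i. ?x i + (z i - ?x i)) {..n} \<le> L2_set ?x {..n} + L2_set (\<lambda>i. z i - ?x i) {..n}"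
      by (rule L2_set_triangle_ineq)
    moreover have "L2_set (\<lambda>i. z i + (?x i - z i)) {..n} \<le> L2_set z {..n} + L2_set (\<lambda>i. ?x i - z i) {..n}"
      by (rule L2_set_triangle_ineq)
    moreover have "L2_set (\<lambda>i. ?x i - z i) {..n} = L2_set (\<lambda>i. z i - ?x i) {..n}"
      by (simp add: L2_set_def power2_commute)
    ultimately show ?thesis using sm by (simp add: vnorm_eq_L2_set)
  qed
  have h: "ver_density d n t = (if L2_set z {..n} \<le> Y then Y ^ d * (1 / veronese_norm d n z) else 0)"
    unfolding ver_density_eq ball \<nu>t ..
  have F0: "0 \<le> F x" by (simp add: F_def veronese_norm_nonneg)
  have near0: "0 \<le> 1 / veronese_norm d n t * indicator (sym_box n (2 / Y)) t + Y ^ d * indicator (sym_box n (2 / Y)) t"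
    using Y0 by (simp add: veronese_norm_nonneg)
  show ?thesis
  \<comment> \<open>For \<open>r <= 1\<close> the point \<open>Y * t\<close> has coordinates at most
    2 in absolute value, so \<open>t\<close> lies in the box of radius \<open>2 / Y\<close>.\<close>
  proof (cases "2 \<le> r")
    case False
    then have r1: "r \<le> 1" by simp
    have "\<bar>t i\<bar> \<le> 2 / Y" if i: "i \<le> n" for i
    proof -
      have "nat \<bar>x i\<bar> \<le> 1" using abs_le_sup_abs[OF i, of x] r1 unfolding r_def by linarith
      then have "\<bar>z i\<bar> \<le> 2" using zx[OF i] by linarith
      then show ?thesis using Y0 by (simp add: z_def abs_mult pos_le_divide_eq mult.commute)
    qed
    then have tb: "t \<in> sym_box n (2 / Y)" using t by (auto simp: sym_box_def space_PiM PiE_iff abs_le_iff) (smt (verit))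
    have "F x \<le> 1" if "x \<in> S"
    proof -
      have "r \<noteq> 0" using that sup_abs_eq_0_iff[OF iv] by (simp add: S_def r_def)
      then have "r = 1" using r1 by simp
      obtain p where p: "p \<le> n" "nat \<bar>x p\<bar> = sup_abs n x" by (rule sup_abs_attained)
      then have "\<bar>?x p\<bar> = 1" using \<open>r = 1\<close> unfolding r_def by linarith
      then have "1 \<le> veronese_norm d n ?x" using veronese_norm_ge[OF p(1), of ?x d] by simp
      then show ?thesis by (simp add: F_def)
    qed
    then have "(if x \<in> S then Y ^ d * F x else 0) \<le> Y ^ d" using Y0 by (simp add: mult_left_le)
    moreover have "0 \<le> (if x \<in> S then Y ^ d * F x else 0)" using Y0 F0 by simp
    moreover have "ver_density d n t \<le> 1 / veronese_norm d n t" by (simp add: ver_density_eq veronese_norm_nonneg)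
    ultimately have "\<bar>ver_density d n t - (if x \<in> S then Y ^ d * F x else 0)\<bar> \<le> 1 / veronese_norm d n t + Y ^ d"
      using ver_density_nonneg[of d n t] by linarith
    then show ?thesis using tb False by (simp add: r_def)
  next
    case True
    have rr: "2 \<le> sup_abs n x" using True by (simp add: r_def)
    note bounds = inverse_veronese_norm_diff_le[OF d rr zx]
    have x0: "x \<noteq> (\<lambda>_. 0)" using sup_abs_eq_0_iff[OF iv] rr by auto
    have xS: "x \<in> S \<longleftrightarrow> vnorm n x \<le> Y" using iv x0 by (simp add: S_def)
    define b where "b = Y ^ d * (C1 / real (sup_abs n x) ^ (d + 1)) + (if \<bar>vnorm n x - Y\<bar> \<le> real (n + 1) then C2 else 0)"
    have b0: "0 \<le> b" using C Y0 by (simp add: b_def)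
    \<comment> \<open>When only \<open>Y * t\<close> is known to lie in the ball, rounding down may
      move a coordinate out of it by at most 1; this accounts for the \<open>+ 1\<close> in the
      range.\<close>
    have Rin: "sup_abs n x \<in> {2..nat \<lfloor>Y\<rfloor> + 1}" if "L2_set z {..n} \<le> Y \<or> x \<in> S"
    proof -
      obtain p where p: "p \<le> n" "nat \<bar>x p\<bar> = sup_abs n x" by (rule sup_abs_attained)
      have "\<bar>?x p\<bar> \<le> Y + 1"
      proof (cases "x \<in> S")
        case True
        have "\<bar>?x p\<bar> \<le> vnorm n x" unfolding vnorm_eq_L2_set using p by (intro abs_le_L2_set) auto
        then show ?thesis using True xS by linarith
      next
        case False
        have "\<bar>z p\<bar> \<le> L2_set (\<lambda>i. \<bar>z i\<bar>) {..n}" using p by (intro member_le_L2_set) auto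
        then have "\<bar>z p\<bar> \<le> Y" using False that by (simp add: L2_set_def)
        then show ?thesis using zx[OF p(1)] by linarith
      qed
      then have "\<bar>x p\<bar> \<le> \<lfloor>Y\<rfloor> + 1" by linarith
      then have "sup_abs n x \<le> nat \<lfloor>Y\<rfloor> + 1" unfolding p(2)[symmetric] using Y by linarith
      then show ?thesis using rr by simp
    qed
    have C1b: "0 \<le> Y ^ d * (C1 / real (sup_abs n x) ^ (d + 1))" using C Y0 by simp
    \<comment> \<open>Near the sphere \<open>r\<close> is at least \<open>Y / (2 * (n + 1))\<close>,
      so \<open>(2 * Y / r) ^ d\<close> is bounded by \<open>C2\<close>.\<close>
    have edge: "Y ^ d * 2 ^ d / real r ^ d \<le> C2" if "\<bar>vnorm n x - Y\<bar> \<le> real (n + 1)"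
    proof -
      define c where "c = real (n + 1)"
      have "Y - c \<le> c * real r" using that vnorm_le_sup_abs[of n x] unfolding r_def c_def by linarith
      moreover have "c * 1 \<le> c * real r" using True unfolding c_def by (intro mult_left_mono) auto
      ultimately have "Y \<le> 2 * c * real r" by linarith
      then have "Y \<le> 2 * real (n + 1) * real r" by (simp only: c_def)
      then have "Y ^ d \<le> (2 * real (n + 1) * real r) ^ d" using Y0 by (intro power_mono) auto
      then have "Y ^ d * 2 ^ d \<le> C2 * real r ^ d" by (simp add: C2_def power_mult_distrib mult_ac)
      then show ?thesis using True by (simp add: pos_divide_le_eq)
    qed
    have lt: "Y ^ d * (1 / veronese_norm d n z) \<le> Y ^ d * 2 ^ d / real r ^ d"
      using mult_left_mono[OF bounds(2), of "Y ^ d"] Y0 by (simp add: r_def)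
    have lx: "Y ^ d * F x \<le> Y ^ d * 2 ^ d / real r ^ d"
    proof -
      have "F x \<le> 1 / real r ^ d" using bounds(1) by (simp add: F_def r_def)
      also have "\<dots> \<le> 2 ^ d / real r ^ d" by (intro divide_right_mono) auto
      finally show ?thesis using mult_left_mono[of "F x" "2 ^ d / real r ^ d" "Y ^ d"] Y0 by simp
    qed
    have z0: "0 \<le> 1 / veronese_norm d n z" by (simp add: veronese_norm_nonneg)
    have "\<bar>ver_density d n t - (if x \<in> S then Y ^ d * F x else 0)\<bar> \<le> (if L2_set z {..n} \<le> Y \<or> x \<in> S then b else 0)"
    \<comment> \<open>If exactly one of \<open>Y * t\<close> and \<open>x\<close> lies in the ball,
      their norms are on different sides of \<open>Y\<close> and differ by at most
      \<open>n + 1\<close>, so \<open>x\<close> belongs to the boundary shell.\<close>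
    proof (cases "L2_set z {..n} \<le> Y"; cases "x \<in> S")
      assume "L2_set z {..n} \<le> Y" "x \<in> S"
      have "\<bar>ver_density d n t - (if x \<in> S then Y ^ d * F x else 0)\<bar> = Y ^ d * \<bar>1 / veronese_norm d n z - F x\<bar>"
      proof -
        have "Y ^ d * (1 / veronese_norm d n z) - Y ^ d * F x = Y ^ d * (1 / veronese_norm d n z - F x)"
          by (simp only: right_diff_distrib)
        then show ?thesis unfolding h using \<open>L2_set z {..n} \<le> Y\<close> \<open>x \<in> S\<close> Y0 by (simp only: abs_mult if_True) simp
      qed
      also have "\<dots> \<le> Y ^ d * (C1 / real (sup_abs n x) ^ (d + 1))"
        using bounds(3) Y0 unfolding F_def C1_def by (intro mult_left_mono) auto
      also have "\<dots> \<le> b" using C by (simp add: b_def)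
      finally show ?thesis using \<open>x \<in> S\<close> by simp
    next
      assume a: "L2_set z {..n} \<le> Y" "x \<notin> S"
      then have e: "\<bar>vnorm n x - Y\<bar> \<le> real (n + 1)" using nrm xS by linarith
      have "Y ^ d * 2 ^ d / real r ^ d \<le> b" using edge[OF e] C1b unfolding b_def if_P[OF e] by linarith
      then show ?thesis using a lt z0 Y0 by (simp add: h)
    next
      assume a: "\<not> L2_set z {..n} \<le> Y" "x \<in> S"
      then have e: "\<bar>vnorm n x - Y\<bar> \<le> real (n + 1)" using nrm xS by linarith
      have "Y ^ d * 2 ^ d / real r ^ d \<le> b" using edge[OF e] C1b unfolding b_def if_P[OF e] by linarith
      then show ?thesis using a lx F0 Y0 by (simp add: h)
    qed (use b0 in \<open>auto simp: h\<close>)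
    also have "\<dots> \<le> (if sup_abs n x \<in> {2..nat \<lfloor>Y\<rfloor> + 1} then b else 0)" using Rin b0 by auto
    finally show ?thesis using near0 unfolding b_def by linarith
  qed
qed

text \<open>Integrating \<open>grid_approximation\<close> compares the integral with a Riemann sum.
  After multiplication by \<open>Y ^ (n + 1 - d)\<close>, the neighbourhood of the origin costs the
  constant \<open>C5\<close>, while the oscillation and the boundary shell cost
  \<open>C1 * C4\<close> and \<open>C2 * C3\<close> times
  \<open>Y ^ (n - d) * (1 + ln Y)\<close>.\<close>

lemma sum_inverse_veronese_norm:
  fixes d n :: nat
  assumes d: "0 < d" "d \<le> n"
  obtains K where "0 \<le> K"
    "\<And>Y. 1 \<le> Y \<Longrightarrow>
      \<bar>(\<Sum>x | int_vec n x \<and> x \<noteq> (\<lambda>_. 0) \<and> vnorm n x \<le> Y. 1 / veronese_norm d n (\<lambda>i. real_of_int (x i)))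
        - ver_integral d n * Y ^ (n + 1 - d)\<bar> \<le> K * (Y ^ (n - d) * (1 + ln Y))"
proof
  define C1 where "C1 = real (Ndn d n) * real d * 4 ^ d"
  define C2 :: real where "C2 = 2 ^ d * (2 * real (n + 1)) ^ d"
  define C3 where "C3 = real (n + 2) ^ n * (unit_ball_vol (real (n + 1)) * real (n + 1) * real (2 * n + 4) + 2 * lattice_const (n + 1))"
  define C4 :: real where "C4 = 4 * real (n + 1) * 6 ^ n"
  \<comment> \<open>The first summand bounds the integral of the inverse norm over the box of radius
    \<open>2 / Y\<close>, the second is \<open>Y ^ d\<close> times the volume of that box, both
    multiplied by \<open>Y ^ (n + 1 - d)\<close>.\<close>
  define C5 :: real where "C5 = 2 ^ (d + n + 2) * 2 ^ (n + 1 - d) + 4 ^ (n + 1)"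
  define K where "K = C5 + C1 * C4 + C2 * C3"
  have C: "0 \<le> C1" "0 \<le> C2" "0 \<le> C3" "0 \<le> C4" "0 \<le> C5"
    by (simp_all add: C1_def C2_def C3_def C4_def C5_def lattice_const_nonneg)
  then show "0 \<le> K" by (simp add: K_def)
  fix Y :: real
  assume Y: "1 \<le> Y"
  then have Y0: "0 < Y" by simp
  let ?M = "lborel_prod n"
  define m where "m = n + 1 - d"
  define F where "F x = 1 / veronese_norm d n (\<lambda>i. real_of_int (x i))" for x :: "nat \<Rightarrow> int"
  define S where "S = {x. int_vec n x \<and> x \<noteq> (\<lambda>_. 0) \<and> vnorm n x \<le> Y}"
  define R where "R = nat \<lfloor>Y\<rfloor> + 1"
  define T where "T = {x. int_vec n x \<and> sup_abs n x \<in> {2..R}}"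
  define edge where "edge x \<longleftrightarrow> \<bar>vnorm n x - Y\<bar> \<le> real (n + 1)" for x
  define b where "b x = Y ^ d * (C1 / real (sup_abs n x) ^ (d + 1)) + (if edge x then C2 else 0)" for x
  define near where "near t = 1 / veronese_norm d n t * indicator (sym_box n (2 / Y)) t + Y ^ d * indicator (sym_box n (2 / Y)) t" for t
  have finS: "finite S" by (rule finite_subset[OF _ finite_vnorm_le[of n Y]]) (auto simp: S_def)
  have "T \<subseteq> (\<Union>k\<in>{2..R}. {x. int_vec n x \<and> sup_abs n x = k})" by (auto simp: T_def)
  then have finT: "finite T" by (rule finite_subset) (auto intro!: card_sup_abs_shell(1))
  have ivS: "int_vec n x" if "x \<in> S" for x using that by (simp add: S_def)
  have ivT: "int_vec n x" if "x \<in> T" for x using that by (simp add: T_def)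
  have ivg: "int_vec n (grid_point n Y t)" for t by (simp add: grid_point_def int_vec_def)
  define g where "g t = (\<Sum>x\<in>S. (Y ^ d * F x) * indicator (grid_cube n Y x) t)" for t
  define W where "W t = near t + (\<Sum>x\<in>T. b x * indicator (grid_cube n Y x) t)" for t
  note gS = sum_grid_cubes[OF Y0 finS ivS] and gT = sum_grid_cubes[OF Y0 finT ivT]
  have pt: "\<bar>ver_density d n t - g t\<bar> \<le> W t" if t: "t \<in> space ?M" for t
  proof -
    have "g t = (if grid_point n Y t \<in> S then Y ^ d * F (grid_point n Y t) else 0)"
      unfolding g_def by (rule gS(1)[OF _ t])
    moreover have "W t = near t + (if grid_point n Y t \<in> T then b (grid_point n Y t) else 0)"
      unfolding W_def using gT(1)[OF _ t] by simp
    moreover have "grid_point n Y t \<in> T \<longleftrightarrow> sup_abs n (grid_point n Y t) \<in> {2..nat \<lfloor>Y\<rfloor> + 1}"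
      using ivg by (simp add: T_def R_def)
    ultimately show ?thesis
      using grid_approximation[OF d(1) Y t] unfolding F_def S_def C1_def C2_def near_def b_def edge_def by simp
  qed
  have int_g: "integrable ?M g" unfolding g_def using gS(2) by simp
  have LINT_g: "(LINT t|?M. g t) = (\<Sum>x\<in>S. Y ^ d * F x) / Y ^ (n + 1)" unfolding g_def using gS(3) by simp
  have Yb: "0 < 2 / Y" using Y0 by simp
  note box = integrable_inverse_veronese_norm_box[OF d Yb]
  have mbox: "measure ?M (sym_box n (2 / Y)) = (4 / Y) ^ (n + 1)"
    using emeasure_sym_box[of "2 / Y" n] Y0 by (simp add: measure_def del: power_Suc)
  have int_box: "integrable ?M (\<lambda>t. Y ^ d * indicator (sym_box n (2 / Y)) t)"
    using emeasure_sym_box[of "2 / Y" n] Y0 by (intro integrable_mult_right integrable_real_indicator) auto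
  have int_near: "integrable ?M near" unfolding near_def by (intro Bochner_Integration.integrable_add box(1) int_box)
  have LINT_near: "(LINT t|?M. near t) \<le> 2 ^ (d + n + 2) * (2 / Y) ^ m + Y ^ d * (4 / Y) ^ (n + 1)"
  proof -
    have "sym_box n (2 / Y) \<inter> space ?M = sym_box n (2 / Y)" using sets.sets_into_space[OF sym_box_sets] by blast
    then have "(LINT t|?M. Y ^ d * indicator (sym_box n (2 / Y)) t) = Y ^ d * (4 / Y) ^ (n + 1)"
      using mbox by simp
    then show ?thesis unfolding near_def using Bochner_Integration.integral_add[OF box(1) int_box] box(2) by (simp add: m_def)
  qed
  have int_W: "integrable ?M W" unfolding W_def using int_near gT(2) by (intro Bochner_Integration.integrable_add) auto
  have LINT_W: "(LINT t|?M. W t) \<le> 2 ^ (d + n + 2) * (2 / Y) ^ m + Y ^ d * (4 / Y) ^ (n + 1) + (\<Sum>x\<in>T. b x) / Y ^ (n + 1)"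
    unfolding W_def using Bochner_Integration.integral_add[OF int_near gT(2)[of b]] gT(3)[of b] LINT_near by simp
  have int_v: "integrable ?M (ver_density d n)" by (rule integrable_ver_density[OF d])
  have "\<bar>ver_integral d n - (\<Sum>x\<in>S. Y ^ d * F x) / Y ^ (n + 1)\<bar> = \<bar>LINT t|?M. ver_density d n t - g t\<bar>"
    using int_v int_g LINT_g by (simp add: ver_integral_def ver_density_def[abs_def])
  also have "\<dots> \<le> (LINT t|?M. \<bar>ver_density d n t - g t\<bar>)" by (rule integral_abs_bound)
  also have "\<dots> \<le> (LINT t|?M. W t)"
    using int_v int_g int_W pt by (intro integral_mono) auto
  finally have dif: "\<bar>ver_integral d n - (\<Sum>x\<in>S. Y ^ d * F x) / Y ^ (n + 1)\<bar>
     \<le> 2 ^ (d + n + 2) * (2 / Y) ^ m + Y ^ d * (4 / Y) ^ (n + 1) + (\<Sum>x\<in>T. b x) / Y ^ (n + 1)"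
    using LINT_W by linarith
  have Ypow: "Y ^ (n + 1) = Y ^ m * Y ^ d" using d by (simp add: m_def flip: power_add)
  have Ym: "0 < Y ^ m" "0 < Y ^ d" using Y0 by auto
  have "(\<Sum>x\<in>S. Y ^ d * F x) / Y ^ (n + 1) = (\<Sum>x\<in>S. F x) / Y ^ m"
    using Ym Y0 unfolding Ypow by (simp flip: sum_distrib_left)
  then have "\<bar>(\<Sum>x\<in>S. F x) - ver_integral d n * Y ^ m\<bar> = \<bar>ver_integral d n - (\<Sum>x\<in>S. Y ^ d * F x) / Y ^ (n + 1)\<bar> * Y ^ m"
  proof -
    assume e: "(\<Sum>x\<in>S. Y ^ d * F x) / Y ^ (n + 1) = (\<Sum>x\<in>S. F x) / Y ^ m"
    have "(ver_integral d n - (\<Sum>x\<in>S. F x) / Y ^ m) * Y ^ m = ver_integral d n * Y ^ m - (\<Sum>x\<in>S. F x)"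
      using Ym Y0 by (simp add: left_diff_distrib)
    then have "\<bar>ver_integral d n - (\<Sum>x\<in>S. F x) / Y ^ m\<bar> * Y ^ m = \<bar>ver_integral d n * Y ^ m - (\<Sum>x\<in>S. F x)\<bar>"
      using Ym by (metis abs_mult abs_of_pos)
    then show ?thesis unfolding e by (simp add: abs_minus_commute)
  qed
  also have "\<dots> \<le> (2 ^ (d + n + 2) * (2 / Y) ^ m + Y ^ d * (4 / Y) ^ (n + 1) + (\<Sum>x\<in>T. b x) / Y ^ (n + 1)) * Y ^ m"
    using dif Ym by (intro mult_right_mono) auto
  also have "\<dots> = C5 + (\<Sum>x\<in>T. b x) / Y ^ d"
  proof -
    have "2 ^ (d + n + 2) * (2 / Y) ^ m * Y ^ m = 2 ^ (d + n + 2) * 2 ^ m" using Ym Y0 by (simp add: power_divide)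
    moreover have "Y ^ d * (4 / Y) ^ (n + 1) * Y ^ m = 4 ^ (n + 1)" using Ym Y0 Ypow by (simp add: power_divide mult_ac)
    moreover have "(\<Sum>x\<in>T. b x) / Y ^ (n + 1) * Y ^ m = (\<Sum>x\<in>T. b x) / Y ^ d" using Ym Y0 unfolding Ypow by simp
    ultimately show ?thesis by (simp only: distrib_right C5_def m_def)
  qed
  also have "(\<Sum>x\<in>T. b x) / Y ^ d = C1 * (\<Sum>x\<in>T. 1 / real (sup_abs n x) ^ (d + 1)) + C2 * real (card {x\<in>T. edge x}) / Y ^ d"
  proof -
    have "(\<Sum>x\<in>T. b x) = (\<Sum>x\<in>T. Y ^ d * C1 * (1 / real (sup_abs n x) ^ (d + 1))) + (\<Sum>x\<in>T. if edge x then C2 else 0)"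
      unfolding b_def sum.distrib by simp
    also have "(\<Sum>x\<in>T. if edge x then C2 else 0) = C2 * real (card {x\<in>T. edge x})"
      using finT by (simp add: sum.inter_filter[symmetric])
    also have "(\<Sum>x\<in>T. Y ^ d * C1 * (1 / real (sup_abs n x) ^ (d + 1))) = Y ^ d * C1 * (\<Sum>x\<in>T. 1 / real (sup_abs n x) ^ (d + 1))"
      by (simp only: sum_distrib_left)
    finally show ?thesis using Ym Y0 by (simp only: add_divide_distrib) simp
  qed
  also have "(\<Sum>x\<in>T. 1 / real (sup_abs n x) ^ (d + 1)) \<le> C4 * (Y ^ (n - d) * (1 + ln Y))"
    unfolding C4_def using Y d(2) finT by (intro sum_inverse_sup_abs_powers_le) (auto simp: T_def R_def)
  also have "C2 * real (card {x\<in>T. edge x}) / Y ^ d \<le> C2 * (C3 * (Y ^ (n - d) * (1 + ln Y)))"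
  proof -
    have "{x. int_vec n x \<and> edge x} \<subseteq> {x. int_vec n x \<and> vnorm n x \<le> Y + real (n + 1)}" by (auto simp: edge_def)
    then have "finite {x. int_vec n x \<and> edge x}" by (rule finite_subset) (rule finite_vnorm_le)
    then have "card {x\<in>T. edge x} \<le> card {x. int_vec n x \<and> edge x}" using ivT by (intro card_mono) auto
    then have "real (card {x\<in>T. edge x}) \<le> C3 * Y ^ n"
      using count_thin_shell[OF Y, of n] unfolding C3_def edge_def by linarith
    also have "Y ^ n = Y ^ (n - d) * Y ^ d" using d by (simp flip: power_add)
    finally have "real (card {x\<in>T. edge x}) / Y ^ d \<le> C3 * Y ^ (n - d)"
      using Ym by (simp add: pos_divide_le_eq mult.assoc)
    also have "\<dots> \<le> C3 * (Y ^ (n - d) * (1 + ln Y))"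
      using C Y by (intro mult_left_mono) (auto simp: distrib_left)
    finally have "C2 * (real (card {x\<in>T. edge x}) / Y ^ d) \<le> C2 * (C3 * (Y ^ (n - d) * (1 + ln Y)))"
      using C by (intro mult_left_mono)
    then show ?thesis by simp
  qed
  finally have "\<bar>(\<Sum>x\<in>S. F x) - ver_integral d n * Y ^ m\<bar>
      \<le> C5 + (C1 * (C4 * (Y ^ (n - d) * (1 + ln Y))) + C2 * (C3 * (Y ^ (n - d) * (1 + ln Y))))"
    using C by (simp add: mult_left_mono)
  also have "C5 \<le> C5 * (Y ^ (n - d) * (1 + ln Y))"
  proof -
    have "1 * 1 \<le> Y ^ (n - d) * (1 + ln Y)" using Y by (intro mult_mono) auto
    then show ?thesis using C mult_left_mono[of 1 "Y ^ (n - d) * (1 + ln Y)" C5] by simp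
  qed
  also have "C5 * (Y ^ (n - d) * (1 + ln Y)) + (C1 * (C4 * (Y ^ (n - d) * (1 + ln Y))) + C2 * (C3 * (Y ^ (n - d) * (1 + ln Y))))
      = K * (Y ^ (n - d) * (1 + ln Y))" by (simp only: K_def distrib_right mult.assoc add.assoc)
  finally show "\<bar>(\<Sum>x | int_vec n x \<and> x \<noteq> (\<lambda>_. 0) \<and> vnorm n x \<le> Y. 1 / veronese_norm d n (\<lambda>i. real_of_int (x i)))
        - ver_integral d n * Y ^ (n + 1 - d)\<bar> \<le> K * (Y ^ (n - d) * (1 + ln Y))"
    by (simp add: S_def F_def m_def)
qed

section \<open>Primitive vectors\<close>

text \<open>The weight is homogeneous of degree \<open>-d\<close>, so Moebius inversion leads to the
  terms \<open>k ^ (- d) * S (X / k)\<close>, where \<open>S\<close> sums over all nonzero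
  vectors.\<close>

lemma sum_primitive_inverse_veronese_norm:
  fixes d n :: nat
  assumes d: "2 \<le> d" "d \<le> n"
  obtains K where "0 \<le> K"
    "\<And>X. 1 \<le> X \<Longrightarrow>
      \<bar>(\<Sum>x | prim_vec n x \<and> vnorm n x \<le> X. 1 / veronese_norm d n (\<lambda>i. real_of_int (x i)))
        - ver_integral d n * X ^ (n + 1 - d) / zeta_nat (n + 1)\<bar> \<le> K * (X ^ (n - d) * (1 + ln X))"
proof -
  have d0: "0 < d" using d by simp
  define F where "F x = 1 / veronese_norm d n (\<lambda>i. real_of_int (x i))" for x :: "nat \<Rightarrow> int"
  define S where "S Y = (\<Sum>x | int_vec n x \<and> x \<noteq> (\<lambda>_. 0) \<and> vnorm n x \<le> Y. F x)" for Y
  obtain K where K: "0 \<le> K" "\<And>Y. 1 \<le> Y \<Longrightarrow> \<bar>S Y - ver_integral d n * Y ^ (n + 1 - d)\<bar> \<le> K * (Y ^ (n - d) * (1 + ln Y))"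
    unfolding S_def F_def using sum_inverse_veronese_norm[OF d0 d(2)] by blast
  define I where "I = ver_integral d n"
  have I: "0 < I" unfolding I_def by (rule ver_integral_pos[OF d0 d(2)])
  show ?thesis
  proof
    show "0 \<le> 2 * K + 8 * I" using K I by simp
    fix X :: real
    assume X: "1 \<le> X"
    then have X0: "0 < X" "0 \<le> ln X" by auto
    \<comment> \<open>The factor \<open>(X / k) ^ d\<close> raises the exponent of the main term
      from \<open>n + 1 - d\<close>, which may be 1, to \<open>n + 1 >= 3\<close>, as
      \<open>moebius_transform_asymptotic\<close> demands; division by \<open>X ^ d\<close> undoes
      it.\<close>
    define R where "R k = (X / real k) ^ d * S (X / real k)" for k :: nat
    have Fk: "F (\<lambda>i. int k * x i) = F x / real k ^ d" for k x
      using veronese_norm_scale[of "real k" d n "\<lambda>i. real_of_int (x i)"] by (simp add: F_def)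
    have "{x. prim_vec n x \<and> vnorm n x \<le> X} = {x. x \<in> {x. int_vec n x} \<and> Gcd (x ` {..n}) = 1 \<and> vnorm n x \<le> X}"
      by (auto simp: prim_vec_def)
    then have "(\<Sum>x | prim_vec n x \<and> vnorm n x \<le> X. F x) = (\<Sum>x | x \<in> {x. int_vec n x} \<and> Gcd (x ` {..n}) = 1 \<and> vnorm n x \<le> X. F x)"
      by simp
    also have "\<dots> = (\<Sum>k\<in>{1..nat \<lfloor>X\<rfloor>}. moebius_mu k * (\<Sum>x | x \<in> {x. int_vec n x} \<and> x \<noteq> (\<lambda>_. 0) \<and> vnorm n x \<le> X / real k. F (\<lambda>i. int k * x i)))"
      unfolding vnorm_eq_L2_set using X by (intro sum_primitive_eq_moebius_sum) (auto simp: int_vec_def)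
    also have "\<dots> = (\<Sum>k\<in>{1..nat \<lfloor>X\<rfloor>}. moebius_mu k * R k / X ^ d)"
    proof (rule sum.cong[OF refl])
      fix k assume "k \<in> {1..nat \<lfloor>X\<rfloor>}"
      have "(\<Sum>x | x \<in> {x. int_vec n x} \<and> x \<noteq> (\<lambda>_. 0) \<and> vnorm n x \<le> X / real k. F (\<lambda>i. int k * x i)) = S (X / real k) / real k ^ d"
        by (simp add: Fk S_def sum_divide_distrib)
      then show "moebius_mu k * (\<Sum>x | x \<in> {x. int_vec n x} \<and> x \<noteq> (\<lambda>_. 0) \<and> vnorm n x \<le> X / real k. F (\<lambda>i. int k * x i)) = moebius_mu k * R k / X ^ d"
        using X0 by (simp add: R_def power_divide)
    qed
    also have "\<dots> = (\<Sum>k\<in>{1..nat \<lfloor>X\<rfloor>}. moebius_mu k * R k) / X ^ d" by (simp only: sum_divide_distrib)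
    finally have sum_eq: "(\<Sum>x | prim_vec n x \<and> vnorm n x \<le> X. F x) = (\<Sum>k\<in>{1..nat \<lfloor>X\<rfloor>}. moebius_mu k * R k) / X ^ d" .
    have "\<bar>(\<Sum>k\<in>{1..nat \<lfloor>X\<rfloor>}. moebius_mu k * R k) - I * X ^ (n + 1) / zeta_nat (n + 1)\<bar>
       \<le> 2 * (K * (1 + ln X)) * X ^ (n + 1 - 1) + 8 * I * X ^ (n + 1) / X"
    proof (rule moebius_transform_asymptotic)
      fix k assume k: "1 \<le> k" "real k \<le> X"
      define Y where "Y = X / real k"
      have Y: "1 \<le> Y" "Y \<le> X" using k X0 by (auto simp: Y_def field_simps)
      have "\<bar>Y ^ d * S Y - I * Y ^ (n + 1)\<bar> = Y ^ d * \<bar>S Y - I * Y ^ (n + 1 - d)\<bar>"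
      proof -
        have "Y ^ (n + 1) = Y ^ d * Y ^ (n + 1 - d)" using d by (simp flip: power_add)
        then have "Y ^ d * S Y - I * Y ^ (n + 1) = Y ^ d * (S Y - I * Y ^ (n + 1 - d))" by (simp only: right_diff_distrib mult_ac)
        then show ?thesis using Y by (simp add: abs_mult)
      qed
      also have "\<dots> \<le> Y ^ d * (K * (Y ^ (n - d) * (1 + ln Y)))"
        using K(2)[OF Y(1)] Y unfolding I_def by (intro mult_left_mono) auto
      \<comment> \<open>Replacing \<open>ln Y\<close> by \<open>ln X\<close> makes the error
        constant the same for all \<open>k\<close>.\<close>
      also have "\<dots> \<le> Y ^ d * (K * (Y ^ (n - d) * (1 + ln X)))"
        using Y K(1) by (intro mult_left_mono add_left_mono) auto
      also have "\<dots> = K * (1 + ln X) * (Y ^ d * Y ^ (n - d))" by (simp only: mult_ac)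
      also have "Y ^ d * Y ^ (n - d) = Y ^ n" using d by (simp flip: power_add)
      finally show "\<bar>R k - I * (X / real k) ^ (n + 1)\<bar> \<le> K * (1 + ln X) * (X / real k) ^ (n + 1 - 1)"
        by (simp add: R_def Y_def)
    qed (use d X X0 I K in auto)
    also have "\<dots> \<le> (2 * K + 8 * I) * (X ^ n * (1 + ln X))"
    proof -
      have "8 * I * X ^ (n + 1) / X = 8 * I * (X ^ n * 1)" using X0 by simp
      also have "\<dots> \<le> 8 * I * (X ^ n * (1 + ln X))" using X0 I by (intro mult_left_mono) auto
      finally show ?thesis by (simp add: algebra_simps)
    qed
    finally have est: "\<bar>(\<Sum>k\<in>{1..nat \<lfloor>X\<rfloor>}. moebius_mu k * R k) - I * X ^ (n + 1) / zeta_nat (n + 1)\<bar> \<le> (2 * K + 8 * I) * (X ^ n * (1 + ln X))" .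
    have Xd: "0 < X ^ d" using X0 by simp
    have p1: "X ^ (n + 1) = X ^ (n + 1 - d) * X ^ d" and p2: "X ^ n = X ^ (n - d) * X ^ d"
      using d by (simp_all flip: power_add)
    have "\<bar>(\<Sum>x | prim_vec n x \<and> vnorm n x \<le> X. F x) - I * X ^ (n + 1 - d) / zeta_nat (n + 1)\<bar>
      = \<bar>(\<Sum>k\<in>{1..nat \<lfloor>X\<rfloor>}. moebius_mu k * R k) - I * X ^ (n + 1) / zeta_nat (n + 1)\<bar> / X ^ d"
    proof -
      have "(\<Sum>x | prim_vec n x \<and> vnorm n x \<le> X. F x) - I * X ^ (n + 1 - d) / zeta_nat (n + 1)
        = ((\<Sum>k\<in>{1..nat \<lfloor>X\<rfloor>}. moebius_mu k * R k) - I * X ^ (n + 1) / zeta_nat (n + 1)) / X ^ d"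
        unfolding sum_eq p1 diff_divide_distrib using Xd X0 by simp
      then show ?thesis using Xd by (simp only: abs_divide)
    qed
    also have "\<dots> \<le> (2 * K + 8 * I) * (X ^ n * (1 + ln X)) / X ^ d" using est Xd by (intro divide_right_mono) auto
    also have "\<dots> = (2 * K + 8 * I) * (X ^ (n - d) * (1 + ln X))" unfolding p2 using Xd X0 by simp
    finally show "\<bar>(\<Sum>x | prim_vec n x \<and> vnorm n x \<le> X. 1 / veronese_norm d n (\<lambda>i. real_of_int (x i)))
        - ver_integral d n * X ^ (n + 1 - d) / zeta_nat (n + 1)\<bar> \<le> (2 * K + 8 * I) * (X ^ (n - d) * (1 + ln X))"
      by (simp add: F_def I_def)
  qed
qed

section \<open>Counting all primitive coefficient vectors\<close>

lemma finite_cnorm_le: "finite {a. coeff_vec d n a \<and> cnorm d n a \<le> T}"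
  using finite_bounded_int_vectors[OF finite_mons[of d n], of T] by (simp add: coeff_vec_def cnorm_eq_L2_set)

lemma primitive_coeff_count:
  fixes d n :: nat
  defines "N \<equiv> Ndn d n"
  assumes d: "2 \<le> d" "d \<le> n" and A: "1 \<le> A"
  shows "\<bar>real (card {a. prim_coeff d n a \<and> cnorm d n a \<le> A}) - unit_ball_vol (real N) * A ^ N / zeta_nat N\<bar>
    \<le> (2 * (lattice_const N + 1) + 8 * unit_ball_vol (real N)) * A ^ (N - 1)"
proof -
  have N: "5 \<le> N" using Ndn_ge[OF d] d by (simp add: N_def)
  define R where "R T = real (card {a. coeff_vec d n a \<and> a \<noteq> (\<lambda>_. 0) \<and> cnorm d n a \<le> T})" for T
  have "{a. prim_coeff d n a \<and> cnorm d n a \<le> A} = {a. a \<in> {a. coeff_vec d n a} \<and> Gcd (a ` mons d n) = 1 \<and> cnorm d n a \<le> A}"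
    by (auto simp: prim_coeff_def)
  then have "real (card {a. prim_coeff d n a \<and> cnorm d n a \<le> A}) = (\<Sum>a | a \<in> {a. coeff_vec d n a} \<and> Gcd (a ` mons d n) = 1 \<and> cnorm d n a \<le> A. 1)"
    by simp
  also have "\<dots> = (\<Sum>k\<in>{1..nat \<lfloor>A\<rfloor>}. moebius_mu k * (\<Sum>a | a \<in> {a. coeff_vec d n a} \<and> a \<noteq> (\<lambda>_. 0) \<and> cnorm d n a \<le> A / real k. 1))"
    unfolding cnorm_eq_L2_set using A finite_mons by (intro sum_primitive_eq_moebius_sum) (auto simp: coeff_vec_def)
  also have "\<dots> = (\<Sum>k\<in>{1..nat \<lfloor>A\<rfloor>}. moebius_mu k * R (A / real k))" by (simp add: R_def)
  finally have eq: "real (card {a. prim_coeff d n a \<and> cnorm d n a \<le> A}) = (\<Sum>k\<in>{1..nat \<lfloor>A\<rfloor>}. moebius_mu k * R (A / real k))" .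
  \<comment> \<open>The added 1 in the constant pays for the zero vector.\<close>
  have RT: "\<bar>R T - unit_ball_vol (real N) * T ^ N\<bar> \<le> (lattice_const N + 1) * T ^ (N - 1)" if T: "1 \<le> T" for T
  proof -
    have ne: "mons d n \<noteq> {}" using card_mons[of d n] N by (auto simp: N_def)
    have cnt: "\<bar>real (card {a. coeff_vec d n a \<and> cnorm d n a \<le> T}) - unit_ball_vol (real N) * T ^ N\<bar> \<le> lattice_const N * T ^ (N - 1)"
      using count_int_vectors[OF finite_mons ne T] by (simp add: card_mons N_def coeff_vec_def cnorm_eq_L2_set)
    have z: "(\<lambda>_. 0) \<in> {a. coeff_vec d n a \<and> cnorm d n a \<le> T}" using T by (simp add: coeff_vec_def cnorm_def)
    have "{a. coeff_vec d n a \<and> a \<noteq> (\<lambda>_. 0) \<and> cnorm d n a \<le> T} = {a. coeff_vec d n a \<and> cnorm d n a \<le> T} - {\<lambda>_. 0}" by auto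
    then have "card {a. coeff_vec d n a \<and> a \<noteq> (\<lambda>_. 0) \<and> cnorm d n a \<le> T} = card {a. coeff_vec d n a \<and> cnorm d n a \<le> T} - 1"
      using z by (simp add: card_Diff_singleton)
    moreover have "1 \<le> card {a. coeff_vec d n a \<and> cnorm d n a \<le> T}"
      using z finite_cnorm_le[of d n T] by (auto simp: Suc_le_eq card_gt_0_iff)
    ultimately have "R T = real (card {a. coeff_vec d n a \<and> cnorm d n a \<le> T}) - 1" by (simp add: R_def of_nat_diff)
    moreover have "1 \<le> T ^ (N - 1)" using T by (rule one_le_power)
    moreover have "(lattice_const N + 1) * T ^ (N - 1) = lattice_const N * T ^ (N - 1) + T ^ (N - 1)" by (simp add: distrib_right)
    ultimately show ?thesis using cnt by linarith
  qed
  have "\<bar>(\<Sum>k\<in>{1..nat \<lfloor>A\<rfloor>}. moebius_mu k * R (A / real k)) - unit_ball_vol (real N) * A ^ N / zeta_nat N\<bar>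
     \<le> 2 * (lattice_const N + 1) * A ^ (N - 1) + 8 * unit_ball_vol (real N) * A ^ N / A"
  proof (rule moebius_transform_asymptotic)
    fix k assume k: "1 \<le> k" "real k \<le> A"
    then have "1 \<le> A / real k" by (simp add: field_simps)
    then show "\<bar>R (A / real k) - unit_ball_vol (real N) * (A / real k) ^ N\<bar> \<le> (lattice_const N + 1) * (A / real k) ^ (N - 1)"
      by (rule RT)
  qed (use N A lattice_const_nonneg[of N] in auto)
  also have "\<dots> = (2 * (lattice_const N + 1) + 8 * unit_ball_vol (real N)) * A ^ (N - 1)"
    using N A by (cases N) (auto simp: algebra_simps)
  finally show ?thesis unfolding eq .
qed

text \<open>The asymptotics is informative only from some \<open>A0\<close> on. Below it
  \<open>A ^ N\<close> is bounded, so that a single primitive vector is enough.\<close>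

lemma primitive_coeff_count_lower:
  fixes d n :: nat
  assumes d: "2 \<le> d" "d \<le> n"
  obtains c where "0 < c" "\<And>A. 1 \<le> A \<Longrightarrow> c * A ^ Ndn d n \<le> real (card {a. prim_coeff d n a \<and> cnorm d n a \<le> A})"
proof
  define N where "N = Ndn d n"
  define v where "v = unit_ball_vol (real N) / zeta_nat N"
  define K where "K = 2 * (lattice_const N + 1) + 8 * unit_ball_vol (real N)"
  \<comment> \<open>For \<open>A >= A0\<close> the error \<open>K * A ^ (N - 1)\<close> is at most
    half of the main term \<open>v * A ^ N\<close>.\<close>
  define A0 where "A0 = 2 * K / v"
  have N: "5 \<le> N" using Ndn_ge[OF d] d by (simp add: N_def)
  have v: "0 < v" using zeta_nat_ge_1[of N] N by (simp add: v_def)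
  have K: "0 \<le> K" using lattice_const_nonneg[of N] by (simp add: K_def)
  have A0: "0 \<le> A0" using K v by (simp add: A0_def)
  define c where "c = min (v / 2) (1 / (A0 ^ N + 1))"
  have pos: "0 < A0 ^ N + 1" using A0 by (simp add: add_nonneg_pos)
  then show "0 < c" using v by (simp add: c_def)
  fix A :: real
  assume A: "1 \<le> A"
  define Q where "Q = real (card {a. prim_coeff d n a \<and> cnorm d n a \<le> A})"
  have AN: "A ^ N = A * A ^ (N - 1)" using N by (cases N) auto
  have "c * A ^ N \<le> Q"
  proof (cases "A0 \<le> A")
    case True
    have "\<bar>Q - v * A ^ N\<bar> \<le> K * A ^ (N - 1)"
      using primitive_coeff_count[OF d A] by (simp add: Q_def v_def K_def N_def)
    moreover have "K * A ^ (N - 1) \<le> v / 2 * A ^ N"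
    proof -
      have "K \<le> v / 2 * A" using True v by (simp add: A0_def field_simps)
      then show ?thesis unfolding AN using A by (simp add: mult_right_mono flip: mult.assoc)
    qed
    ultimately have "v / 2 * A ^ N \<le> Q" by linarith
    moreover have "c * A ^ N \<le> v / 2 * A ^ N" using A by (intro mult_right_mono) (auto simp: c_def)
    ultimately show ?thesis by linarith
  next
    case False
    \<comment> \<open>The form consisting of one pure power with coefficient 1 has a primitive
      coefficient vector of norm 1.\<close>
    define q where "q = pure_mon d 0"
    have q: "q \<in> mons d n" by (simp add: q_def pure_mon_in_mons)
    define e :: "(nat \<Rightarrow> nat) \<Rightarrow> int" where "e = (\<lambda>i. if i = q then 1 else 0)"
    have "Gcd (e ` mons d n) dvd e q" using q by (intro Gcd_dvd) auto
    then have "Gcd (e ` mons d n) = 1" by (simp add: e_def)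
    moreover have "cnorm d n e = 1"
    proof -
      have "(\<Sum>i\<in>mons d n. (real_of_int (e i))\<^sup>2) = (\<Sum>i\<in>mons d n. if i = q then 1 else 0)"
        by (intro sum.cong) (auto simp: e_def)
      then show ?thesis using q finite_mons by (simp add: cnorm_def)
    qed
    ultimately have "e \<in> {a. prim_coeff d n a \<and> cnorm d n a \<le> A}"
      using A q by (auto simp: prim_coeff_def coeff_vec_def e_def)
    moreover have "finite {a. prim_coeff d n a \<and> cnorm d n a \<le> A}"
      by (rule finite_subset[OF _ finite_cnorm_le[of d n A]]) (auto simp: prim_coeff_def)
    ultimately have "1 \<le> card {a. prim_coeff d n a \<and> cnorm d n a \<le> A}"
      by (auto simp: Suc_le_eq card_gt_0_iff)
    then have "1 \<le> Q" by (simp add: Q_def)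
    moreover have "c * A ^ N \<le> 1 / (A0 ^ N + 1) * (A0 ^ N + 1)"
    proof (rule mult_mono)
      have "A ^ N \<le> A0 ^ N" using False A by (intro power_mono) auto
      then show "A ^ N \<le> A0 ^ N + 1" by simp
    qed (use pos A in \<open>auto simp: c_def\<close>)
    ultimately show ?thesis using pos by simp
  qed
  then show "c * A ^ Ndn d n \<le> real (card {a. prim_coeff d n a \<and> cnorm d n a \<le> A})" by (simp add: Q_def N_def)
qed

text \<open>Each class has exactly two members because \<open>a\<close> is nonzero, whence the
  factor 2.\<close>

lemma sum_over_sign_classes:
  fixes S :: "('a \<Rightarrow> int) set" and g :: "('a \<Rightarrow> int) set \<Rightarrow> real"
  assumes S: "finite S" and neg: "\<And>a. a \<in> S \<Longrightarrow> - a \<in> S" and nz: "\<And>a. a \<in> S \<Longrightarrow> a \<noteq> (\<lambda>_. 0)"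
  shows "2 * (\<Sum>V\<in>(\<lambda>a. {a, - a}) ` S. g V) = (\<Sum>a\<in>S. g {a, - a})"
proof -
  let ?p = "\<lambda>a :: 'a \<Rightarrow> int. {a, - a}"
  have mm: "- (- a) = a" for a :: "'a \<Rightarrow> int" by (simp add: fun_eq_iff)
  have ne: "- a \<noteq> a" if "a \<in> S" for a
  proof
    assume e: "- a = a"
    have "a i = 0" for i using fun_cong[OF e, of i] by simp
    then show False using nz[OF that] by auto
  qed
  have "(\<Sum>a\<in>S. g (?p a)) = (\<Sum>V\<in>?p ` S. \<Sum>a\<in>{a\<in>S. ?p a = V}. g (?p a))"
    using S by (rule sum.image_gen)
  also have "\<dots> = (\<Sum>V\<in>?p ` S. 2 * g V)"
  proof (rule sum.cong[OF refl])
    fix V assume "V \<in> ?p ` S"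
    then obtain a where a: "a \<in> S" "V = ?p a" by auto
    have "{a'\<in>S. ?p a' = V} = {a, - a}"
    proof (intro equalityI subsetI)
      fix b assume "b \<in> {a'\<in>S. ?p a' = V}"
      then have "b \<in> V" by auto
      then show "b \<in> {a, - a}" using a by simp
    next
      fix b assume "b \<in> {a, - a}"
      then show "b \<in> {a'\<in>S. ?p a' = V}" using a neg[OF a(1)] by (auto simp: mm)
    qed
    moreover have "(\<Sum>a\<in>{a'\<in>S. ?p a' = V}. g (?p a)) = (\<Sum>a\<in>{a'\<in>S. ?p a' = V}. g V)"
      by (rule sum.cong) auto
    ultimately show "(\<Sum>a\<in>{a'\<in>S. ?p a' = V}. g (?p a)) = 2 * g V"
      using ne[OF a(1)] by (auto simp: card_insert_if)
  qed
  finally show ?thesis by (simp add: sum_distrib_left)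
qed

section \<open>The average number of points\<close>

text \<open>Hypersurfaces and points are replaced by primitive vectors \<open>a\<close> and
  \<open>x\<close>; each is met twice, which makes a factor 4 for the pairs. Vanishing of the form
  is independent of both signs, and \<open>X ^ (n + 1 - d) = B\<close> turns the height condition
  into \<open>vnorm n x <= X\<close>.\<close>

lemma sum_NV_eq:
  fixes d n :: nat and A B X :: real
  assumes d: "0 < d" "d \<le> n" and X: "0 \<le> X" "X ^ (n + 1 - d) = B"
  defines "SA \<equiv> {a. prim_coeff d n a \<and> cnorm d n a \<le> A}"
    and "SX \<equiv> {x. prim_vec n x \<and> vnorm n x \<le> X}"
  shows "4 * (\<Sum>V\<in>hyps d n A. real (NV d n V B))
      = (\<Sum>x\<in>SX. real (card {a. prim_coeff d n a \<and> form_eval d n a x = 0 \<and> cnorm d n a \<le> A}))"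
    and "2 * real (card (hyps d n A)) = real (card SA)"
    and "finite SX"
proof -
  have finA: "finite SA"
    by (rule finite_subset[OF _ finite_cnorm_le[of d n A]]) (auto simp: SA_def prim_coeff_def)
  show finX: "finite SX"
    by (rule finite_subset[OF _ finite_vnorm_le[of n X]]) (auto simp: SX_def prim_vec_def)
  have Gneg: "Gcd ((- a) ` U) = Gcd (a ` U)" for a :: "'b \<Rightarrow> int" and U
  proof -
    have "(- a) ` U = uminus ` (a ` U)" by (simp add: image_image)
    moreover have "Gcd (uminus ` Z) = Gcd Z" for Z :: "int set"
      by (rule associated_eqI) (auto intro!: Gcd_greatest simp: dvd_Gcd_iff)
    ultimately show ?thesis by simp
  qed
  have negA: "- a \<in> SA" if "a \<in> SA" for a
    using that Gneg[of a "mons d n"] by (simp add: SA_def prim_coeff_def coeff_vec_def cnorm_def)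
  have nzA: "a \<noteq> (\<lambda>_. 0)" if "a \<in> SA" for a
  proof
    assume "a = (\<lambda>_. 0)"
    then have g: "Gcd (a ` mons d n) = 0" by (auto simp: Gcd_0_iff)
    show False using that by (simp add: SA_def prim_coeff_def g del: Gcd_0_iff)
  qed
  have hyps: "hyps d n A = (\<lambda>a. {a, - a}) ` SA" by (auto simp: hyps_def SA_def)
  note pairs = sum_over_sign_classes[of SA, OF finA negA nzA]
  show "2 * real (card (hyps d n A)) = real (card SA)"
    using pairs[of "\<lambda>_. 1"] by (simp add: hyps)
  have even: "form_eval d n (- a) x = - form_eval d n a x" for a x
    by (simp add: form_eval_def sum_negf)
  have odd: "form_eval d n a (- x) = (- 1) ^ d * form_eval d n a x" for a x
  proof -
    have "form_eval d n a (- x) = (\<Sum>e\<in>mons d n. (- 1) ^ d * (a e * (\<Prod>i\<le>n. x i ^ e i)))"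
      unfolding form_eval_def
    proof (rule sum.cong[OF refl])
      fix e assume e: "e \<in> mons d n"
      have "(\<Prod>i\<le>n. (- x) i ^ e i) = (\<Prod>i\<le>n. (- 1) ^ e i * x i ^ e i)"
        by (intro prod.cong refl) (simp add: power_minus[of "x _"])
      also have "\<dots> = (\<Prod>i\<le>n. (- 1) ^ e i) * (\<Prod>i\<le>n. x i ^ e i)" by (rule prod.distrib)
      also have "(\<Prod>i\<le>n. (- 1 :: int) ^ e i) = (- 1) ^ d" using e by (simp only: mons_def mem_Collect_eq flip: power_sum)
      finally show "a e * (\<Prod>i\<le>n. (- x) i ^ e i) = (- 1) ^ d * (a e * (\<Prod>i\<le>n. x i ^ e i))" by simp
    qed
    then show ?thesis by (simp add: form_eval_def sum_distrib_left)
  qed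
  have height: "vnorm n x ^ (n + 1 - d) \<le> B \<longleftrightarrow> vnorm n x \<le> X" for x
  proof -
    have "0 \<le> vnorm n x" by (simp add: vnorm_def sum_nonneg)
    then show ?thesis unfolding X(2)[symmetric] using X(1) d by (intro power_mono_iff) auto
  qed
  have NV: "2 * real (NV d n {a, - a} B) = real (card {x\<in>SX. form_eval d n a x = 0})" for a
  proof -
    let ?S = "{x\<in>SX. form_eval d n a x = 0}"
    have "NV d n {a, - a} B = card ((\<lambda>x. {x, - x}) ` ?S)"
      unfolding NV_def height by (rule arg_cong[where f = card]) (auto simp: SX_def even)
    moreover have "2 * (\<Sum>V\<in>(\<lambda>x. {x, - x}) ` ?S. 1) = (\<Sum>x\<in>?S. (1::real))"
    proof (rule sum_over_sign_classes)
      show "finite ?S" using finX by simp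
      show "- x \<in> ?S" if "x \<in> ?S" for x
        using that Gneg[of x "{..n}"] odd[of a x] by (simp add: SX_def prim_vec_def int_vec_def vnorm_def)
      show "x \<noteq> (\<lambda>_. 0)" if "x \<in> ?S" for x
      proof
        assume "x = (\<lambda>_. 0)"
        then have g: "Gcd (x ` {..n}) = 0" by (auto simp: Gcd_0_iff)
        show False using that by (simp add: SX_def prim_vec_def g del: Gcd_0_iff)
      qed
    qed
    ultimately show ?thesis by simp
  qed
  have "4 * (\<Sum>V\<in>hyps d n A. real (NV d n V B)) = 2 * (2 * (\<Sum>V\<in>(\<lambda>a. {a, - a}) ` SA. real (NV d n V B)))"
    by (simp add: hyps)
  also have "\<dots> = (\<Sum>a\<in>SA. 2 * real (NV d n {a, - a} B))"
    by (subst pairs, assumption, rule sum_distrib_left)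
  also have "\<dots> = (\<Sum>a\<in>SA. \<Sum>x\<in>SX. if form_eval d n a x = 0 then 1 else 0)"
    unfolding NV using finX by (simp add: sum.inter_filter[symmetric])
  also have "\<dots> = (\<Sum>x\<in>SX. \<Sum>a\<in>SA. if form_eval d n a x = 0 then 1 else 0)" by (rule sum.swap)
  also have "\<dots> = (\<Sum>x\<in>SX. real (card {a. prim_coeff d n a \<and> form_eval d n a x = 0 \<and> cnorm d n a \<le> A}))"
  proof (rule sum.cong[OF refl])
    fix x
    have "{a\<in>SA. form_eval d n a x = 0} = {a. prim_coeff d n a \<and> form_eval d n a x = 0 \<and> cnorm d n a \<le> A}"
      by (auto simp: SA_def)
    then show "(\<Sum>a\<in>SA. if form_eval d n a x = 0 then 1 else 0) = real (card {a. prim_coeff d n a \<and> form_eval d n a x = 0 \<and> cnorm d n a \<le> A})"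
      using finA by (simp add: sum.inter_filter[symmetric])
  qed
  finally show "4 * (\<Sum>V\<in>hyps d n A. real (NV d n V B))
      = (\<Sum>x\<in>SX. real (card {a. prim_coeff d n a \<and> form_eval d n a x = 0 \<and> cnorm d n a \<le> A}))" .
qed

text \<open>The relative error \<open>X / A\<close> comes from adding up the errors of the lattice
  counts over shells, and \<open>(1 + ln X) / X\<close> from the sum of the inverse norms in the
  main terms.\<close>

lemma sum_primitive_coeff_lattice_counts:
  fixes d n :: nat
  defines "M \<equiv> Ndn d n - 1"
  assumes d: "2 \<le> d" "d \<le> n"
  obtains K where "0 \<le> K"
    "\<And>X A. 1 \<le> X \<Longrightarrow> X \<le> A \<Longrightarrow>
      \<bar>(\<Sum>x | prim_vec n x \<and> vnorm n x \<le> X. real (card {a. prim_coeff d n a \<and> form_eval d n a x = 0 \<and> cnorm d n a \<le> A}))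
        - unit_ball_vol (real M) / zeta_nat M * (ver_integral d n / zeta_nat (n + 1)) * A ^ M * X ^ (n + 1 - d)\<bar>
      \<le> K * (A ^ M * X ^ (n + 1 - d)) * (X / A + (1 + ln X) / X)"
proof -
  obtain K1 where K1: "0 \<le> K1"
    "\<And>x p A. prim_vec n x \<Longrightarrow> p \<le> n \<Longrightarrow> x p \<noteq> 0 \<Longrightarrow> (\<And>i. i \<le> n \<Longrightarrow> \<bar>x i\<bar> \<le> \<bar>x p\<bar>) \<Longrightarrow>
      \<bar>real_of_int (x p)\<bar> \<le> A \<Longrightarrow>
      \<bar>real (card {a. prim_coeff d n a \<and> form_eval d n a x = 0 \<and> cnorm d n a \<le> A})
        - unit_ball_vol (real M) / veronese_norm d n (\<lambda>i. real_of_int (x i)) * A ^ M / zeta_nat M\<bar>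
      \<le> K1 * A ^ (M - 1) * (\<bar>real_of_int (x p)\<bar> / \<bar>real_of_int (x p)\<bar> ^ d)"
    using primitive_coeff_lattice_count[OF d] unfolding M_def by blast
  obtain K2 where K2: "0 \<le> K2"
    "\<And>X. 1 \<le> X \<Longrightarrow>
      \<bar>(\<Sum>x | prim_vec n x \<and> vnorm n x \<le> X. 1 / veronese_norm d n (\<lambda>i. real_of_int (x i)))
        - ver_integral d n * X ^ (n + 1 - d) / zeta_nat (n + 1)\<bar> \<le> K2 * (X ^ (n - d) * (1 + ln X))"
    using sum_primitive_inverse_veronese_norm[OF d] by blast
  define c where "c = 2 * real (n + 1) * 3 ^ n"
  define V where "V = unit_ball_vol (real M) / zeta_nat M"
  have M: "4 \<le> M" using Ndn_ge[OF d] d by (simp add: M_def)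
  have V: "0 \<le> V" using zeta_nat_ge_1[of M] M by (simp add: V_def)
  have c: "0 \<le> c" by (simp add: c_def)
  show ?thesis
  proof
    show "0 \<le> K1 * c + V * K2" using K1 K2 V c by simp
    fix X A :: real
    assume X: "1 \<le> X" and XA: "X \<le> A"
    define SX where "SX = {x. prim_vec n x \<and> vnorm n x \<le> X}"
    define p where "p x = real (card {a. prim_coeff d n a \<and> form_eval d n a x = 0 \<and> cnorm d n a \<le> A})" for x
    define F where "F x = 1 / veronese_norm d n (\<lambda>i. real_of_int (x i))" for x :: "nat \<Rightarrow> int"
    define m where "m = n + 1 - d"
    have X0: "0 < X" and A0: "0 < A" using X XA by auto
    have finX: "finite SX"
      by (rule finite_subset[OF _ finite_vnorm_le[of n X]]) (auto simp: SX_def prim_vec_def)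
    have pt: "\<bar>p x - V * A ^ M * F x\<bar> \<le> K1 * A ^ (M - 1) * (real (sup_abs n x) / real (sup_abs n x) ^ d)"
      and sup: "int_vec n x \<and> sup_abs n x \<in> {1..nat \<lfloor>X\<rfloor>}" if x: "x \<in> SX" for x
    proof -
      obtain q where q: "q \<le> n" "nat \<bar>x q\<bar> = sup_abs n x" by (rule sup_abs_attained)
      have max: "\<bar>x i\<bar> \<le> \<bar>x q\<bar>" if "i \<le> n" for i using abs_le_sup_abs[OF that, of x] q(2) by linarith
      have iv: "int_vec n x" using x by (simp add: SX_def prim_vec_def)
      have "x q \<noteq> 0"
      proof
        assume "x q = 0"
        then have "x i = 0" if "i \<le> n" for i using max[OF that] by simp
        then have g: "Gcd (x ` {..n}) = 0" by (auto simp: Gcd_0_iff)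
        show False using x by (simp add: SX_def prim_vec_def g del: Gcd_0_iff)
      qed
      have le: "real (sup_abs n x) \<le> X" using sup_abs_le_vnorm[of n x] x by (simp add: SX_def)
      have xq: "\<bar>real_of_int (x q)\<bar> = real (sup_abs n x)" using q(2) by linarith
      show "\<bar>p x - V * A ^ M * F x\<bar> \<le> K1 * A ^ (M - 1) * (real (sup_abs n x) / real (sup_abs n x) ^ d)"
        using K1(2)[of x q A] x q(1) \<open>x q \<noteq> 0\<close> max le XA unfolding xq
        by (simp add: SX_def p_def V_def F_def mult_ac)
      have "1 \<le> sup_abs n x" using q(2) \<open>x q \<noteq> 0\<close> by linarith
      moreover have "sup_abs n x \<le> nat \<lfloor>X\<rfloor>" using le by (rule le_nat_floor)
      ultimately show "int_vec n x \<and> sup_abs n x \<in> {1..nat \<lfloor>X\<rfloor>}" using iv by simp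
    qed
    have "\<bar>(\<Sum>x\<in>SX. p x) - V * A ^ M * (\<Sum>x\<in>SX. F x)\<bar> = \<bar>\<Sum>x\<in>SX. p x - V * A ^ M * F x\<bar>"
      by (simp only: sum_subtractf sum_distrib_left)
    also have "\<dots> \<le> (\<Sum>x\<in>SX. \<bar>p x - V * A ^ M * F x\<bar>)" by (rule sum_abs)
    also have "\<dots> \<le> (\<Sum>x\<in>SX. K1 * A ^ (M - 1) * (real (sup_abs n x) / real (sup_abs n x) ^ d))" by (intro sum_mono pt)
    also have "\<dots> = K1 * A ^ (M - 1) * (\<Sum>x\<in>SX. real (sup_abs n x) / real (sup_abs n x) ^ d)" by (simp only: sum_distrib_left)
    also have "(\<Sum>x\<in>SX. real (sup_abs n x) / real (sup_abs n x) ^ d) \<le> c * (\<Sum>k\<in>{1..nat \<lfloor>X\<rfloor>}. real k ^ n * (real k / real k ^ d))"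
      unfolding c_def using finX sup by (intro sum_over_shells_le[where \<phi> = "\<lambda>k. real k / real k ^ d"]) auto
    also have "(\<Sum>k\<in>{1..nat \<lfloor>X\<rfloor>}. real k ^ n * (real k / real k ^ d)) \<le> (\<Sum>k\<in>{1..nat \<lfloor>X\<rfloor>}. X ^ m)"
    proof (rule sum_mono)
      fix k assume k: "k \<in> {1..nat \<lfloor>X\<rfloor>}"
      have "real k ^ n * real k = real k ^ m * real k ^ d" using d by (simp add: m_def flip: power_add power_Suc2)
      then have "real k ^ n * (real k / real k ^ d) = real k ^ m" using k by simp
      also have "\<dots> \<le> X ^ m"
      proof (rule power_mono)
        have "k \<le> nat \<lfloor>X\<rfloor>" using k by simp
        then show "real k \<le> X" using X by linarith
      qed simp
      finally show "real k ^ n * (real k / real k ^ d) \<le> X ^ m" .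
    qed
    also have "\<dots> = real (nat \<lfloor>X\<rfloor>) * X ^ m" by simp
    also have "\<dots> \<le> X * X ^ m" using X by (intro mult_right_mono) auto
    finally have e1: "\<bar>(\<Sum>x\<in>SX. p x) - V * A ^ M * (\<Sum>x\<in>SX. F x)\<bar> \<le> K1 * A ^ (M - 1) * (c * (X * X ^ m))"
      using K1 A0 c by (simp add: mult_left_mono)
    have "\<bar>V * A ^ M * (\<Sum>x\<in>SX. F x) - V * (ver_integral d n / zeta_nat (n + 1)) * A ^ M * X ^ m\<bar>
        = V * A ^ M * \<bar>(\<Sum>x\<in>SX. F x) - ver_integral d n * X ^ m / zeta_nat (n + 1)\<bar>"
    proof -
      have "V * A ^ M * (\<Sum>x\<in>SX. F x) - V * (ver_integral d n / zeta_nat (n + 1)) * A ^ M * X ^ m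
        = V * A ^ M * ((\<Sum>x\<in>SX. F x) - ver_integral d n * X ^ m / zeta_nat (n + 1))"
        by (simp add: right_diff_distrib)
      then show ?thesis using V A0 by (simp only: abs_mult) simp
    qed
    also have "\<dots> \<le> V * A ^ M * (K2 * (X ^ (n - d) * (1 + ln X)))"
      using K2(2)[OF X] V A0 unfolding SX_def F_def m_def by (intro mult_left_mono) auto
    finally have e2: "\<bar>V * A ^ M * (\<Sum>x\<in>SX. F x) - V * (ver_integral d n / zeta_nat (n + 1)) * A ^ M * X ^ m\<bar>
      \<le> V * A ^ M * (K2 * (X ^ (n - d) * (1 + ln X)))" .
    have AM: "A ^ (M - 1) = A ^ M / A" using M A0 by (cases M) auto
    have Xm: "X ^ (n - d) = X ^ m / X" using d X0 by (simp add: m_def Suc_diff_le)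
    define u where "u = A ^ M * X ^ m"
    have u: "0 \<le> u" using A0 X0 by (simp add: u_def)
    have l: "0 \<le> X / A" "0 \<le> (1 + ln X) / X" using X A0 X0 by auto
    have "K1 * A ^ (M - 1) * (c * (X * X ^ m)) = K1 * c * u * (X / A)" unfolding AM u_def by simp
    moreover have "V * A ^ M * (K2 * (X ^ (n - d) * (1 + ln X))) = V * K2 * u * ((1 + ln X) / X)" by (simp add: Xm u_def)
    moreover have "K1 * c * u * (X / A) \<le> K1 * c * u * (X / A + (1 + ln X) / X)"
      "V * K2 * u * ((1 + ln X) / X) \<le> V * K2 * u * (X / A + (1 + ln X) / X)"
      using K1(1) K2(1) V c u l by (intro mult_left_mono; simp)+
    moreover have "(K1 * c + V * K2) * u * (X / A + (1 + ln X) / X)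
        = K1 * c * u * (X / A + (1 + ln X) / X) + V * K2 * u * (X / A + (1 + ln X) / X)" by (simp only: distrib_right)
    ultimately have "\<bar>(\<Sum>x\<in>SX. p x) - V * (ver_integral d n / zeta_nat (n + 1)) * A ^ M * X ^ m\<bar>
      \<le> (K1 * c + V * K2) * u * (X / A + (1 + ln X) / X)" using e1 e2 by linarith
    then show "\<bar>(\<Sum>x | prim_vec n x \<and> vnorm n x \<le> X. real (card {a. prim_coeff d n a \<and> form_eval d n a x = 0 \<and> cnorm d n a \<le> A}))
        - unit_ball_vol (real M) / zeta_nat M * (ver_integral d n / zeta_nat (n + 1)) * A ^ M * X ^ (n + 1 - d)\<bar>
      \<le> (K1 * c + V * K2) * (A ^ M * X ^ (n + 1 - d)) * (X / A + (1 + ln X) / X)"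
      by (simp add: SX_def p_def V_def u_def m_def)
  qed
qed

text \<open>The difference splits as \<open>(T - \<kappa> * u) / Q\<close> plus
  \<open>\<kappa> * u\<close> times \<open>(v * w - Q) / (Q * v * w)\<close>. The lower bound
  \<open>c * w <= Q\<close> stands in for smallness of the relative error of \<open>Q\<close>, which
  may fail when \<open>A\<close> is close to 1.\<close>

lemma quotient_asymptotic:
  fixes T Q \<kappa> v c u w \<epsilon> \<eta> K3 K4 :: real
  assumes Q: "c * w \<le> Q" "\<bar>Q - v * w\<bar> \<le> K4 * \<eta> * w" and T: "\<bar>T - \<kappa> * u\<bar> \<le> K3 * u * \<epsilon>"
    and pos: "0 < c" "0 < v" "0 < w" "0 \<le> u" "0 \<le> \<kappa>" "0 \<le> K3" "0 \<le> K4" "0 \<le> \<eta>" "\<eta> \<le> \<epsilon>"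
  shows "\<bar>T / Q - \<kappa> / v * (u / w)\<bar> \<le> (K3 / c + \<kappa> * K4 / (c * v)) * (u / w) * \<epsilon>"
proof -
  have cw: "0 < c * w" using pos by simp
  then have Q0: "0 < Q" using Q by linarith
  have \<epsilon>: "0 \<le> \<epsilon>" using pos by linarith
  have "T / Q - \<kappa> / v * (u / w) = (T - \<kappa> * u) / Q + \<kappa> * u * ((v * w - Q) / (Q * (v * w)))"
    using Q0 pos by (simp add: field_simps)
  then have "\<bar>T / Q - \<kappa> / v * (u / w)\<bar> \<le> \<bar>T - \<kappa> * u\<bar> / Q + \<kappa> * u * (\<bar>Q - v * w\<bar> / (Q * (v * w)))"
    using abs_triangle_ineq[of "(T - \<kappa> * u) / Q" "\<kappa> * u * ((v * w - Q) / (Q * (v * w)))"] Q0 pos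
    by (simp add: abs_mult abs_minus_commute)
  also have "\<bar>T - \<kappa> * u\<bar> / Q \<le> K3 * u * \<epsilon> / (c * w)"
    using T Q cw Q0 pos \<epsilon> by (intro frac_le) auto
  also have "\<kappa> * u * (\<bar>Q - v * w\<bar> / (Q * (v * w))) \<le> \<kappa> * u * (K4 * \<epsilon> * w / (c * w * (v * w)))"
  proof (intro mult_left_mono frac_le mult_right_mono)
    have "K4 * \<eta> * w \<le> K4 * \<epsilon> * w" using pos by (intro mult_right_mono mult_left_mono) auto
    then show "\<bar>Q - v * w\<bar> \<le> K4 * \<epsilon> * w" using Q(2) by linarith
  qed (use Q cw pos \<epsilon> in auto)
  also have "K3 * u * \<epsilon> / (c * w) + \<kappa> * u * (K4 * \<epsilon> * w / (c * w * (v * w))) = (K3 / c + \<kappa> * K4 / (c * v)) * (u / w) * \<epsilon>"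
    using pos by (simp add: field_simps)
  finally show ?thesis by simp
qed

theorem theorem2:
  fixes d n :: nat
  assumes "2 \<le> d" and "d \<le> n"
  shows "Cdn d n > 0 \<and>
    (\<exists>K::real. \<forall>B A::real. 2 \<le> B \<longrightarrow> B powr (1 / real (n + 1 - d)) \<le> A \<longrightarrow>
       \<bar>(\<Sum>V\<in>hyps d n A. real (NV d n V B)) / real (card (hyps d n A)) - Cdn d n * B / A\<bar>
         \<le> K * (Cdn d n * B / A) *
            (B powr (1 / real (n + 1 - d)) / A + ln B / B powr (1 / real (n + 1 - d))))"
proof -
  note d = assms
  define N where "N = Ndn d n"
  define M where "M = N - 1"
  define m where "m = n + 1 - d"
  define \<kappa> where "\<kappa> = unit_ball_vol (real M) / zeta_nat M * (ver_integral d n / zeta_nat (n + 1))"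
  define v where "v = unit_ball_vol (real N) / zeta_nat N"
  define K4 where "K4 = 2 * (lattice_const N + 1) + 8 * unit_ball_vol (real N)"
  have N: "5 \<le> N" using Ndn_ge[OF d] d by (simp add: N_def)
  have z: "1 \<le> zeta_nat N" "1 \<le> zeta_nat M" "1 \<le> zeta_nat (n + 1)"
    using N d by (auto intro!: zeta_nat_ge_1 simp: M_def)
  have I: "0 < ver_integral d n" using d by (intro ver_integral_pos) auto
  have \<kappa>: "0 < \<kappa>" and v: "0 < v" using z I by (simp_all add: \<kappa>_def v_def)
  have K4: "0 \<le> K4" using lattice_const_nonneg[of N] by (simp add: K4_def)
  \<comment> \<open>The factor 1/2 arises because the numerator counts each incident pair of classes
    four times and the denominator each class twice.\<close>
  have C: "Cdn d n = \<kappa> / v / 2"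
    unfolding Cdn_def \<kappa>_def v_def N_def[symmetric] M_def[symmetric] using z by (simp add: field_simps)
  then have C0: "0 < Cdn d n" using \<kappa> v by simp
  obtain K3 where K3: "0 \<le> K3"
    "\<And>X A. 1 \<le> X \<Longrightarrow> X \<le> A \<Longrightarrow>
      \<bar>(\<Sum>x | prim_vec n x \<and> vnorm n x \<le> X. real (card {a. prim_coeff d n a \<and> form_eval d n a x = 0 \<and> cnorm d n a \<le> A}))
        - \<kappa> * A ^ M * X ^ m\<bar> \<le> K3 * (A ^ M * X ^ m) * (X / A + (1 + ln X) / X)"
    using sum_primitive_coeff_lattice_counts[OF d] unfolding \<kappa>_def M_def N_def m_def by blast
  obtain c where c: "0 < c" "\<And>A. 1 \<le> A \<Longrightarrow> c * A ^ N \<le> real (card {a. prim_coeff d n a \<and> cnorm d n a \<le> A})"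
    using primitive_coeff_count_lower[OF d] unfolding N_def by blast
  define K where "K = (K3 / c + \<kappa> * K4 / (c * v)) / 2"
  have K0: "0 \<le> K" using K3 c \<kappa> K4 v by (simp add: K_def)
  have "\<bar>(\<Sum>V\<in>hyps d n A. real (NV d n V B)) / real (card (hyps d n A)) - Cdn d n * B / A\<bar>
       \<le> 3 * K / Cdn d n * (Cdn d n * B / A) *
          (B powr (1 / real (n + 1 - d)) / A + ln B / B powr (1 / real (n + 1 - d)))"
    if B: "2 \<le> B" and A: "B powr (1 / real (n + 1 - d)) \<le> A" for B A
  proof -
    define X where "X = B powr (1 / real m)"
    have m: "1 \<le> m" using d by (simp add: m_def)
    have X1: "1 \<le> X" unfolding X_def using B by (intro ge_one_powr_ge_zero) auto
    have XA: "X \<le> A" using A by (simp add: X_def m_def)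
    have X0: "0 < X" and A0: "0 < A" and A1: "1 \<le> A" using X1 XA by auto
    have XB: "X ^ m = B" using m B by (simp add: X_def powr_powr flip: powr_realpow)
    have lnX: "ln X \<le> ln B"
    proof -
      have "X ^ 1 \<le> X ^ m" using X1 m by (intro power_increasing) auto
      then show ?thesis using X0 B by (simp add: XB)
    qed
    \<comment> \<open>This yields \<open>1 <= 2 * ln B\<close>, hence
      \<open>1 + ln X <= 3 * ln B\<close>, the origin of the 3 in the final constant.\<close>
    have ln2: "1 / 2 \<le> ln B"
    proof -
      have "1 / 2 \<le> ln (2 :: real)" using ln_le_minus_one[of "1 / 2"] by (simp add: ln_div)
      also have "\<dots> \<le> ln B" using B by simp
      finally show ?thesis .
    qed
    define T where "T = (\<Sum>x | prim_vec n x \<and> vnorm n x \<le> X. real (card {a. prim_coeff d n a \<and> form_eval d n a x = 0 \<and> cnorm d n a \<le> A}))"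
    define Q where "Q = real (card {a. prim_coeff d n a \<and> cnorm d n a \<le> A})"
    define \<epsilon> where "\<epsilon> = X / A + (1 + ln X) / X"
    have d0: "0 < d" using d by simp
    note NV = sum_NV_eq(1,2)[OF d0 d(2) less_imp_le[OF X0] XB[unfolded m_def], of A, folded T_def Q_def]
    have AN: "A ^ N = A * A ^ M" using N by (cases N) (auto simp: M_def)
    \<comment> \<open>The quotient lemma is applied with \<open>u = A ^ M * X ^ m\<close>,
      \<open>w = A ^ N\<close> and \<eta> equal to \<open>1 / A\<close>, which is at most
      \<open>X / A\<close> as \<open>X >= 1\<close>.\<close>
    have "\<bar>T / Q - \<kappa> / v * (A ^ M * X ^ m / A ^ N)\<bar> \<le> (K3 / c + \<kappa> * K4 / (c * v)) * (A ^ M * X ^ m / A ^ N) * \<epsilon>"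
    proof (rule quotient_asymptotic)
      show "c * A ^ N \<le> Q" unfolding Q_def using A1 by (rule c(2))
      show "\<bar>Q - v * A ^ N\<bar> \<le> K4 * (1 / A) * A ^ N"
      proof -
        have "K4 * (1 / A) * A ^ N = K4 * A ^ (N - 1)" unfolding AN M_def using A0 by simp
        then show ?thesis using primitive_coeff_count[OF d A1] by (simp add: Q_def v_def K4_def N_def)
      qed
      show "\<bar>T - \<kappa> * (A ^ M * X ^ m)\<bar> \<le> K3 * (A ^ M * X ^ m) * \<epsilon>"
        using K3(2)[OF X1 XA] by (simp add: T_def \<epsilon>_def mult.assoc)
      have "1 / A \<le> X / A" using X1 A0 by (intro divide_right_mono) auto
      moreover have "0 \<le> (1 + ln X) / X" using X1 by simp
      ultimately show "1 / A \<le> \<epsilon>" by (simp add: \<epsilon>_def)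
    qed (use c v \<kappa> K3 K4 A0 X0 in auto)
    also have "A ^ M * X ^ m / A ^ N = B / A" unfolding AN XB using A0 by simp
    also have "K3 / c + \<kappa> * K4 / (c * v) = 2 * K"
    proof -
      have "z = 2 * (z / 2)" for z :: real by simp
      then show ?thesis unfolding K_def .
    qed
    finally have TQ: "\<bar>T / Q - \<kappa> / v * (B / A)\<bar> \<le> 2 * K * (B / A) * \<epsilon>" .
    have ratio: "(\<Sum>V\<in>hyps d n A. real (NV d n V B)) / real (card (hyps d n A)) = T / Q / 2"
    proof -
      have "(\<Sum>V\<in>hyps d n A. real (NV d n V B)) = T / 4" "real (card (hyps d n A)) = Q / 2"
        using NV(1,2) by simp_all
      then show ?thesis by (simp only:) simp
    qed
    have "(\<Sum>V\<in>hyps d n A. real (NV d n V B)) / real (card (hyps d n A)) - Cdn d n * B / A = (T / Q - \<kappa> / v * (B / A)) / 2"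
      unfolding ratio C by simp
    then have "\<bar>(\<Sum>V\<in>hyps d n A. real (NV d n V B)) / real (card (hyps d n A)) - Cdn d n * B / A\<bar>
        = \<bar>T / Q - \<kappa> / v * (B / A)\<bar> / 2" by (simp only: abs_divide)
    also have "\<dots> \<le> 2 * K * (B / A) * \<epsilon> / 2" using TQ by (rule divide_right_mono) simp
    also have "\<dots> = K * (B / A) * \<epsilon>" by simp
    finally have "\<bar>(\<Sum>V\<in>hyps d n A. real (NV d n V B)) / real (card (hyps d n A)) - Cdn d n * B / A\<bar> \<le> K * (B / A) * \<epsilon>" .
    also have "\<dots> \<le> K * (B / A) * (3 * (X / A + ln B / X))"
    proof (rule mult_left_mono)
      have "(1 + ln X) / X \<le> 3 * ln B / X" using lnX ln2 X0 by (intro divide_right_mono) auto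
      moreover have "0 \<le> X / A" using X0 A0 by simp
      ultimately show "\<epsilon> \<le> 3 * (X / A + ln B / X)" by (simp add: \<epsilon>_def)
    qed (use K0 B A0 in simp)
    \<comment> \<open>Division by the positive constant \<open>Cdn d n\<close> expresses the bound
      relative to the main term.\<close>
    also have "\<dots> = 3 * K / Cdn d n * (Cdn d n * B / A) * (X / A + ln B / X)" using C0 by simp
    finally show ?thesis by (simp only: X_def m_def)
  qed
  then show ?thesis using C0 by blast
qed

end
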